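(* Let $\Gamma$ be a (discrete) group acting by graph automorphisms on a countable fine hyperbolic graph $K$ with finite quotient. Let $Y$ be a compact space on which $\Gamma$ acts. Assume that, for every vertex $x$ of $K$, the restricted action of the vertex stabilizer $\Gamma^x=\{s\in\Gamma : sx=x\}$ on $Y$ is amenable. Then the diagonal action of $\Gamma$ on $\Delta K\times Y$ is amenable.
   Context: Conventions: compact spaces are Hausdorff, and group actions on topological spaces are by homeomorphisms. Graphs: $K$ is a connected graph with vertex set $V(K)$ and edge set $E(K)$, without loops or multiple edges, and $d$ is the path metric on $V(K)$. A finite path of length $n$ is a sequence $x_0x_1\cdots x_n$ of vertices with each $x_i$ equal or adjacent to $x_{i+1}$; infinite and biinfinite paths are defined analogously. A circuit is a closed path ($x_0=x_n$) with $x_0,\dots,x_{n-1}$ distinct. A finite, infinite or biinfinite path $\alpha$ is geodesic if $d(\alpha(m),\alpha(n))=|m-n|$ for all $m,n$. The Gromov product is $\langle x,y\rangle_z=\frac12(d(x,z)+d(y,z)-d(x,y))$. $K$ is hyperbolic if there is $\delta>0$ such that for any finite geodesic paths $\alpha$ and $\beta$ starting at a common vertex $z$ and ending at $\alpha_+$ and $\beta_+$, and any $k\le\langle\alpha_+,\beta_+\rangle_z$, one has $d(\alpha(k),\beta(k))<\delta$. $K$ is fine if for every $n$ and every edge $e\in E(K)$, the set of circuits of length at most $n$ containing $e$ is finite. The action of $\Gamma$ on $K$ has finite quotient if there are finitely many orbits of vertices and of edges. The compactification $\Delta K$: two infinite geodesic paths are equivalent if their Hausdorff distance is finite; $\partial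 K$ is the set of equivalence classes of infinite geodesic paths, and $\Delta K=V(K)\cup\partial K$. An infinite geodesic path $x_0x_1\cdots$ connects $x_0$ to its class; a biinfinite geodesic path $\cdots x_{-1}x_0x_1\cdots$ connects the class of $x_0x_{-1}x_{-2}\cdots$ to the class of $x_0x_1\cdots$. For $x,y\in\Delta K$, $\mathcal F(x,y)$ is the set of all geodesic paths connecting $x$ to $y$ (up to reversal of direction). For $x\in\Delta K$ and finite $A\subset V(K)$, let $M(x,A)$ be the set of $z\in\Delta K$ such that no $\alpha\in\mathcal F(x,z)$ meets $A\setminus\{x\}$. The topology of $\Delta K$ is the one in which $\{M(x,A)\}_A$ is a neighborhood base at each $x\in\Delta K$. With it, $\Delta K$ is a compact space (Bowditch), $V(K)$ is dense in it, and every graph automorphism of $K$ extends uniquely to a homeomorphism of $\Delta K$; this gives the action of $\Gamma$ on $\Delta K$. Amenable action: for a discrete group $G$, $\mathrm{Prob}(G)=\{\mu\in\ell_1(G):\mu\ge0,\ \sum_{s}\mu(s)=1\}$ with the pointwise convergence topology (which coincides with the $\ell_1$-norm topology), and $(s\cdot\mu)(t)=\mu(s^{-1}t)$. An action of $G$ on a compact space $\Omega$ is amenable if for every finite $E\subset G$ and $\varepsilon>0$ there is a continuous map $\mu\colon\Omega\to\mathrm{Prob}(G)$, $\omega\mapsto\mu_\omega$, with $\max_{s\in E}\sup_{\omega\in\Omega}\|s\cdot\mu_\omega-\mu_{s\omega}\|_1\le\varepsilon$. *)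

theory Defs
  imports "HOL-Analysis.Analysis" "HOL-Algebra.Group_Action"
begin

section \<open>Connected simple graphs\<close>

locale connected_graph =
  fixes V :: "'v set" and E :: "'v set set"
  assumes edges: "e \<in> E \<Longrightarrow> \<exists>x\<in>V. \<exists>y\<in>V. x \<noteq> y \<and> e = {x, y}"
    and connected: "x \<in> V \<Longrightarrow> y \<in> V \<Longrightarrow>
      \<exists>p. p \<noteq> [] \<and> set p \<subseteq> V \<and> hd p = x \<and> last p = y \<and>
          (\<forall>i. Suc i < length p \<longrightarrow> p ! i = p ! Suc i \<or> {p ! i, p ! Suc i} \<in> E)"
begin

text \<open>A finite path \<open>x\<^sub>0 \<dots> x\<^sub>n\<close> of length \<open>n\<close> is the list of its \<open>n + 1\<close> vertices.\<close>

definition finite_path :: "'v list \<Rightarrow> bool" where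
  "finite_path p \<longleftrightarrow> p \<noteq> [] \<and> set p \<subseteq> V \<and>
     (\<forall>i. Suc i < length p \<longrightarrow> p ! i = p ! Suc i \<or> {p ! i, p ! Suc i} \<in> E)"

definition infinite_path :: "(nat \<Rightarrow> 'v) \<Rightarrow> bool" where
  "infinite_path \<alpha> \<longleftrightarrow> range \<alpha> \<subseteq> V \<and> (\<forall>i. \<alpha> i = \<alpha> (Suc i) \<or> {\<alpha> i, \<alpha> (Suc i)} \<in> E)"

definition biinfinite_path :: "(int \<Rightarrow> 'v) \<Rightarrow> bool" where
  "biinfinite_path \<alpha> \<longleftrightarrow> range \<alpha> \<subseteq> V \<and> (\<forall>i. \<alpha> i = \<alpha> (i + 1) \<or> {\<alpha> i, \<alpha> (i + 1)} \<in> E)"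

definition circuit :: "'v list \<Rightarrow> bool" where
  "circuit p \<longleftrightarrow> finite_path p \<and> hd p = last p \<and> distinct (butlast p)"

definition path_contains_edge :: "'v list \<Rightarrow> 'v set \<Rightarrow> bool" where
  "path_contains_edge p e \<longleftrightarrow> (\<exists>i. Suc i < length p \<and> {p ! i, p ! Suc i} = e)"

definition graph_dist :: "'v \<Rightarrow> 'v \<Rightarrow> nat" where
  "graph_dist x y = (LEAST n. \<exists>p. finite_path p \<and> hd p = x \<and> last p = y \<and> length p = Suc n)"

definition finite_geodesic :: "'v list \<Rightarrow> bool" where
  "finite_geodesic p \<longleftrightarrow> finite_path p \<and>
     (\<forall>m<length p. \<forall>n<length p. int (graph_dist (p ! m) (p ! n)) = \<bar>int m - int n\<bar>)"

definition infinite_geodesic :: "(nat \<Rightarrow> 'v) \<Rightarrow> bool" where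
  "infinite_geodesic \<alpha> \<longleftrightarrow> infinite_path \<alpha> \<and>
     (\<forall>m n. int (graph_dist (\<alpha> m) (\<alpha> n)) = \<bar>int m - int n\<bar>)"

definition biinfinite_geodesic :: "(int \<Rightarrow> 'v) \<Rightarrow> bool" where
  "biinfinite_geodesic \<alpha> \<longleftrightarrow> biinfinite_path \<alpha> \<and>
     (\<forall>m n. int (graph_dist (\<alpha> m) (\<alpha> n)) = \<bar>m - n\<bar>)"

definition gromov_product :: "'v \<Rightarrow> 'v \<Rightarrow> 'v \<Rightarrow> real" where
  "gromov_product x y z =
     (real (graph_dist x z) + real (graph_dist y z) - real (graph_dist x y)) / 2"

text \<open>The bound \<open>k \<le> \<langle>\<alpha>\<^sub>+, \<beta>\<^sub>+\<rangle>\<^sub>z\<close> forces \<open>k\<close> to be at most the length of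
  both paths, so the list accesses below are in range.\<close>

definition hyperbolic_graph :: bool where
  "hyperbolic_graph \<longleftrightarrow> (\<exists>\<delta>::real. \<delta> > 0 \<and>
     (\<forall>z \<alpha> \<beta>. finite_geodesic \<alpha> \<and> finite_geodesic \<beta> \<and> hd \<alpha> = z \<and> hd \<beta> = z \<longrightarrow>
        (\<forall>k::nat. real k \<le> gromov_product (last \<alpha>) (last \<beta>) z \<longrightarrow>
           real (graph_dist (\<alpha> ! k) (\<beta> ! k)) < \<delta>)))"

definition fine_graph :: bool where
  "fine_graph \<longleftrightarrow> (\<forall>n. \<forall>e\<in>E. finite {p. circuit p \<and> length p - 1 \<le> n \<and> path_contains_edge p e})"

section \<open>The compactification\<close>

text \<open>Two rays are related iff the Hausdorff distance of their vertex sets is finite.\<close>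

definition ray_equiv :: "((nat \<Rightarrow> 'v) \<times> (nat \<Rightarrow> 'v)) set" where
  "ray_equiv = {(\<alpha>, \<beta>). infinite_geodesic \<alpha> \<and> infinite_geodesic \<beta> \<and>
     (\<exists>C. (\<forall>m. \<exists>n. graph_dist (\<alpha> m) (\<beta> n) \<le> C) \<and> (\<forall>n. \<exists>m. graph_dist (\<alpha> m) (\<beta> n) \<le> C))}"

definition boundary :: "(nat \<Rightarrow> 'v) set set" where
  "boundary = Collect infinite_geodesic // ray_equiv"

definition delta_set :: "('v + (nat \<Rightarrow> 'v) set) set" where
  "delta_set = V <+> boundary"

end

datatype (vertices: 'v) graph_path =
  Finite "'v list" | Infinite "nat \<Rightarrow> 'v" | Biinfinite "int \<Rightarrow> 'v"
  for map: map_path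

context connected_graph
begin

text \<open>The set \<open>\<F>(x, y)\<close>. Paths are not identified with their reversals, but a geodesic between a
  vertex and a boundary point is always listed starting at the vertex; only the vertices that
  a path visits matter below.\<close>

fun geodesics :: "'v + (nat \<Rightarrow> 'v) set \<Rightarrow> 'v + (nat \<Rightarrow> 'v) set \<Rightarrow> 'v graph_path set" where
  "geodesics (Inl x) (Inl y) = {Finite p | p. finite_geodesic p \<and> hd p = x \<and> last p = y}"
| "geodesics (Inl x) (Inr c) = {Infinite \<alpha> | \<alpha>. infinite_geodesic \<alpha> \<and> \<alpha> 0 = x \<and> \<alpha> \<in> c}"
| "geodesics (Inr c) (Inl x) = {Infinite \<alpha> | \<alpha>. infinite_geodesic \<alpha> \<and> \<alpha> 0 = x \<and> \<alpha> \<in> c}"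
| "geodesics (Inr c) (Inr c') = {Biinfinite \<alpha> | \<alpha>. biinfinite_geodesic \<alpha> \<and>
     (\<lambda>n. \<alpha> (- int n)) \<in> c \<and> (\<lambda>n. \<alpha> (int n)) \<in> c'}"

definition M :: "'v + (nat \<Rightarrow> 'v) set \<Rightarrow> 'v set \<Rightarrow> ('v + (nat \<Rightarrow> 'v) set) set" where
  "M x A = {z \<in> delta_set. \<forall>\<alpha> \<in> geodesics x z. Inl ` vertices \<alpha> \<inter> (Inl ` A - {x}) = {}}"

text \<open>A set is open iff it is a neighbourhood of each of its points; by
  \<open>delta_topology_unique\<close> below, this is the only topology on the compactification
  that can have the sets \<open>M x A\<close> as a neighbourhood base at each point \<open>x\<close>.\<close>

definition delta_topology :: "('v + (nat \<Rightarrow> 'v) set) topology" where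
  "delta_topology = topology (\<lambda>U. U \<subseteq> delta_set \<and>
     (\<forall>x\<in>U. \<exists>A. finite A \<and> A \<subseteq> V \<and> M x A \<subseteq> U))"

lemma openin_delta_topology:
  "openin delta_topology U \<longleftrightarrow>
     U \<subseteq> delta_set \<and> (\<forall>x\<in>U. \<exists>A. finite A \<and> A \<subseteq> V \<and> M x A \<subseteq> U)"
proof -
  have "istopology (\<lambda>U. U \<subseteq> delta_set \<and> (\<forall>x\<in>U. \<exists>A. finite A \<and> A \<subseteq> V \<and> M x A \<subseteq> U))"
    unfolding istopology_def
  proof (intro conjI allI impI ballI)
    fix S T x
    assume S: "S \<subseteq> delta_set \<and> (\<forall>x\<in>S. \<exists>A. finite A \<and> A \<subseteq> V \<and> M x A \<subseteq> S)"
      and T: "T \<subseteq> delta_set \<and> (\<forall>x\<in>T. \<exists>A. finite A \<and> A \<subseteq> V \<and> M x A \<subseteq> T)"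
    then show "S \<inter> T \<subseteq> delta_set"
      by blast
    assume "x \<in> S \<inter> T"
    with S T obtain A B where "finite A" "A \<subseteq> V" "M x A \<subseteq> S" "finite B" "B \<subseteq> V" "M x B \<subseteq> T"
      by (meson IntD1 IntD2)
    moreover have "M x (A \<union> B) \<subseteq> M x A" "M x (A \<union> B) \<subseteq> M x B"
      unfolding M_def by blast+
    ultimately show "\<exists>A. finite A \<and> A \<subseteq> V \<and> M x A \<subseteq> S \<inter> T"
      by (intro exI[of _ "A \<union> B"]) auto
  next
    fix \<K> x
    assume *: "\<forall>K\<in>\<K>. K \<subseteq> delta_set \<and> (\<forall>x\<in>K. \<exists>A. finite A \<and> A \<subseteq> V \<and> M x A \<subseteq> K)"
    then show "\<Union>\<K> \<subseteq> delta_set"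
      by blast
    assume "x \<in> \<Union>\<K>"
    then show "\<exists>A. finite A \<and> A \<subseteq> V \<and> M x A \<subseteq> \<Union>\<K>"
      using * by (meson UnionE Union_upper subset_trans)
  qed
  then show ?thesis
    by (simp add: delta_topology_def)
qed

lemma topspace_delta_topology [simp]: "topspace delta_topology = delta_set"
proof -
  have "openin delta_topology delta_set"
    unfolding openin_delta_topology by (auto simp: M_def)
  then show ?thesis
    by (meson openin_delta_topology openin_subset openin_topspace subset_antisym)
qed

lemma delta_topology_unique:
  assumes "topspace T = delta_set"
    and "\<And>x A. x \<in> delta_set \<Longrightarrow> finite A \<Longrightarrow> A \<subseteq> V \<Longrightarrow> \<exists>W. openin T W \<and> x \<in> W \<and> W \<subseteq> M x A"
    and "\<And>x W. openin T W \<Longrightarrow> x \<in> W \<Longrightarrow> \<exists>A. finite A \<and> A \<subseteq> V \<and> M x A \<subseteq> W"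
  shows "T = delta_topology"
proof (rule topology_eq[THEN iffD2], intro allI iffI)
  fix U assume "openin T U" then show "openin delta_topology U"
    using assms(1,3) openin_subset unfolding openin_delta_topology by metis
next
  fix U assume U: "openin delta_topology U"
  have "\<exists>W. openin T W \<and> x \<in> W \<and> W \<subseteq> U" if "x \<in> U" for x
    using U that assms(2)[of x] unfolding openin_delta_topology
    by (meson subset_iff)
  then show "openin T U"
    by (subst openin_subopen) blast
qed

end

section \<open>Group actions\<close>

definition topological_action :: "'g monoid \<Rightarrow> 'x topology \<Rightarrow> ('g \<Rightarrow> 'x \<Rightarrow> 'x) \<Rightarrow> bool" where
  "topological_action G X \<theta> \<longleftrightarrow>
     group_action G (topspace X) \<theta> \<and> (\<forall>g\<in>carrier G. homeomorphic_map X X (\<theta> g))"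

locale graph_group_action =
  connected_graph V E + group_action \<Gamma> V \<phi>
  for V :: "'v set" and E :: "'v set set" and \<Gamma> :: "'g monoid" (structure) and \<phi> +
  assumes automorphism: "g \<in> carrier \<Gamma> \<Longrightarrow> x \<in> V \<Longrightarrow> y \<in> V \<Longrightarrow>
    {\<phi> g x, \<phi> g y} \<in> E \<longleftrightarrow> {x, y} \<in> E"
begin

text \<open>The extension of the action to the compactification: an element \<open>g\<close> sends the
  class of a ray to the class of the translated ray (\<open>delta_action_ray_class\<close>). This is a
  homeomorphism (\<open>topological_action_delta\<close>), and the unique one extending \<open>\<phi> g\<close> whenever
  the compactification is Hausdorff with dense vertex set (\<open>delta_action_unique\<close>).\<close>

definition delta_action :: "'g \<Rightarrow> 'v + (nat \<Rightarrow> 'v) set \<Rightarrow> 'v + (nat \<Rightarrow> 'v) set" where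
  "delta_action g = restrict (map_sum (\<phi> g) (\<lambda>c. (\<lambda>\<alpha>. \<phi> g \<circ> \<alpha>) ` c)) delta_set"

end

definition diagonal_action ::
    "'x topology \<Rightarrow> ('g \<Rightarrow> 'x \<Rightarrow> 'x) \<Rightarrow> 'y topology \<Rightarrow> ('g \<Rightarrow> 'y \<Rightarrow> 'y) \<Rightarrow> 'g \<Rightarrow> 'x \<times> 'y \<Rightarrow> 'x \<times> 'y" where
  "diagonal_action X \<theta> Y \<psi> g = restrict (map_prod (\<theta> g) (\<psi> g)) (topspace (prod_topology X Y))"

section \<open>Amenable actions\<close>

definition Prob :: "'g monoid \<Rightarrow> ('g \<Rightarrow> real) set" where
  "Prob G = {\<mu> \<in> extensional (carrier G).
     (\<forall>t\<in>carrier G. \<mu> t \<ge> 0) \<and> (\<mu> has_sum 1) (carrier G)}"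

definition Prob_topology :: "'g monoid \<Rightarrow> ('g \<Rightarrow> real) topology" where
  "Prob_topology G = subtopology (powertop_real (carrier G)) (Prob G)"

definition translate :: "'g monoid \<Rightarrow> 'g \<Rightarrow> ('g \<Rightarrow> real) \<Rightarrow> 'g \<Rightarrow> real" where
  "translate G s \<mu> = (\<lambda>t\<in>carrier G. \<mu> (inv\<^bsub>G\<^esub> s \<otimes>\<^bsub>G\<^esub> t))"

definition l1_dist :: "'g monoid \<Rightarrow> ('g \<Rightarrow> real) \<Rightarrow> ('g \<Rightarrow> real) \<Rightarrow> real" where
  "l1_dist G \<mu> \<nu> = (\<Sum>\<^sub>\<infinity>t\<in>carrier G. \<bar>\<mu> t - \<nu> t\<bar>)"

definition amenable_action :: "'g monoid \<Rightarrow> 'x topology \<Rightarrow> ('g \<Rightarrow> 'x \<Rightarrow> 'x) \<Rightarrow> bool" where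
  "amenable_action G X \<theta> \<longleftrightarrow>
     (\<forall>F \<epsilon>. finite F \<and> F \<subseteq> carrier G \<and> \<epsilon> > 0 \<longrightarrow>
        (\<exists>\<mu>. continuous_map X (Prob_topology G) \<mu> \<and>
             (\<forall>s\<in>F. \<forall>\<omega>\<in>topspace X. l1_dist G (translate G s (\<mu> \<omega>)) (\<mu> (\<theta> s \<omega>)) \<le> \<epsilon>)))"

section \<open>The induced actions are actions by homeomorphisms\<close>

lemma topological_actionI:
  assumes "group G"
    and "\<And>g. g \<in> carrier G \<Longrightarrow> \<theta> g \<in> extensional (topspace X)"
    and "\<And>g. g \<in> carrier G \<Longrightarrow> continuous_map X X (\<theta> g)"
    and one: "\<And>x. x \<in> topspace X \<Longrightarrow> \<theta> \<one>\<^bsub>G\<^esub> x = x"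
    and mult: "\<And>g h x. g \<in> carrier G \<Longrightarrow> h \<in> carrier G \<Longrightarrow> x \<in> topspace X \<Longrightarrow>
      \<theta> (g \<otimes>\<^bsub>G\<^esub> h) x = \<theta> g (\<theta> h x)"
  shows "topological_action G X \<theta>"
proof -
  interpret group G by fact
  have hm: "homeomorphic_maps X X (\<theta> g) (\<theta> (inv\<^bsub>G\<^esub> g))" if "g \<in> carrier G" for g
    unfolding homeomorphic_maps_def
    using assms(3) that one mult[of g "inv\<^bsub>G\<^esub> g"] mult[of "inv\<^bsub>G\<^esub> g" g] by auto
  then have homeo: "homeomorphic_map X X (\<theta> g)" if "g \<in> carrier G" for g
    using homeomorphic_map_maps that by blast
  then have bij: "\<theta> g \<in> Bij (topspace X)" if "g \<in> carrier G" for g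
    using assms(2) homeo that homeomorphic_imp_surjective_map[of X X "\<theta> g"]
    by (auto simp: Bij_def bij_betw_def homeomorphic_map_def)
  have "\<theta> (g \<otimes>\<^bsub>G\<^esub> h) = compose (topspace X) (\<theta> g) (\<theta> h)" if "g \<in> carrier G" "h \<in> carrier G" for g h
    using that assms(2)[of "g \<otimes>\<^bsub>G\<^esub> h"] mult[of g h]
    by (intro extensionalityI[of _ "topspace X"]) (auto simp: compose_eq)
  then have "\<theta> \<in> hom G (BijGroup (topspace X))"
    using bij by (auto simp: hom_def BijGroup_def)
  then show ?thesis
    unfolding topological_action_def group_action_def group_hom_def group_hom_axioms_def
    using homeo group_BijGroup is_group by auto
qed

context graph_group_action
begin

abbreviation (input) raw :: "'g \<Rightarrow> 'v + (nat \<Rightarrow> 'v) set \<Rightarrow> 'v + (nat \<Rightarrow> 'v) set" where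
  "raw g \<equiv> map_sum (\<phi> g) (\<lambda>c. (\<lambda>\<alpha>. \<phi> g \<circ> \<alpha>) ` c)"

lemma is_group: "group \<Gamma>"
  using group_hom group_hom.axioms(1) by blast

lemma in_V: "g \<in> carrier \<Gamma> \<Longrightarrow> x \<in> V \<Longrightarrow> \<phi> g x \<in> V"
  using element_image by blast

lemma inv_cancel: "g \<in> carrier \<Gamma> \<Longrightarrow> x \<in> V \<Longrightarrow> \<phi> (inv g) (\<phi> g x) = x"
  using orbit_sym_aux by blast

lemma phi_eq_iff: "g \<in> carrier \<Gamma> \<Longrightarrow> x \<in> V \<Longrightarrow> y \<in> V \<Longrightarrow> \<phi> g x = \<phi> g y \<longleftrightarrow> x = y"
  using inj_prop by (meson inj_on_eq_iff)

lemma finite_path_map: "g \<in> carrier \<Gamma> \<Longrightarrow> finite_path p \<Longrightarrow> finite_path (map (\<phi> g) p)"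
  by (auto simp: finite_path_def subset_iff in_V phi_eq_iff automorphism)

lemma graph_dist_le:
  assumes "g \<in> carrier \<Gamma>" "x \<in> V" "y \<in> V"
  shows "graph_dist (\<phi> g x) (\<phi> g y) \<le> graph_dist x y"
proof -
  let ?P = "\<lambda>n. \<exists>p. finite_path p \<and> hd p = x \<and> last p = y \<and> length p = Suc n"
  obtain p where p: "finite_path p" "hd p = x" "last p = y"
    using connected[OF assms(2,3)] unfolding finite_path_def by blast
  then have "length p = Suc (length p - 1)"
    by (simp add: finite_path_def)
  then have "?P (length p - 1)"
    using p by blast
  then have "?P (graph_dist x y)"
    unfolding graph_dist_def by (rule LeastI)
  then obtain q where q: "finite_path q" "hd q = x" "last q = y" "length q = Suc (graph_dist x y)"
    by blast
  then have "q \<noteq> []" by auto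
  then show ?thesis
    unfolding graph_dist_def[of "\<phi> g x"]
    using q finite_path_map[OF assms(1) q(1)]
    by (intro Least_le exI[of _ "map (\<phi> g) q"]) (simp add: hd_map last_map)
qed

lemma graph_dist_phi:
  assumes "g \<in> carrier \<Gamma>" "x \<in> V" "y \<in> V"
  shows "graph_dist (\<phi> g x) (\<phi> g y) = graph_dist x y"
  using graph_dist_le[OF assms] graph_dist_le[of "inv g" "\<phi> g x" "\<phi> g y"] assms inv_cancel in_V
    group.inv_closed[OF is_group]
  by (simp add: le_antisym)

lemma finite_geodesic_map:
  assumes g: "g \<in> carrier \<Gamma>" and p: "finite_geodesic p"
  shows "finite_geodesic (map (\<phi> g) p)"
proof -
  have "p ! m \<in> V" if "m < length p" for m
    using p nth_mem[OF that] unfolding finite_geodesic_def finite_path_def by blast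
  then show ?thesis
    using p by (simp add: finite_geodesic_def finite_path_map graph_dist_phi g)
qed

lemma infinite_geodesic_comp: "g \<in> carrier \<Gamma> \<Longrightarrow> infinite_geodesic \<alpha> \<Longrightarrow> infinite_geodesic (\<phi> g \<circ> \<alpha>)"
  unfolding infinite_geodesic_def infinite_path_def
  by (simp add: graph_dist_phi image_subset_iff in_V phi_eq_iff automorphism)

lemma biinfinite_geodesic_comp:
  "g \<in> carrier \<Gamma> \<Longrightarrow> biinfinite_geodesic \<alpha> \<Longrightarrow> biinfinite_geodesic (\<phi> g \<circ> \<alpha>)"
  unfolding biinfinite_geodesic_def biinfinite_path_def
  by (simp add: graph_dist_phi image_subset_iff in_V phi_eq_iff automorphism)

lemma infinite_geodesic_in_V: "infinite_geodesic \<alpha> \<Longrightarrow> \<alpha> n \<in> V"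
  by (auto simp: infinite_geodesic_def infinite_path_def)

lemma ray_comp_inv:
  "g \<in> carrier \<Gamma> \<Longrightarrow> infinite_geodesic \<alpha> \<Longrightarrow> \<phi> (inv g) \<circ> (\<phi> g \<circ> \<alpha>) = \<alpha>"
  by (auto simp: fun_eq_iff inv_cancel infinite_geodesic_in_V)

lemma ray_comp_inv':
  "g \<in> carrier \<Gamma> \<Longrightarrow> infinite_geodesic \<alpha> \<Longrightarrow> \<phi> g \<circ> (\<phi> (inv g) \<circ> \<alpha>) = \<alpha>"
  using ray_comp_inv[of "inv g"] is_group by (simp add: group.inv_inv)

lemma ray_equiv_comp:
  "g \<in> carrier \<Gamma> \<Longrightarrow> (\<alpha>, \<beta>) \<in> ray_equiv \<Longrightarrow> (\<phi> g \<circ> \<alpha>, \<phi> g \<circ> \<beta>) \<in> ray_equiv"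
  unfolding ray_equiv_def
  by (simp add: infinite_geodesic_comp graph_dist_phi infinite_geodesic_in_V)

lemma image_ray_class:
  assumes g: "g \<in> carrier \<Gamma>" and "infinite_geodesic \<alpha>"
  shows "(\<lambda>\<alpha>. \<phi> g \<circ> \<alpha>) ` (ray_equiv `` {\<alpha>}) = ray_equiv `` {\<phi> g \<circ> \<alpha>}"
proof -
  have "\<exists>\<gamma>. (\<alpha>, \<gamma>) \<in> ray_equiv \<and> \<beta> = \<phi> g \<circ> \<gamma>" if "(\<phi> g \<circ> \<alpha>, \<beta>) \<in> ray_equiv" for \<beta>
  proof (intro exI conjI)
    have "infinite_geodesic \<beta>"
      using that by (simp add: ray_equiv_def)
    then show "\<beta> = \<phi> g \<circ> (\<phi> (inv g) \<circ> \<beta>)"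
      using ray_comp_inv' g by simp
    show "(\<alpha>, \<phi> (inv g) \<circ> \<beta>) \<in> ray_equiv"
      using ray_equiv_comp[OF _ that, of "inv g"] ray_comp_inv assms group.inv_closed[OF is_group]
      by simp
  qed
  then show ?thesis
    using ray_equiv_comp[OF g] by auto
qed

lemma boundary_subset: "c \<in> boundary \<Longrightarrow> \<alpha> \<in> c \<Longrightarrow> infinite_geodesic \<alpha>"
  by (auto simp: boundary_def quotient_def ray_equiv_def)

lemma raw_in: "g \<in> carrier \<Gamma> \<Longrightarrow> p \<in> delta_set \<Longrightarrow> raw g p \<in> delta_set"
  using infinite_geodesic_comp
  by (fastforce simp: delta_set_def in_V boundary_def quotient_def image_ray_class)

lemma delta_action_vertex: "x \<in> V \<Longrightarrow> delta_action g (Inl x) = Inl (\<phi> g x)"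
  by (auto simp: delta_action_def delta_set_def)

lemma delta_action_ray_class:
  assumes "g \<in> carrier \<Gamma>" "infinite_geodesic \<alpha>"
  shows "delta_action g (Inr (ray_equiv `` {\<alpha>})) = Inr (ray_equiv `` {\<phi> g \<circ> \<alpha>})"
  using assms image_ray_class[OF assms]
  by (auto simp: delta_action_def delta_set_def boundary_def quotient_def)

lemma raw_one: "p \<in> delta_set \<Longrightarrow> raw \<one> p = p"
proof -
  have "\<phi> \<one> x = x" if "x \<in> V" for x
    using id_eq_one that by (metis restrict_apply')
  then have "\<phi> \<one> \<circ> \<alpha> = \<alpha>" if "infinite_geodesic \<alpha>" for \<alpha>
    using that by (auto simp: fun_eq_iff infinite_geodesic_in_V)
  then show "p \<in> delta_set \<Longrightarrow> raw \<one> p = p"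
    using \<open>\<And>x. x \<in> V \<Longrightarrow> \<phi> \<one> x = x\<close> boundary_subset
    by (auto simp: delta_set_def image_iff)
qed

lemma raw_mult:
  assumes "g \<in> carrier \<Gamma>" "h \<in> carrier \<Gamma>" "p \<in> delta_set"
  shows "raw (g \<otimes> h) p = raw g (raw h p)"
proof -
  have "\<phi> (g \<otimes> h) \<circ> \<alpha> = \<phi> g \<circ> (\<phi> h \<circ> \<alpha>)" if "infinite_geodesic \<alpha>" for \<alpha>
    using that assms by (auto simp: fun_eq_iff infinite_geodesic_in_V composition_rule)
  then show ?thesis
    using assms boundary_subset
    by (auto simp: delta_set_def composition_rule image_image intro!: image_cong)
qed

lemma geodesics_map:
  assumes "g \<in> carrier \<Gamma>" "\<alpha> \<in> geodesics x z"
  shows "map_path (\<phi> g) \<alpha> \<in> geodesics (raw g x) (raw g z)"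
proof -
  have *: "finite_geodesic p \<Longrightarrow> p \<noteq> []" for p
    by (simp add: finite_geodesic_def finite_path_def)
  show ?thesis
    using assms
    by (cases x; cases z)
      (auto simp: finite_geodesic_map hd_map last_map * comp_def
        intro!: image_eqI infinite_geodesic_comp[unfolded comp_def]
          biinfinite_geodesic_comp[unfolded comp_def])
qed

lemma raw_inv: "g \<in> carrier \<Gamma> \<Longrightarrow> p \<in> delta_set \<Longrightarrow> raw (inv g) (raw g p) = p"
  using raw_mult[of "inv g" g p] raw_one is_group by (simp add: group.l_inv group.inv_closed)

lemma raw_M:
  assumes g: "g \<in> carrier \<Gamma>" and "x \<in> delta_set" "A \<subseteq> V" "z \<in> M x (\<phi> (inv g) ` A)"
  shows "raw g z \<in> M (raw g x) A"
proof -
  have z: "z \<in> delta_set" "\<And>\<alpha>. \<alpha> \<in> geodesics x z \<Longrightarrow>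
      Inl ` vertices \<alpha> \<inter> (Inl ` \<phi> (inv g) ` A - {x}) = {}"
    using assms(4) by (auto simp: M_def)
  have ig: "inv g \<in> carrier \<Gamma>"
    using g is_group by (simp add: group.inv_closed)
  have "Inl v = raw g x" if \<alpha>: "\<alpha> \<in> geodesics (raw g x) (raw g z)" "v \<in> vertices \<alpha>" "v \<in> A" for \<alpha> v
  proof -
    have "map_path (\<phi> (inv g)) \<alpha> \<in> geodesics x z"
      using geodesics_map[OF ig \<alpha>(1)] raw_inv g assms(2) z(1) by simp
    then have "Inl (\<phi> (inv g) v) = x"
      using z(2)[of "map_path (\<phi> (inv g)) \<alpha>"] that(2,3)
      by (auto simp: graph_path.set_map)
    then have "raw g x = Inl (\<phi> g (\<phi> (inv g) v))"
      by auto
    also have "\<phi> g (\<phi> (inv g) v) = v"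
      using inv_cancel[OF ig, of v] that(3) assms(3) g is_group by (auto simp: group.inv_inv)
    finally show ?thesis by (rule sym)
  qed
  then show ?thesis
    using raw_in[OF g z(1)] by (auto simp: M_def)
qed

lemma topological_action_delta: "topological_action \<Gamma> delta_topology delta_action"
proof (rule topological_actionI[OF is_group])
  fix g assume g: "g \<in> carrier \<Gamma>"
  show "continuous_map delta_topology delta_topology (delta_action g)"
    unfolding continuous_map_def
  proof (intro conjI allI impI)
    show "delta_action g \<in> topspace delta_topology \<rightarrow> topspace delta_topology"
      using raw_in g by (auto simp: delta_action_def)
    fix U assume U: "openin delta_topology U"
    show "openin delta_topology {x \<in> topspace delta_topology. delta_action g x \<in> U}"
      unfolding openin_delta_topology
    proof (intro conjI ballI)
      fix x assume "x \<in> {x \<in> topspace delta_topology. delta_action g x \<in> U}"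
      then have x: "x \<in> delta_set" "raw g x \<in> U"
        by (auto simp: delta_action_def)
      then obtain A where A: "finite A" "A \<subseteq> V" "M (raw g x) A \<subseteq> U"
        using U unfolding openin_delta_topology by blast
      have "M x (\<phi> (inv g) ` A) \<subseteq> {x \<in> topspace delta_topology. delta_action g x \<in> U}"
      proof
        fix z assume z: "z \<in> M x (\<phi> (inv g) ` A)"
        then have "z \<in> delta_set"
          by (simp add: M_def)
        moreover have "raw g z \<in> U"
          using raw_M[OF g x(1) A(2) z] A(3) by blast
        ultimately show "z \<in> {x \<in> topspace delta_topology. delta_action g x \<in> U}"
          by (simp add: delta_action_def)
      qed
      moreover have "\<phi> (inv g) ` A \<subseteq> V"
        using in_V A(2) g is_group by (auto simp: group.inv_closed)
      ultimately show "\<exists>B. finite B \<and> B \<subseteq> V \<and>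
          M x B \<subseteq> {x \<in> topspace delta_topology. delta_action g x \<in> U}"
        using A(1) by blast
    qed auto
  qed
next
  fix g h x assume "g \<in> carrier \<Gamma>" "h \<in> carrier \<Gamma>" "x \<in> topspace delta_topology"
  then show "delta_action (g \<otimes> h) x = delta_action g (delta_action h x)"
    using raw_in[of h x] raw_mult[of g h x] by (simp add: delta_action_def)
next
  fix x assume "x \<in> topspace delta_topology"
  then show "delta_action \<one> x = x"
    using raw_one[of x] by (simp add: delta_action_def)
qed (simp add: delta_action_def)

text \<open>Bowditch's theorem provides the first two hypotheses for a fine hyperbolic graph.\<close>

lemma delta_action_unique:
  assumes "Hausdorff_space delta_topology"
    and "delta_topology closure_of (Inl ` V) = delta_set"
    and "g \<in> carrier \<Gamma>"
    and "continuous_map delta_topology delta_topology f"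
    and "\<And>x. x \<in> V \<Longrightarrow> f (Inl x) = Inl (\<phi> g x)"
    and "p \<in> delta_set"
  shows "f p = delta_action g p"
proof -
  have "continuous_map delta_topology delta_topology (delta_action g)"
    using topological_action_delta assms(3)
    by (auto simp: topological_action_def homeomorphic_imp_continuous_map)
  moreover have "f x = delta_action g x" if "x \<in> Inl ` V" for x
    using that assms(5) by (auto simp: delta_action_vertex)
  ultimately show ?thesis
    using forall_in_closure_of_eq[of p delta_topology "Inl ` V" delta_topology f "delta_action g"]
      assms(1,2,4,6) by blast
qed

end

lemma topological_action_diagonal:
  assumes "topological_action G X \<theta>" "topological_action G Y \<psi>"
  shows "topological_action G (prod_topology X Y) (diagonal_action X \<theta> Y \<psi>)"
proof -
  interpret X: group_action G "topspace X" \<theta>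
    using assms(1) by (simp add: topological_action_def)
  interpret Y: group_action G "topspace Y" \<psi>
    using assms(2) by (simp add: topological_action_def)
  have grp: "group G"
    using X.group_hom group_hom.axioms(1) by blast
  have one: "\<theta> \<one>\<^bsub>G\<^esub> x = x" if "x \<in> topspace X" for x
    using X.id_eq_one that by (metis restrict_apply')
  have one': "\<psi> \<one>\<^bsub>G\<^esub> x = x" if "x \<in> topspace Y" for x
    using Y.id_eq_one that by (metis restrict_apply')
  show ?thesis
  proof (rule topological_actionI[OF grp])
    fix g assume g: "g \<in> carrier G"
    have "continuous_map X X (\<theta> g)" "continuous_map Y Y (\<psi> g)"
      using assms g by (auto simp: topological_action_def homeomorphic_imp_continuous_map)
    then have "continuous_map (prod_topology X Y) (prod_topology X Y)
        (\<lambda>(x, y). (\<theta> g x, \<psi> g y))"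
      by (simp add: continuous_map_prod_top)
    then show "continuous_map (prod_topology X Y) (prod_topology X Y) (diagonal_action X \<theta> Y \<psi> g)"
      by (rule continuous_map_eq) (auto simp: diagonal_action_def)
  next
    fix g h p
    assume gh: "g \<in> carrier G" "h \<in> carrier G" and p: "p \<in> topspace (prod_topology X Y)"
    then obtain x y where xy: "p = (x, y)" "x \<in> topspace X" "y \<in> topspace Y"
      by auto
    then show "diagonal_action X \<theta> Y \<psi> (g \<otimes>\<^bsub>G\<^esub> h) p =
        diagonal_action X \<theta> Y \<psi> g (diagonal_action X \<theta> Y \<psi> h p)"
      using X.composition_rule[of x g h] Y.composition_rule[of y g h] gh
        X.element_image[of h x] Y.element_image[of h y]
      by (simp add: diagonal_action_def)
  next
    fix p assume "p \<in> topspace (prod_topology X Y)"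
    then show "diagonal_action X \<theta> Y \<psi> \<one>\<^bsub>G\<^esub> p = p"
      using one one' by (auto simp: diagonal_action_def)
  qed (simp add: diagonal_action_def)
qed

end

theory Submission
  imports Defs
begin

text \<open>The obstacle is that K need not be locally finite: balls are infinite, so bounded
  distance alone gives neither limits of geodesics nor finite candidate sets. The substitute is one
  mechanism: if two geodesics run side by side over a stretch longer than the connectors between
  them, they close up to a circuit, so an edge of one leaves finitely many possibilities for an edge
  of the other. The finite sets that secure a common element in (ii) grow uncontrollably with R. The
  linear bound (iii) therefore comes from elsewhere: any two geodesics from y to z are tied together
  by circuits of length at most \<open>mu\<close>, which depends on \<delta> only, and finitely many
  edge orbits bound the vertices of such circuits through an edge uniformly. Base points vary
  because of equivariance: a candidate of z seen from v^{-1} y is moved by v to a candidate of v z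
  seen from y. With words v of length about N, R is proportional to N, and a mass that shrinks from
  C to 1 in N steps changes by a factor with logarithm ln C / N on average; so C growing linearly in
  N is good enough.\<close>

text \<open>
  Fix a base vertex. Each point \<open>z\<close> of the compactification gets a finite set of candidate
  vertices such that (i) the set depends upper semicontinuously on \<open>z\<close>, (ii) the sets belonging to
  all base vertices within distance \<open>R\<close> of the fixed one have a common element, and (iii) their
  size is linear in \<open>R\<close>. Here hyperbolicity makes geodesics with a common target close to each
  other, and fineness turns closeness into finiteness, because close geodesics have edges on common
  short circuits. The compactification is compact Hausdorff, so Urysohn functions turn the candidate
  sets into finitely supported functions on the vertices that depend continuously on \<open>z\<close> and have
  total mass linear in \<open>R\<close>. By (ii), the iterated minima of these functions over the translates by a
  finite subset of the group keep total mass at least \<open>1\<close> during about \<open>R\<close> steps, so averaging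
  their normalizations gives continuous maps into the probability measures on the vertices that are
  equivariant up to \<open>O(log R / R)\<close>. Continuity is thus obtained directly, without an appeal to
  measurable maps. Finally, almost invariant families of measures on the vertex stabilizers
  are transported along the orbits and mixed with these weights.
\<close>

section \<open>Walks and circuits\<close>

text \<open>The edge set is a parameter so that pieces of a closed walk can be kept away from a
  vertex, from a level or from the edge to be closed up. Stationary steps make a walk of length
  \<open>n\<close> also one of every larger length.\<close>

definition walk :: "'v set set \<Rightarrow> nat \<Rightarrow> 'v \<Rightarrow> 'v \<Rightarrow> bool" where
  "walk B n = (\<lambda>x y. x = y \<or> {x, y} \<in> B) ^^ n"

lemma walk_iff_fun:
  "walk B n x y \<longleftrightarrow> (\<exists>f. f 0 = x \<and> f n = y \<and> (\<forall>i<n. f i = f (Suc i) \<or> {f i, f (Suc i)} \<in> B))"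
  by (simp add: walk_def relpowp_fun_conv)

lemma walk_refl: "walk B n x x"
  unfolding walk_iff_fun by (rule exI[of _ "\<lambda>_. x"]) simp

lemma walk_trans: "walk B m x y \<Longrightarrow> walk B n y z \<Longrightarrow> walk B (m + n) x z"
  unfolding walk_def by (rule relpowp_trans)

lemma walk_le: "walk B m x y \<Longrightarrow> m \<le> n \<Longrightarrow> walk B n x y"
  using walk_trans[of B m x y "n - m" y] walk_refl[of B "n - m" y] by simp

lemma walk_mono: "walk B n x y \<Longrightarrow> B \<subseteq> C \<Longrightarrow> walk C n x y"
  unfolding walk_iff_fun by blast

lemma walk_sym: "walk B n x y \<Longrightarrow> walk B n y x"
proof -
  assume "walk B n x y"
  then obtain f where f: "f 0 = x" "f n = y" "\<forall>i<n. f i = f (Suc i) \<or> {f i, f (Suc i)} \<in> B"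
    unfolding walk_iff_fun by blast
  have "f (n - i) = f (n - Suc i) \<or> {f (n - i), f (n - Suc i)} \<in> B" if "i < n" for i
    using f(3)[rule_format, of "n - Suc i"] that by (simp add: Suc_diff_Suc insert_commute eq_commute)
  then show ?thesis
    unfolding walk_iff_fun using f by (intro exI[of _ "\<lambda>i. f (n - i)"]) auto
qed

lemma walk_segment:
  assumes "\<And>i. a \<le> i \<Longrightarrow> i < b \<Longrightarrow> f i = f (Suc i) \<or> {f i, f (Suc i)} \<in> B" "a \<le> b"
  shows "walk B (b - a) (f a) (f b)"
  unfolding walk_iff_fun using assms by (intro exI[of _ "\<lambda>i. f (a + i)"]) auto

lemma walk_step: "{x, y} \<in> B \<Longrightarrow> walk B 1 x y"
  by (auto simp: walk_def OO_def)

text \<open>If the new first vertex recurs further on, the loop is cut off by keeping only the part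
  from the recurrence.\<close>

lemma walk_distinct_path:
  assumes "walk B n x y"
  shows "\<exists>q. q \<noteq> [] \<and> distinct q \<and> hd q = x \<and> last q = y \<and> length q \<le> Suc n \<and>
    successively (\<lambda>x y. {x, y} \<in> B) q"
  using assms
proof (induction n arbitrary: x)
  case 0
  then show ?case
    by (intro exI[of _ "[x]"]) (auto simp: walk_def)
next
  case (Suc n)
  then obtain z where z: "x = z \<or> {x, z} \<in> B" "walk B n z y"
    unfolding walk_def by (blast elim: relpowp_Suc_E2)
  then obtain q where q: "q \<noteq> []" "distinct q" "hd q = z" "last q = y" "length q \<le> Suc n"
      "successively (\<lambda>x y. {x, y} \<in> B) q"
    using Suc.IH by blast
  show ?case
  proof (cases "x \<in> set q")
    case True
    then obtain q1 q2 where "q = q1 @ x # q2"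
      by (metis split_list)
    then show ?thesis
      using q by (intro exI[of _ "x # q2"]) (auto simp: successively_append_iff)
  next
    case False
    then have "{x, z} \<in> B"
      using z(1) q by (metis list.set_sel(1))
    then show ?thesis
      using q False by (intro exI[of _ "x # q"]) (auto simp: successively_Cons)
  qed
qed

lemma successively_crossing:
  assumes "successively P q" "q \<noteq> []" "hd q \<in> U" "last q \<notin> U"
  shows "\<exists>i. Suc i < length q \<and> q ! i \<in> U \<and> q ! Suc i \<notin> U"
  using assms
proof (induction q)
  case (Cons x q)
  then have "q \<noteq> []"
    by (metis last_ConsL list.sel(1))
  show ?case
  proof (cases "hd q \<in> U")
    case True
    then obtain i where "Suc i < length q" "q ! i \<in> U" "q ! Suc i \<notin> U"
      using Cons \<open>q \<noteq> []\<close> by (auto simp: successively_Cons)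
    then show ?thesis
      by (intro exI[of _ "Suc i"]) simp
  next
    case False
    then show ?thesis
      using Cons.prems \<open>q \<noteq> []\<close> by (intro exI[of _ 0]) (simp add: hd_conv_nth)
  qed
qed simp

context connected_graph
begin

section \<open>The path metric in terms of walks\<close>

abbreviation d where "d \<equiv> graph_dist"

lemma edge_in_V: "{x, y} \<in> E \<Longrightarrow> x \<in> V \<and> y \<in> V \<and> x \<noteq> y"
  using edges[of "{x, y}"] by (auto simp: doubleton_eq_iff)

lemma edge_subset_V: "e \<in> E \<Longrightarrow> e \<subseteq> V"
  using edges[of e] by auto

lemma finite_path_iff_walk:
  assumes "x \<in> V"
  shows "(\<exists>p. finite_path p \<and> hd p = x \<and> last p = y \<and> length p = Suc n) \<longleftrightarrow> walk E n x y"
    (is "?L = ?R")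
proof
  assume ?L
  then obtain p where p: "finite_path p" "hd p = x" "last p = y" "length p = Suc n"
    by blast
  then show ?R
    unfolding walk_iff_fun finite_path_def
    by (intro exI[of _ "\<lambda>i. p ! i"]) (auto simp: hd_conv_nth last_conv_nth)
next
  assume ?R
  then obtain f where f: "f 0 = x" "f n = y" "\<forall>i<n. f i = f (Suc i) \<or> {f i, f (Suc i)} \<in> E"
    unfolding walk_iff_fun by blast
  have "f i \<in> V" if "i \<le> n" for i
    using that
  proof (induction i)
    case (Suc i)
    then have "f i = f (Suc i) \<or> {f i, f (Suc i)} \<in> E" "f i \<in> V"
      using f(3) by auto
    then show ?case
      using edge_in_V by metis
  qed (use f assms in simp)
  then have "finite_path (map f [0..<Suc n])"
    using f(3) unfolding finite_path_def by (auto simp: nth_append less_Suc_eq_le simp del: upt_Suc)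
  then show ?L
    using f by (intro exI[of _ "map f [0..<Suc n]"])
      (simp add: hd_map last_map del: upt_Suc)
qed

lemma dist_Least: "x \<in> V \<Longrightarrow> d x y = (LEAST n. walk E n x y)"
  unfolding graph_dist_def by (simp add: finite_path_iff_walk)

lemma ex_walk: "x \<in> V \<Longrightarrow> y \<in> V \<Longrightarrow> \<exists>n. walk E n x y"
proof -
  assume xy: "x \<in> V" "y \<in> V"
  then obtain p where "finite_path p" "hd p = x" "last p = y"
    using connected[OF xy] unfolding finite_path_def by blast
  moreover have "length p = Suc (length p - 1)"
    using calculation by (simp add: finite_path_def)
  ultimately show ?thesis
    using finite_path_iff_walk[OF xy(1), of y "length p - 1"] by blast
qed

lemma walk_dist: "x \<in> V \<Longrightarrow> y \<in> V \<Longrightarrow> walk E (d x y) x y"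
  by (metis LeastI dist_Least ex_walk)

lemma dist_le_walk: "walk E n x y \<Longrightarrow> x \<in> V \<Longrightarrow> d x y \<le> n"
  by (simp add: dist_Least Least_le)

lemma dist_self [simp]: "x \<in> V \<Longrightarrow> d x x = 0"
  using dist_le_walk[of 0 x x] by (simp add: walk_refl)

lemma dist_sym: "x \<in> V \<Longrightarrow> y \<in> V \<Longrightarrow> d x y = d y x"
  by (meson dist_le_walk le_antisym walk_dist walk_sym)

lemma dist_triangle: "x \<in> V \<Longrightarrow> y \<in> V \<Longrightarrow> z \<in> V \<Longrightarrow> d x z \<le> d x y + d y z"
  by (meson dist_le_walk walk_dist walk_trans)

lemma dist_eq_0: "x \<in> V \<Longrightarrow> y \<in> V \<Longrightarrow> d x y = 0 \<longleftrightarrow> x = y"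
  using walk_dist[of x y] by (auto simp: walk_def)

lemma dist_edge: "{x, y} \<in> E \<Longrightarrow> d x y = 1"
  using dist_le_walk[of 1 x y] walk_step[of x y E] edge_in_V[of x y] dist_eq_0[of x y] by force

lemma dist_1_edge: "x \<in> V \<Longrightarrow> y \<in> V \<Longrightarrow> d x y = 1 \<Longrightarrow> {x, y} \<in> E"
  using walk_dist[of x y] dist_eq_0[of x y] by (auto simp: walk_def)

text \<open>Stationary steps are allowed in walks, so a walk of length \<open>d x y\<close> need not be
  injective a priori; the triangle inequality forces it.\<close>

lemma ex_geodesic_fun:
  assumes "x \<in> V" "y \<in> V"
  shows "\<exists>f. f 0 = x \<and> f (d x y) = y \<and> range f \<subseteq> V \<and> (\<forall>i\<ge>d x y. f i = y) \<and>
    (\<forall>i j. int (d (f i) (f j)) = \<bar>int (min i (d x y)) - int (min j (d x y))\<bar>)"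
proof -
  let ?n = "d x y"
  obtain f where f: "f 0 = x" "f ?n = y" "\<forall>i<?n. f i = f (Suc i) \<or> {f i, f (Suc i)} \<in> E"
    using walk_dist[OF assms] unfolding walk_iff_fun by blast
  define g where "g i = f (min i ?n)" for i
  have "f i \<in> V" if "i \<le> ?n" for i
    using that
  proof (induction i)
    case (Suc i)
    then have "f i = f (Suc i) \<or> {f i, f (Suc i)} \<in> E" "f i \<in> V"
      using f(3) by auto
    then show ?case
      using edge_in_V by metis
  qed (use f assms in simp)
  then have gV: "g i \<in> V" for i
    by (simp add: g_def)
  have le: "d (f i) (f j) \<le> j - i" if "i \<le> j" "j \<le> ?n" for i j
    using walk_segment[of i j f E] f(3) that \<open>\<And>i. i \<le> ?n \<Longrightarrow> f i \<in> V\<close>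
    by (intro dist_le_walk) auto
  have eq: "d (f i) (f j) = j - i" if "i \<le> j" "j \<le> ?n" for i j
  proof -
    have V: "f 0 \<in> V" "f i \<in> V" "f j \<in> V" "f ?n \<in> V"
      using that \<open>\<And>i. i \<le> ?n \<Longrightarrow> f i \<in> V\<close> by auto
    have "d (f 0) (f ?n) \<le> d (f 0) (f i) + (d (f i) (f j) + d (f j) (f ?n))"
      using dist_triangle[OF V(1,2,4)] dist_triangle[OF V(2,3,4)] by linarith
    then show ?thesis
      using le[of 0 i] le[of i j] le[of j ?n] that f by simp
  qed
  have "int (d (g i) (g j)) = \<bar>int (min i ?n) - int (min j ?n)\<bar>" for i j
  proof (cases "min i ?n \<le> min j ?n")
    case True
    then show ?thesis
      using eq[OF True] by (simp add: g_def)
  next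
    case False
    then show ?thesis
      using eq[of "min j ?n" "min i ?n"] dist_sym[OF gV gV, of i j] by (simp add: g_def)
  qed
  then show ?thesis
    using f gV by (intro exI[of _ g]) (auto simp: g_def)
qed

section \<open>Circuits of bounded length through an edge\<close>

definition Circ :: "nat \<Rightarrow> 'v set \<Rightarrow> 'v set set" where
  "Circ n e = {e'. \<exists>p. circuit p \<and> length p - 1 \<le> n \<and> path_contains_edge p e \<and>
     path_contains_edge p e' \<and> e' \<in> E}"

definition crosses :: "'v set \<Rightarrow> 'v set \<Rightarrow> bool" where
  "crosses e U \<longleftrightarrow> e \<inter> U \<noteq> {} \<and> \<not> e \<subseteq> U"

lemma Circ_subset_E: "Circ n e \<subseteq> E"
  by (auto simp: Circ_def)

lemma Circ_sym: "e \<in> E \<Longrightarrow> e' \<in> Circ n e \<Longrightarrow> e \<in> Circ n e'"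
  by (auto simp: Circ_def)

lemma Circ_mono: assumes "m \<le> n" shows "Circ m e \<subseteq> Circ n e"
proof
  fix e' assume "e' \<in> Circ m e"
  then obtain p where "circuit p" "length p - 1 \<le> m" "path_contains_edge p e"
      "path_contains_edge p e'" "e' \<in> E"
    unfolding Circ_def by blast
  then show "e' \<in> Circ n e"
    unfolding Circ_def using order_trans[OF _ assms] by blast
qed

text \<open>The back-and-forth path \<open>[x, y, x]\<close> counts as a circuit of length 2. This
  covers the degenerate cases in which two paths share the edge in question.\<close>

lemma Circ_refl: "e \<in> E \<Longrightarrow> 2 \<le> n \<Longrightarrow> e \<in> Circ n e"
proof -
  assume e: "e \<in> E" "2 \<le> n"
  then obtain x y where xy: "e = {x, y}" "x \<noteq> y" "x \<in> V" "y \<in> V"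
    using edges by blast
  have "circuit [x, y, x]"
    unfolding circuit_def finite_path_def using xy e
    by (auto simp: less_Suc_eq insert_commute)
  moreover have "path_contains_edge [x, y, x] e"
    unfolding path_contains_edge_def using xy by (intro exI[of _ 0]) auto
  ultimately show ?thesis
    unfolding Circ_def using e by (intro CollectI exI[of _ "[x, y, x]"]) auto
qed

text \<open>Fineness enters in this form: each of the finitely many short circuits through
  \<open>e\<close> has finitely many edges.\<close>

lemma finite_Circ:
  assumes fine_graph "e \<in> E"
  shows "finite (Circ n e)"
proof -
  let ?C = "{p. circuit p \<and> length p - 1 \<le> n \<and> path_contains_edge p e}"
  have "Circ n e \<subseteq> (\<Union>p\<in>?C. (\<lambda>i. {p ! i, p ! Suc i}) ` {..<length p})"
  proof
    fix e' assume "e' \<in> Circ n e"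
    then obtain p where p: "p \<in> ?C" "path_contains_edge p e'"
      unfolding Circ_def by blast
    then obtain i where "Suc i < length p" "{p ! i, p ! Suc i} = e'"
      by (auto simp: path_contains_edge_def)
    then have "e' \<in> (\<lambda>i. {p ! i, p ! Suc i}) ` {..<length p}"
      by (intro image_eqI[of _ _ i]) auto
    then show "e' \<in> (\<Union>p\<in>?C. (\<lambda>i. {p ! i, p ! Suc i}) ` {..<length p})"
      using p(1) by blast
  qed
  moreover have "finite ?C"
    using assms by (simp add: fine_graph_def)
  ultimately show ?thesis
    by (meson finite_UN_I finite_imageI finite_lessThan finite_subset)
qed

text \<open>Shortened to a simple path, the walk from \<open>u\<close> to \<open>v\<close> closes up
  with the edge {u, v} to a circuit. The path leaves \<open>U\<close> somewhere, and it can do so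
  only along an edge of \<open>B\<close>.\<close>

lemma circuit_through_crossing:
  assumes e: "{u, v} \<in> E" and U: "u \<in> U" "v \<notin> U"
    and w: "walk {e \<in> E. e \<noteq> {u, v} \<and> (crosses e U \<longrightarrow> e \<in> B)} k u v"
  shows "\<exists>e'\<in>B. e' \<in> Circ (Suc k) {u, v} \<and> crosses e' U"
proof -
  let ?B = "{e \<in> E. e \<noteq> {u, v} \<and> (crosses e U \<longrightarrow> e \<in> B)}"
  obtain q where q: "q \<noteq> []" "distinct q" "hd q = u" "last q = v" "length q \<le> Suc k"
      "successively (\<lambda>x y. {x, y} \<in> ?B) q"
    using walk_distinct_path[OF w] by blast
  obtain i where i: "Suc i < length q" "q ! i \<in> U" "q ! Suc i \<notin> U"
    using successively_crossing[OF q(6,1)] q U by blast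
  have step: "{q ! j, q ! Suc j} \<in> ?B" if "Suc j < length q" for j
    using q(6) that by (simp add: successively_conv_nth)
  \<comment> \<open>Since \<open>q\<close> ends in \<open>v\<close>, putting \<open>v\<close> in
    front closes the path, and its first edge is {v, u}.\<close>
  let ?e = "{q ! i, q ! Suc i}" and ?p = "v # q"
  have qV: "set q \<subseteq> V"
  proof
    fix x assume "x \<in> set q"
    then obtain j where j: "j < length q" "x = q ! j"
      by (metis in_set_conv_nth)
    show "x \<in> V"
    proof (cases "Suc j < length q")
      case True then show ?thesis using step[OF True] j edge_in_V by blast
    next
      case False
      then have "x = v" using j q(4) by (metis last_conv_nth Suc_lessI diff_Suc_1 q(1))
      then show ?thesis using e edge_in_V by blast
    qed
  qed
  have hd: "q ! 0 = u"
    using q by (simp add: hd_conv_nth)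
  have "?p ! j = ?p ! Suc j \<or> {?p ! j, ?p ! Suc j} \<in> E" if "Suc j < length ?p" for j
    using step[of "j - 1"] that e hd by (cases j) (auto simp: insert_commute)
  then have "finite_path ?p"
    using qV e edge_in_V[OF e] by (auto simp: finite_path_def)
  moreover have "butlast ?p = v # butlast q"
    using q by simp
  moreover have "v \<notin> set (butlast q)"
    using q by (metis append_butlast_last_id distinct_append disjoint_iff list.set_intros(1))
  ultimately have "circuit ?p"
    using q by (simp add: circuit_def distinct_butlast)
  moreover have "path_contains_edge ?p {u, v}"
    unfolding path_contains_edge_def using hd q by (intro exI[of _ 0]) (auto simp: insert_commute)
  moreover have "path_contains_edge ?p ?e"
    unfolding path_contains_edge_def using i by (intro exI[of _ "Suc i"]) auto
  moreover have "crosses ?e U"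
    using i by (auto simp: crosses_def)
  moreover have "length ?p - 1 \<le> Suc k" using q by simp
  ultimately show ?thesis
    using step[OF i(1)] unfolding Circ_def by blast
qed

section \<open>Geodesics\<close>

lemma infinite_geodesic_iff:
  "infinite_geodesic g \<longleftrightarrow> range g \<subseteq> V \<and> (\<forall>m n. int (d (g m) (g n)) = \<bar>int m - int n\<bar>)"
proof -
  have "{g i, g (Suc i)} \<in> E"
    if "range g \<subseteq> V" "\<forall>m n. int (d (g m) (g n)) = \<bar>int m - int n\<bar>" for i
    using that(2)[rule_format, of i "Suc i"] that(1) dist_1_edge[of "g i" "g (Suc i)"] by auto
  then show ?thesis
    unfolding infinite_geodesic_def infinite_path_def by blast
qed

text \<open>If \<open>h n\<close> is within \<open>C\<close> of \<open>g m\<close>, then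
  \<open>n\<close> and \<open>m\<close> differ by at most \<open>C + d (g 0) (h 0)\<close>, because
  both rays are geodesic. So a finite Hausdorff distance bounds the distance at equal times.\<close>

lemma ray_equiv_iff:
  "(g, h) \<in> ray_equiv \<longleftrightarrow>
     infinite_geodesic g \<and> infinite_geodesic h \<and> (\<exists>C. \<forall>t. d (g t) (h t) \<le> C)"
proof
  assume "(g, h) \<in> ray_equiv"
  then obtain C where g: "infinite_geodesic g" and h: "infinite_geodesic h"
    and C: "\<And>m. \<exists>n. d (g m) (h n) \<le> C"
    unfolding ray_equiv_def by blast
  have V: "g i \<in> V" "h i \<in> V" for i
    using g h unfolding infinite_geodesic_iff by auto
  have "d (g m) (h m) \<le> 2 * C + d (g 0) (h 0)" for m
  proof -
    obtain n where n: "d (g m) (h n) \<le> C"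
      using C by blast
    have *: "int (d (g 0) (g m)) = int m" "int (d (h 0) (h n)) = int n"
      "int (d (h n) (h m)) = \<bar>int n - int m\<bar>"
      using g h unfolding infinite_geodesic_iff by auto
    have "d (h 0) (h n) \<le> d (h 0) (g 0) + (d (g 0) (g m) + d (g m) (h n))"
      using dist_triangle[OF V(2) V(1) V(2), of 0 n 0] dist_triangle[OF V(1) V(1) V(2), of 0 n m]
      by linarith
    moreover have "d (g 0) (g m) \<le> d (g 0) (h 0) + (d (h 0) (h n) + d (h n) (g m))"
      using dist_triangle[OF V(1) V(2) V(1), of 0 m 0] dist_triangle[OF V(2) V(2) V(1), of 0 m n]
      by linarith
    moreover have "d (g m) (h m) \<le> d (g m) (h n) + d (h n) (h m)"
      using dist_triangle V by blast
    ultimately show ?thesis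
      using * n dist_sym[OF V(1) V(2), of 0 0] dist_sym[OF V(1) V(2), of m n] by linarith
  qed
  then show "infinite_geodesic g \<and> infinite_geodesic h \<and> (\<exists>C. \<forall>t. d (g t) (h t) \<le> C)"
    using g h by blast
qed (unfold ray_equiv_def; blast)

lemma equiv_ray_equiv: "equiv (Collect infinite_geodesic) ray_equiv"
proof (rule equivI)
  show "refl_on (Collect infinite_geodesic) ray_equiv"
  proof (rule refl_onI)
    fix g assume "g \<in> Collect infinite_geodesic"
    then show "(g, g) \<in> ray_equiv"
      unfolding ray_equiv_iff infinite_geodesic_iff by (auto intro!: exI[of _ 0] simp: image_subset_iff)
  qed
  show "ray_equiv \<subseteq> Collect infinite_geodesic \<times> Collect infinite_geodesic"
    by (auto simp: ray_equiv_def)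
  show "sym ray_equiv"
  proof (rule symI)
    fix g h assume "(g, h) \<in> ray_equiv"
    moreover have "d (h t) (g t) = d (g t) (h t)" if "infinite_geodesic g" "infinite_geodesic h" for t
      using that unfolding infinite_geodesic_iff by (intro dist_sym) auto
    ultimately show "(h, g) \<in> ray_equiv"
      unfolding ray_equiv_iff by auto
  qed
  show "trans ray_equiv"
  proof (rule transI)
    fix g h k assume "(g, h) \<in> ray_equiv" "(h, k) \<in> ray_equiv"
    then obtain C D where *: "infinite_geodesic g" "infinite_geodesic h" "infinite_geodesic k"
      "\<forall>t. d (g t) (h t) \<le> C" "\<forall>t. d (h t) (k t) \<le> D"
      unfolding ray_equiv_iff by auto
    then have "d (g t) (k t) \<le> C + D" for t
      using dist_triangle[of "g t" "h t" "k t"] add_mono[of "d (g t) (h t)" C "d (h t) (k t)" D]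
      unfolding infinite_geodesic_iff by (meson le_trans range_subsetD)
    then show "(g, k) \<in> ray_equiv"
      using * unfolding ray_equiv_iff by blast
  qed
qed

lemma boundary_infinite_geodesic: "c \<in> boundary \<Longrightarrow> g \<in> c \<Longrightarrow> infinite_geodesic g"
  by (auto simp: boundary_def quotient_def ray_equiv_def)

lemma boundary_ex: "c \<in> boundary \<Longrightarrow> \<exists>g. g \<in> c"
  using equiv_class_self[OF equiv_ray_equiv] by (auto simp: boundary_def quotient_def)

lemma boundary_mem_iff:
  assumes "c \<in> boundary" "g \<in> c"
  shows "h \<in> c \<longleftrightarrow> infinite_geodesic h \<and> (\<exists>C. \<forall>t. d (g t) (h t) \<le> C)"
proof -
  have "h \<in> c \<longleftrightarrow> (g, h) \<in> ray_equiv"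
    using assms equiv_ray_equiv unfolding boundary_def
    by (metis quotient_eq_iff quotientE Image_singleton_iff in_quotient_imp_closed in_quotient_imp_in_rel
        empty_subsetI insert_subset)
  then show ?thesis
    using assms boundary_infinite_geodesic unfolding ray_equiv_iff by blast
qed

lemma class_in_boundary: "infinite_geodesic g \<Longrightarrow> ray_equiv `` {g} \<in> boundary \<and> g \<in> ray_equiv `` {g}"
  unfolding boundary_def using equiv_class_self[OF equiv_ray_equiv] by (simp add: quotientI)

text \<open>A geodesic from \<open>y\<close> to \<open>z\<close> is an infinite sequence; it is eventually constant, at \<open>z\<close>,
  when \<open>z\<close> is a vertex. Its \<open>i\<close>-th term is at distance \<open>lev y z i\<close> from \<open>y\<close>.\<close>

definition lev :: "'v \<Rightarrow> 'v + (nat \<Rightarrow> 'v) set \<Rightarrow> nat \<Rightarrow> nat" where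
  "lev y z i = (case z of Inl x \<Rightarrow> min i (d y x) | Inr c \<Rightarrow> i)"

definition Geo :: "'v \<Rightarrow> 'v + (nat \<Rightarrow> 'v) set \<Rightarrow> (nat \<Rightarrow> 'v) \<Rightarrow> bool" where
  "Geo y z g \<longleftrightarrow> y \<in> V \<and> z \<in> delta_set \<and> range g \<subseteq> V \<and> g 0 = y \<and>
     (\<forall>i j. int (d (g i) (g j)) = \<bar>int (lev y z i) - int (lev y z j)\<bar>) \<and>
     (case z of Inl x \<Rightarrow> g (d y x) = x | Inr c \<Rightarrow> g \<in> c)"

lemma lev_simps [simp]: "lev y (Inl x) i = min i (d y x)" "lev y (Inr c) i = i"
  by (simp_all add: lev_def)

lemma lev_le: "lev y z i \<le> i"
  by (simp add: lev_def split: sum.splits)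

lemma lev_mono: "i \<le> j \<Longrightarrow> lev y z i \<le> lev y z j"
  by (auto simp add: lev_def split: sum.splits)

lemma lev_0 [simp]: "lev y z 0 = 0"
  using lev_le[of y z 0] by simp

lemma lev_eqI: "lev y z j = j \<Longrightarrow> i \<le> j \<Longrightarrow> lev y z i = i"
  by (auto simp: lev_def split: sum.splits)

lemma lev_lev [simp]: "lev y z (lev y z i) = lev y z i"
  by (auto simp: lev_def split: sum.splits)

lemma Geo_V: "Geo y z g \<Longrightarrow> g i \<in> V"
  by (auto simp: Geo_def)

lemma Geo_0: "Geo y z g \<Longrightarrow> g 0 = y"
  by (simp add: Geo_def)

lemma Geo_source: "Geo y z g \<Longrightarrow> y \<in> V"
  by (simp add: Geo_def)

lemma Geo_target: "Geo y z g \<Longrightarrow> z \<in> delta_set"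
  by (simp add: Geo_def)

lemma Inl_in_delta_set [simp]: "Inl x \<in> delta_set \<longleftrightarrow> x \<in> V"
  by (auto simp: delta_set_def)

lemma Inr_in_delta_set [simp]: "Inr c \<in> delta_set \<longleftrightarrow> c \<in> boundary"
  by (auto simp: delta_set_def)

lemma Geo_dist: "Geo y z g \<Longrightarrow> int (d (g i) (g j)) = \<bar>int (lev y z i) - int (lev y z j)\<bar>"
  by (simp add: Geo_def)

lemma Geo_dist_source: "Geo y z g \<Longrightarrow> d y (g i) = lev y z i"
  using Geo_dist[of y z g 0 i] by (simp add: Geo_0)

lemma Geo_dist_le: "Geo y z g \<Longrightarrow> i \<le> j \<Longrightarrow> d (g i) (g j) \<le> j - i"
  using Geo_dist[of y z g i j] by (cases z) auto

lemma Geo_lev: "Geo y z g \<Longrightarrow> g (lev y z i) = g i"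
  using Geo_dist[of y z g "lev y z i" i] dist_eq_0[of "g (lev y z i)" "g i"] Geo_V by simp

lemma Geo_eq: "Geo y z g \<Longrightarrow> lev y z i = lev y z j \<Longrightarrow> g i = g j"
  by (metis Geo_lev)

lemma Geo_vertex_end: "Geo y (Inl x) g \<Longrightarrow> d y x \<le> i \<Longrightarrow> g i = x"
  using Geo_eq[of y "Inl x" g i "d y x"] by (simp add: Geo_def)

lemma Geo_edge: "Geo y z g \<Longrightarrow> lev y z (Suc i) = Suc i \<Longrightarrow> {g i, g (Suc i)} \<in> E"
  using Geo_dist[of y z g i "Suc i"] lev_eqI[of y z "Suc i" i] Geo_V
  by (intro dist_1_edge) auto

lemma lev_step: "lev y z (Suc i) = lev y z i \<or> lev y z (Suc i) = Suc i"
  by (auto simp: lev_def split: sum.splits)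

lemma Geo_step: "Geo y z g \<Longrightarrow> g i = g (Suc i) \<or> {g i, g (Suc i)} \<in> E"
  using lev_step[of y z i] Geo_edge[of y z g i] Geo_eq[of y z g i "Suc i"] by auto

lemma ex_Geo_vertex: "y \<in> V \<Longrightarrow> x \<in> V \<Longrightarrow> \<exists>g. Geo y (Inl x) g"
  using ex_geodesic_fun[of y x] unfolding Geo_def lev_simps by auto

lemma Geo_vertexI:
  assumes "y \<in> V" "x \<in> V" "range g \<subseteq> V" "g 0 = y" "g (d y x) = x"
    "\<And>i j. int (d (g i) (g j)) = \<bar>int (min i (d y x)) - int (min j (d y x))\<bar>"
  shows "Geo y (Inl x) g"
  using assms by (simp add: Geo_def)

lemma Geo_rev: "Geo y (Inl x) g \<Longrightarrow> Geo x (Inl y) (\<lambda>i. g (d y x - i))"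
proof -
  assume g: "Geo y (Inl x) g"
  have V: "x \<in> V" "y \<in> V"
    using Geo_V[OF g] Geo_vertex_end[OF g order_refl] Geo_source[OF g] by metis+
  have "d x y = d y x"
    using dist_sym V by blast
  then show ?thesis
    using V Geo_V[OF g] Geo_0[OF g] Geo_vertex_end[OF g order_refl] Geo_dist[OF g]
    by (intro Geo_vertexI) auto
qed

lemma Geo_const: "y \<in> V \<Longrightarrow> Geo y (Inl y) (\<lambda>_. y)"
  by (intro Geo_vertexI) auto

lemma Geo_trunc: "Geo y z g \<Longrightarrow> lev y z n = n \<Longrightarrow> Geo y (Inl (g n)) (\<lambda>i. g (min i n))"
proof -
  assume g: "Geo y z g" and n: "lev y z n = n"
  then have "d y (g n) = n"
    by (simp add: Geo_dist_source)
  moreover have "lev y z (min i n) = min i n" for i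
    using lev_eqI[OF n] by simp
  ultimately show ?thesis
    using Geo_V[OF g] Geo_0[OF g] Geo_source[OF g] Geo_dist[OF g]
    by (intro Geo_vertexI) auto
qed

lemma infinite_geodesic_tail:
  assumes "infinite_geodesic g" shows "infinite_geodesic (\<lambda>i. g (n + i))"
  using assms unfolding infinite_geodesic_iff by auto

lemma boundary_tail: "c \<in> boundary \<Longrightarrow> g \<in> c \<Longrightarrow> (\<lambda>i. g (n + i)) \<in> c"
proof -
  assume c: "c \<in> boundary" "g \<in> c"
  then have g: "infinite_geodesic g"
    by (rule boundary_infinite_geodesic)
  have "int (d (g t) (g (n + t))) = int n" for t
    using g unfolding infinite_geodesic_iff by auto
  then have "\<forall>t. d (g t) (g (n + t)) \<le> n"
    by auto
  then show ?thesis
    using boundary_mem_iff[OF c] infinite_geodesic_tail[OF g] by blast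
qed

lemma Geo_boundaryI: "c \<in> boundary \<Longrightarrow> g \<in> c \<Longrightarrow> Geo (g 0) (Inr c) g"
  using boundary_infinite_geodesic[of c g] unfolding Geo_def infinite_geodesic_iff by auto

lemma Geo_boundaryD: "Geo y (Inr c) g \<Longrightarrow> infinite_geodesic g \<and> g 0 = y \<and> g \<in> c \<and> c \<in> boundary"
  using boundary_infinite_geodesic[of c g] unfolding Geo_def by auto

lemma Geo_tail:
  assumes g: "Geo y z g" and n: "lev y z n = n"
  shows "Geo (g n) z (\<lambda>i. g (n + i))"
proof (cases z)
  case (Inl x)
  have g': "Geo y (Inl x) g" and n': "n \<le> d y x"
    using g n Inl by auto
  have x: "x = g (d y x)" using Geo_vertex_end[OF g'] by simp
  have dx: "d (g n) x = d y x - n"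
    using Geo_dist[OF g', of n "d y x"] n' x by auto
  then show ?thesis
    using Geo_V[OF g] Geo_dist[OF g] Inl n' x dx
    by (auto intro!: Geo_vertexI) (metis x)+
next
  case (Inr c)
  then show ?thesis
    using Geo_boundaryI[of c "\<lambda>i. g (n + i)"] Geo_boundaryD[of y c g] boundary_tail[of c g n] g by simp
qed

section \<open>Short circuits forced by pairs of geodesics\<close>

definition edges_of :: "'v set \<Rightarrow> 'v set set" where
  "edges_of Z = {e \<in> E. e \<subseteq> Z}"

lemma edges_of_subset_E: "edges_of Z \<subseteq> E"
  by (auto simp: edges_of_def)

lemma Geo_walk:
  assumes g: "Geo y z g"
  shows "walk (edges_of (range g)) (d (g i) (g j)) (g i) (g j)"
proof -
  have *: "walk (edges_of (range g)) (d (g i) (g j)) (g i) (g j)" if "lev y z i \<le> lev y z j" for i j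
  proof -
    have "walk (edges_of (range g)) (lev y z j - lev y z i) (g (lev y z i)) (g (lev y z j))"
      using Geo_step[OF g] that by (intro walk_segment) (auto simp: edges_of_def)
    then show ?thesis
      using Geo_dist[OF g, of i j] that Geo_lev[OF g] by (simp flip: of_nat_diff)
  qed
  show ?thesis
    using *[of i j] *[of j i] dist_sym[OF Geo_V[OF g] Geo_V[OF g], of i j]
    by (cases "lev y z i \<le> lev y z j") (auto intro: walk_sym)
qed

text \<open>The distance from \<open>y\<close> grows by one along a geodesic from \<open>y\<close>,
  so only one edge can lead from level \<open>s\<close> to level \<open>s + 1\<close>. This
  identifies the edge that the circuit lemmas produce as the one at the same position.\<close>

lemma Geo_crossing_edge:
  assumes g: "Geo y z g" and e: "e \<in> edges_of (range g)" and c: "crosses e {x. s < d y x}"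
  shows "e = {g s, g (Suc s)}" "lev y z (Suc s) = Suc s"
proof -
  obtain u v where uv: "u \<in> e" "v \<in> e" "s < d y u" "d y v \<le> s"
    using c by (fastforce simp: crosses_def)
  then have "e = {v, u}"
    using e edges[of e] by (auto simp: edges_of_def)
  moreover obtain i j where ij: "u = g j" "v = g i"
    using uv e unfolding edges_of_def by blast
  ultimately have e': "e = {g i, g j}" "{g i, g j} \<in> E"
    using e by (auto simp: edges_of_def)
  have "lev y z j > s" "lev y z i \<le> s"
    using uv ij Geo_dist_source[OF g] by auto
  moreover have "\<bar>int (lev y z i) - int (lev y z j)\<bar> = 1"
    using dist_edge[OF e'(2)] Geo_dist[OF g, of i j] by simp
  ultimately have "lev y z j = Suc s" "lev y z i = s"
    by auto
  then show "e = {g s, g (Suc s)}" "lev y z (Suc s) = Suc s"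
    using e' Geo_lev[OF g, of i] Geo_lev[OF g, of j] lev_lev[of y z j] by auto
qed

text \<open>A geodesic from \<open>x\<close> of length at most \<open>k\<close> stays in the
  \<open>k\<close>-ball about \<open>x\<close>, which lies on one side of \<open>U\<close>.
  Connectors of circuits are handled this way.\<close>

lemma walk_not_crossing:
  assumes V: "x \<in> V" "x' \<in> V" and k: "d x x' \<le> k"
    and U: "(\<forall>p\<in>V. d x p \<le> k \<longrightarrow> p \<in> U) \<or> (\<forall>p\<in>V. d x p \<le> k \<longrightarrow> p \<notin> U)"
  shows "walk {e \<in> E. \<not> crosses e U} k x x'"
proof -
  obtain g where g: "Geo x (Inl x') g"
    using ex_Geo_vertex V by blast
  have x': "g (d x x') = x'" "g 0 = x"
    using Geo_vertex_end[OF g] Geo_0[OF g] by auto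
  have "d x (g i) \<le> k" for i
    using Geo_dist_source[OF g, of i] k by simp
  then have "range g \<subseteq> U \<or> range g \<inter> U = {}"
    using U Geo_V[OF g] by blast
  then have "edges_of (range g) \<subseteq> {e \<in> E. \<not> crosses e U}"
    by (auto simp: edges_of_def crosses_def)
  then show ?thesis
    using walk_le[OF walk_mono[OF Geo_walk[OF g, of 0 "d x x'"]]] k x' by simp
qed

text \<open>Closing up a geodesic segment \<open>g a, \<dots>, g b\<close> by a path \<open>x\<^sub>1, \<dots>, x\<^sub>2\<close> and two short
  connectors: the edge of \<open>g\<close> at level \<open>s\<close> lies on a short circuit with an edge of the path,
  since the connectors stay away from that level.\<close>

lemma quadrilateral_circuit:
  assumes g: "Geo y z g" and b: "lev y z b = b" and s: "a + k1 \<le> s" "s + k2 < b"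
    and w: "walk B n x1 x2" and B: "B \<subseteq> E" and V: "x1 \<in> V" "x2 \<in> V"
    and close: "d (g a) x1 \<le> k1" "d (g b) x2 \<le> k2"
  shows "\<exists>e'\<in>B. e' \<in> Circ (b - a + k1 + k2 + n + 1) {g s, g (Suc s)} \<and> crosses e' {x. s < d y x}"
proof -
  let ?U = "{x. s < d y x}" and ?e = "{g (Suc s), g s}"
  let ?B = "{e \<in> E. e \<noteq> ?e \<and> (crosses e ?U \<longrightarrow> e \<in> B)}"
  have lv: "d y (g i) = i" if "i \<le> b" for i
    using lev_eqI[OF b that] Geo_dist_source[OF g] by simp
  have eE: "?e \<in> E"
    using Geo_edge[OF g, of s] lev_eqI[OF b, of "Suc s"] s by (simp add: insert_commute)
  have cr: "crosses ?e ?U"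
    using lv[of s] lv[of "Suc s"] s by (auto simp: crosses_def)
  show ?thesis
  \<comment> \<open>If the path uses the edge itself, the circuit of length 2 will do; otherwise all
    edges of \<open>B\<close> are admissible in \<open>?B\<close>.\<close>
  proof (cases "?e \<in> B")
    case True
    then show ?thesis
      using Circ_refl[OF eE, of "b - a + k1 + k2 + n + 1"] cr s
      by (intro bexI[of _ ?e]) (auto simp: insert_commute)
  next
    case False
    have nc: "{e \<in> E. \<not> crosses e ?U} \<subseteq> ?B" and B': "B \<subseteq> ?B"
      using cr False B by auto
    have yV: "y \<in> V" using Geo_source[OF g] .
    have "walk {e \<in> E. \<not> crosses e ?U} k2 (g b) x2"
    proof (rule walk_not_crossing)
      have "s < d y p" if "p \<in> V" "d (g b) p \<le> k2" for p
        using dist_triangle[OF yV that(1) Geo_V[OF g], of b] that(2) lv[of b] s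
          dist_sym[OF that(1) Geo_V[OF g], of b] by simp
      then show "(\<forall>p\<in>V. d (g b) p \<le> k2 \<longrightarrow> p \<in> ?U) \<or> (\<forall>p\<in>V. d (g b) p \<le> k2 \<longrightarrow> p \<notin> ?U)"
        by blast
    qed (use Geo_V[OF g] V close in auto)
    then have w2: "walk ?B k2 (g b) x2"
      using nc by (rule walk_mono)
    have w1': "walk {e \<in> E. \<not> crosses e ?U} k1 (g a) x1"
    proof (rule walk_not_crossing)
      have "d y p \<le> s" if "p \<in> V" "d (g a) p \<le> k1" for p
        using dist_triangle[OF yV Geo_V[OF g] that(1), of a] that(2) lv[of a] s by simp
      then show "(\<forall>p\<in>V. d (g a) p \<le> k1 \<longrightarrow> p \<in> ?U) \<or> (\<forall>p\<in>V. d (g a) p \<le> k1 \<longrightarrow> p \<notin> ?U)"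
        by (simp add: leD)
    qed (use Geo_V[OF g] V close in auto)
    have w1: "walk ?B k1 x1 (g a)"
      by (rule walk_sym[OF walk_mono[OF w1' nc]])
    have st: "{g i, g (Suc i)} \<in> ?B" if "i < b" "i \<noteq> s" for i
    proof -
      have "{g i, g (Suc i)} \<in> E"
        using Geo_edge[OF g] lev_eqI[OF b, of "Suc i"] that by simp
      moreover have "\<not> crosses {g i, g (Suc i)} ?U"
        using lv[of i] lv[of "Suc i"] that by (auto simp: crosses_def)
      ultimately show ?thesis using nc by blast
    qed
    have w3: "walk ?B (b - Suc s) (g (Suc s)) (g b)"
      by (rule walk_segment) (use st s in auto)
    have w4: "walk ?B (s - a) (g a) (g s)"
      by (rule walk_segment) (use st s in auto)
    \<comment> \<open>The walk runs from \<open>g (Suc s)\<close> along \<open>g\<close> to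
      \<open>g b\<close>, over to \<open>x2\<close>, along the given path to \<open>x1\<close>, over
      to \<open>g a\<close> and along \<open>g\<close> to \<open>g s\<close>. Only the middle piece
      can change sides of level \<open>s\<close>.\<close>
    have "walk ?B ((b - Suc s) + k2 + n + k1 + (s - a)) (g (Suc s)) (g s)"
      by (rule walk_trans[OF walk_trans[OF walk_trans[OF walk_trans[OF w3 w2]
            walk_sym[OF walk_mono[OF w B']]] w1] w4])
    then have "\<exists>e'\<in>B. e' \<in> Circ (Suc ((b - Suc s) + k2 + n + k1 + (s - a))) ?e \<and> crosses e' ?U"
      using lv[of s] lv[of "Suc s"] s by (intro circuit_through_crossing eE) auto
    moreover have "Suc ((b - Suc s) + k2 + n + k1 + (s - a)) \<le> b - a + k1 + k2 + n + 1"
      using s by simp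
    ultimately show ?thesis
      using Circ_mono by (subst insert_commute) blast
  qed
qed

text \<open>This is \<open>circuit_through_crossing\<close> with the complement of \<open>p\<close>
  as \<open>U\<close>: the edges that cross it are those at \<open>p\<close>. The far half avoids
  \<open>p\<close>, so the circuit returns to \<open>p\<close> along an edge of the near half, that
  is, of \<open>B\<close>.\<close>

lemma vertex_circuit:
  assumes e: "{p, q} \<in> E" and far: "walk {e \<in> E. p \<notin> e} n1 q x"
    and near: "walk B n2 x p" and B: "B \<subseteq> E"
  shows "\<exists>e'\<in>B. e' \<in> Circ (n1 + n2 + 1) {p, q} \<and> p \<in> e'"
proof (cases "{p, q} \<in> B")
  case True
  have "n1 + n2 \<noteq> 0"
  proof
    assume "n1 + n2 = 0"
    then have "q = p" using far near by (simp add: walk_def)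
    then show False using e edge_in_V by blast
  qed
  then have "{p, q} \<in> Circ (n1 + n2 + 1) {p, q}"
    using e by (intro Circ_refl) auto
  then show ?thesis using True by blast
next
  case False
  let ?B = "{e \<in> E. e \<noteq> {q, p} \<and> (crosses e (- {p}) \<longrightarrow> e \<in> B)}"
  have "walk ?B n1 q x"
    using far by (rule walk_mono) (auto simp: crosses_def)
  moreover have "walk ?B n2 x p"
    using near by (rule walk_mono) (use False B in \<open>auto simp: insert_commute\<close>)
  ultimately have "walk ?B (n1 + n2) q p"
    by (rule walk_trans)
  then have "\<exists>e'\<in>B. e' \<in> Circ (Suc (n1 + n2)) {q, p} \<and> crosses e' (- {p})"
    using e edge_in_V[OF e] by (intro circuit_through_crossing) (auto simp: insert_commute)
  then show ?thesis
    by (auto simp: crosses_def insert_commute)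
qed

text \<open>A quadrilateral whose first connector is trivial, at the common source, and whose second
  one has length at most \<open>K\<close> at time \<open>t\<close>. The condition
  \<open>s + K < t\<close> keeps the latter above level \<open>s\<close>.\<close>

lemma same_source_circuit:
  assumes g: "Geo y z g" and h: "Geo y w h" and t: "lev y z t = t"
    and K: "d (g t) (h t) \<le> K" and s: "s + K < t"
  shows "{h s, h (Suc s)} \<in> Circ (2 * t + K + 1) {g s, g (Suc s)}" "lev y w (Suc s) = Suc s"
proof -
  have "walk (edges_of (range h)) (d (h 0) (h t)) (h 0) (h t)"
    by (rule Geo_walk[OF h])
  then have "walk (edges_of (range h)) t (h 0) (h t)"
    by (rule walk_le) (use Geo_dist_le[OF h, of 0 t] in simp)
  then have "\<exists>e'\<in>edges_of (range h). e' \<in> Circ (t - 0 + 0 + K + t + 1) {g s, g (Suc s)} \<and>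
      crosses e' {x. s < d y x}"
    using Geo_0[OF g] Geo_0[OF h] Geo_source[OF g] Geo_V[OF h] K s edges_of_subset_E
    by (intro quadrilateral_circuit[OF g t]) auto
  then obtain e' where e': "e' \<in> edges_of (range h)" "e' \<in> Circ (t - 0 + 0 + K + t + 1) {g s, g (Suc s)}"
      "crosses e' {x. s < d y x}"
    by blast
  have "t - 0 + 0 + K + t + 1 = 2 * t + K + 1" by simp
  then show "{h s, h (Suc s)} \<in> Circ (2 * t + K + 1) {g s, g (Suc s)}" "lev y w (Suc s) = Suc s"
    using Geo_crossing_edge[OF h e'(1,3)] e'(2) by metis+
qed

lemma Geo_finite_geodesic:
  assumes g: "Geo y (Inl x) g"
  shows "finite_geodesic (map g [0..<Suc (d y x)])"
proof -
  have "finite_path (map g [0..<Suc (d y x)])"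
    unfolding finite_path_def using Geo_V[OF g] Geo_step[OF g]
    by (auto simp: nth_append less_Suc_eq_le simp del: upt_Suc)
  then show ?thesis
    unfolding finite_geodesic_def using Geo_dist[OF g] by (auto simp del: upt_Suc)
qed

end

section \<open>Thin triangles\<close>

text \<open>The real hyperbolicity constant is rounded up, so that the estimates become linear
  inequalities between natural numbers.\<close>

locale fine_hyperbolic_graph = connected_graph V E
  for V :: "'v set" and E :: "'v set set" +
  fixes \<delta> :: nat
  assumes fine: fine_graph
    and thin: "\<And>\<alpha> \<beta> k. finite_geodesic \<alpha> \<Longrightarrow> finite_geodesic \<beta> \<Longrightarrow> hd \<alpha> = hd \<beta> \<Longrightarrow>
      real k \<le> gromov_product (last \<alpha>) (last \<beta>) (hd \<alpha>) \<Longrightarrow> d (\<alpha> ! k) (\<beta> ! k) \<le> \<delta>"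
begin

lemma thin_Geo:
  assumes g: "Geo y (Inl x) g" and h: "Geo y (Inl x') h" and k: "2 * k + d x x' \<le> d y x + d y x'"
  shows "d (g k) (h k) \<le> \<delta>"
proof -
  have V: "x \<in> V" "x' \<in> V" "y \<in> V"
    using Geo_target[OF g] Geo_target[OF h] Geo_source[OF g] by auto
  have le: "k \<le> d y x" "k \<le> d y x'"
    using k dist_triangle[OF V(3,1,2)] dist_triangle[OF V(3,2,1)] dist_sym[OF V(1,2)] by linarith+
  have "d (map g [0..<Suc (d y x)] ! k) (map h [0..<Suc (d y x')] ! k) \<le> \<delta>"
  proof (rule thin)
    show "real k \<le> gromov_product (last (map g [0..<Suc (d y x)])) (last (map h [0..<Suc (d y x')]))
       (hd (map g [0..<Suc (d y x)]))"
      using k Geo_0[OF g] Geo_vertex_end[OF g order_refl] Geo_vertex_end[OF h order_refl]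
        dist_sym[OF V(1,3)] dist_sym[OF V(2,3)]
      by (simp add: gromov_product_def hd_map last_map del: upt_Suc)
  qed (use Geo_finite_geodesic g h Geo_0[OF g] Geo_0[OF h] in \<open>auto simp: hd_map simp del: upt_Suc\<close>)
  then show ?thesis
    using le by (simp del: upt_Suc)
qed

text \<open>Up to the Gromov product of \<open>x\<close> and \<open>y'\<close> at \<open>y\<close>,
  the point \<open>g t\<close> is close to \<open>f t\<close>. Beyond it, the distance from
  \<open>x\<close> to \<open>g t\<close> is at most the Gromov product of \<open>y\<close> and
  \<open>y'\<close> at \<open>x\<close>, so the reversed geodesics from \<open>x\<close> are close
  there.\<close>

lemma slim_vertex:
  assumes g: "Geo y (Inl x) g" and g': "Geo y' (Inl x) g'" and f: "Geo y (Inl y') f"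
  shows "t \<le> d y y' \<and> d (g t) (f t) \<le> \<delta> \<or> (\<exists>t'. d (g t) (g' t') \<le> \<delta>)"
proof -
  have V: "x \<in> V" "y' \<in> V" "y \<in> V"
    using Geo_target[OF g] Geo_source[OF g'] Geo_source[OF g] by auto
  let ?D = "d y x" and ?D' = "d y' x"
  consider "?D \<le> t" | "t < ?D" "2 * t + ?D' \<le> ?D + d y y'" | "t < ?D" "?D + d y y' \<le> 2 * t + ?D'"
    by linarith
  then show ?thesis
  proof cases
    case 1
    then have "d (g t) (g' ?D') = 0"
      using Geo_vertex_end[OF g] Geo_vertex_end[OF g'] V by simp
    then show ?thesis by (metis le0)
  next
    case 2
    have "d x y' = ?D'"
      using dist_sym V by blast
    then have "d (g t) (f t) \<le> \<delta>"
      using 2 by (intro thin_Geo[OF g f]) simp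
    moreover have "t \<le> d y y'"
      using 2 dist_triangle[OF V(3,2,1)] by linarith
    ultimately show ?thesis by blast
  next
    case 3
    have "d x y = ?D" "d x y' = ?D'"
      using dist_sym V by blast+
    then have "d (g (?D - (?D - t))) (g' (?D' - (?D - t))) \<le> \<delta>"
      using 3 by (intro thin_Geo[OF Geo_rev[OF g] Geo_rev[OF g']]) simp
    then show ?thesis using 3 by auto
  qed
qed

lemma slim_vertex':
  assumes g: "Geo y (Inl x) g" and g': "Geo y' (Inl x) g'" and f: "Geo y (Inl y') f"
  shows "d (f t) (g t) \<le> \<delta> \<or> (\<exists>t'. d (f t) (g' t') \<le> \<delta>)"
  using slim_vertex[OF f Geo_rev[OF g'] g, of t] by auto

text \<open>For a boundary point, replace it by a vertex far out on the ray.\<close>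

lemma boundary_approximation:
  assumes g: "Geo y (Inr c) g" and g': "Geo y' (Inr c) g'" and p: "p \<in> V"
  shows "\<exists>N. \<forall>n\<ge>N. \<forall>h t'. Geo y' (Inl (g n)) h \<longrightarrow> d p (h t') \<le> \<delta> \<longrightarrow> (\<exists>t''. d p (g' t'') \<le> 2 * \<delta>)"
proof -
  note bg = Geo_boundaryD[OF g] and bg' = Geo_boundaryD[OF g']
  obtain C where C: "\<And>t. d (g t) (g' t) \<le> C"
    using boundary_mem_iff[of c g g'] bg bg' by blast
  let ?r = "d y y'"
  \<comment> \<open>Here \<open>n\<close> is so large that \<open>t\<close>, which is at most
    \<open>d y' p + \<delta>\<close>, stays below the Gromov product of \<open>g n\<close> and
    \<open>g' n\<close> at \<open>y'\<close>: these points are \<open>C\<close>-close and at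
    distance at least \<open>n - d y y'\<close> from \<open>y'\<close>.\<close>
  have "\<exists>t''. d p (g' t'') \<le> 2 * \<delta>"
    if n: "n \<ge> d y' p + \<delta> + ?r + C" and h: "Geo y' (Inl (g n)) h" and t': "d p (h t') \<le> \<delta>" for n h t'
  proof -
    let ?L = "d y' (g n)"
    define t where "t = min t' ?L"
    have ht: "h t' = h t"
      using Geo_eq[OF h, of t' t] by (simp add: t_def)
    have V: "y \<in> V" "y' \<in> V" "g n \<in> V" "h t \<in> V" "g' t \<in> V"
      using Geo_source[OF g] Geo_source[OF g'] Geo_V[OF g] Geo_V[OF h] Geo_V[OF g'] by auto
    have "n \<le> ?r + ?L"
      using dist_triangle[OF V(1,2,3)] Geo_dist_source[OF g, of n] by simp
    moreover have "t \<le> d y' p + \<delta>"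
      using dist_triangle[OF V(2) p V(4)] Geo_dist_source[OF h, of t] t' ht by (simp add: t_def)
    moreover have "d y' (g' n) = n"
      using Geo_dist_source[OF g'] by simp
    ultimately have "2 * t + d (g n) (g' n) \<le> d y' (g n) + d y' (g' n)"
      using n C[of n] by linarith
    then have "d (h t) (g' (min t n)) \<le> \<delta>"
      by (intro thin_Geo[OF h Geo_trunc[OF g']]) simp_all
    then show ?thesis
      using dist_triangle[OF p V(4) Geo_V[OF g'], of "min t n"] t' ht by (intro exI[of _ "min t n"]) simp
  qed
  then show ?thesis by blast
qed

text \<open>For a boundary point the triangle has its third corner at \<open>g n\<close> far out.
  Passing from its side to the ray \<open>g'\<close> costs another \<delta>, whence the constant
  \<open>2 * \<delta>\<close>.\<close>

lemma slim:
  assumes g: "Geo y z g" and g': "Geo y' z g'" and f: "Geo y (Inl y') f"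
  shows "t \<le> d y y' \<and> d (g t) (f t) \<le> \<delta> \<or> (\<exists>t'. d (g t) (g' t') \<le> 2 * \<delta>)"
proof (cases z)
  case (Inl x)
  then show ?thesis
    using slim_vertex[of y x g y' g' f t] assms by (auto intro: trans_le_add1 simp: mult_2)
next
  case (Inr c)
  obtain N where N: "\<And>n h t'. n \<ge> N \<Longrightarrow> Geo y' (Inl (g n)) h \<Longrightarrow> d (g t) (h t') \<le> \<delta> \<Longrightarrow>
      \<exists>t''. d (g t) (g' t'') \<le> 2 * \<delta>"
    using boundary_approximation[of y c g y' g' "g t"] g g' Geo_V[OF g] Inr by blast
  define n where "n = max N t"
  obtain h where h: "Geo y' (Inl (g n)) h"
    using ex_Geo_vertex Geo_source[OF g'] Geo_V[OF g] by blast
  have "t \<le> d y y' \<and> d (g (min t n)) (f t) \<le> \<delta> \<or> (\<exists>t'. d (g (min t n)) (h t') \<le> \<delta>)"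
    by (rule slim_vertex[OF Geo_trunc[OF g] h f]) (simp add: Inr)
  then show ?thesis
    using N[OF _ h] by (auto simp: n_def)
qed

lemma slim':
  assumes g: "Geo y z g" and g': "Geo y' z g'" and f: "Geo y (Inl y') f"
  shows "d (f t) (g t) \<le> \<delta> \<or> (\<exists>t'. d (f t) (g' t') \<le> 2 * \<delta>)"
proof (cases z)
  case (Inl x)
  then show ?thesis
    using slim_vertex'[of y x g y' g' f t] assms by (auto intro: trans_le_add1 simp: mult_2)
next
  case (Inr c)
  obtain N where N: "\<And>n h t'. n \<ge> N \<Longrightarrow> Geo y' (Inl (g n)) h \<Longrightarrow> d (f t) (h t') \<le> \<delta> \<Longrightarrow>
      \<exists>t''. d (f t) (g' t'') \<le> 2 * \<delta>"
    using boundary_approximation[of y c g y' g' "f t"] g g' Geo_V[OF f] Inr by blast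
  define n where "n = max N t"
  obtain h where h: "Geo y' (Inl (g n)) h"
    using ex_Geo_vertex Geo_source[OF g'] Geo_V[OF g] by blast
  have "d (f t) (g (min t n)) \<le> \<delta> \<or> (\<exists>t'. d (f t) (h t') \<le> \<delta>)"
    by (rule slim_vertex'[OF Geo_trunc[OF g] h f]) (simp add: Inr)
  then show ?thesis
    using N[OF _ h] by (auto simp: n_def)
qed

text \<open>In a triangle with \<open>y' = y\<close> the side \<open>f\<close> is constant, so
  \<open>g t\<close> is \<open>2 * \<delta>\<close>-close to some \<open>g' t'\<close>. Levels are
  distances from the common source, so those of \<open>t\<close> and \<open>t'\<close> differ by at
  most \<open>2 * \<delta>\<close> as well.\<close>

lemma bigon_synchronous:
  assumes g: "Geo y z g" and g': "Geo y z g'"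
  shows "d (g t) (g' t) \<le> 4 * \<delta>"
proof (cases "t = 0")
  case True
  then show ?thesis
    using Geo_0[OF g] Geo_0[OF g'] Geo_source[OF g] by simp
next
  case False
  have y: "y \<in> V" using Geo_source[OF g] .
  then have "\<exists>t'. d (g t) (g' t') \<le> 2 * \<delta>"
    using slim[OF g g' Geo_const[OF y], of t] False by auto
  then obtain t' where t': "d (g t) (g' t') \<le> 2 * \<delta>" by blast
  note V = Geo_V[OF g] Geo_V[OF g']
  have "lev y z t \<le> lev y z t' + 2 * \<delta>"
    using dist_triangle[OF y V(2) V(1), of t t'] t' dist_sym[OF V(1) V(2), of t t']
      Geo_dist_source[OF g, of t] Geo_dist_source[OF g', of t'] by linarith
  moreover have "lev y z t' \<le> lev y z t + 2 * \<delta>"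
    using dist_triangle[OF y V(1) V(2), of t' t] t'
      Geo_dist_source[OF g, of t] Geo_dist_source[OF g', of t'] by linarith
  ultimately have "d (g' t') (g' t) \<le> 2 * \<delta>"
    using Geo_dist[OF g', of t' t] by linarith
  then show ?thesis
    using dist_triangle[OF V(1) V(2) V(2), of t t t'] t' by linarith
qed

text \<open>Thinness applies at a time \<open>k\<close> that lies \<open>K\<close> below
  \<open>n\<close> and both levels at \<open>t\<close>, since this is below the Gromov product of
  \<open>g t\<close> and \<open>h t\<close>. Returning from \<open>k\<close> to \<open>n\<close>
  costs at most \<open>2 * K\<close> on either geodesic.\<close>

lemma fellow_travel_below:
  assumes g: "Geo y z g" and h: "Geo y w h" and K: "d (g t) (h t) \<le> K" and n: "n \<le> t"
  shows "d (g n) (h n) \<le> \<delta> + 4 * K"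
proof -
  let ?A = "lev y z t" and ?B = "lev y w t"
  define k where "k = min n (min ?A ?B) - K"
  have y: "y \<in> V" using Geo_source[OF g] .
  note V = Geo_V[OF g] Geo_V[OF h]
  have AB: "?A \<le> ?B + K" "?B \<le> ?A + K"
    using dist_triangle[OF y V(2) V(1), of t t] dist_triangle[OF y V(1) V(2), of t t] K
      dist_sym[OF V(1) V(2), of t t]
      Geo_dist_source[OF g, of t] Geo_dist_source[OF h, of t] by linarith+
  have kk: "d (g k) (h k) \<le> \<delta>"
  proof (cases "k = 0")
    case True
    then show ?thesis
      using Geo_0[OF g] Geo_0[OF h] y by simp
  next
    case False
    have gt: "g ?A = g t" "h ?B = h t"
      using Geo_lev g h by blast+
    have "d y (g t) = ?A" "d y (h t) = ?B"
      using Geo_dist_source g h by blast+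
    moreover have "2 * k + K \<le> ?A + ?B"
      using False by (simp add: k_def)
    ultimately have "d (g (min k ?A)) (h (min k ?B)) \<le> \<delta>"
      using K gt by (intro thin_Geo[OF Geo_trunc[OF g lev_lev] Geo_trunc[OF h lev_lev]]) simp
    moreover have "min k ?A = k" "min k ?B = k"
      by (auto simp: k_def)
    ultimately show ?thesis by simp
  qed
  have "lev y z k = k" "lev y w k = k"
    using lev_eqI[OF lev_lev, of k y z t] lev_eqI[OF lev_lev, of k y w t] by (auto simp: k_def)
  moreover have "lev y z n \<le> ?A" "lev y w n \<le> ?B" "lev y z n \<le> n" "lev y w n \<le> n"
    using lev_mono[OF n] lev_le by auto
  moreover have "lev y z k \<le> lev y z n" "lev y w k \<le> lev y w n"
    by (intro lev_mono; simp add: k_def)+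
  ultimately have "d (g n) (g k) \<le> 2 * K" "d (h k) (h n) \<le> 2 * K"
    using Geo_dist[OF g, of n k] Geo_dist[OF h, of k n] AB unfolding k_def by linarith+
  then show ?thesis
    using dist_triangle[OF V(1) V(1) V(2), of n n k] dist_triangle[OF V(1) V(2) V(2), of k n k] kk
    by linarith
qed

text \<open>In contrast to \<open>same_source_circuit\<close>, the length bound depends on \<open>\<delta>\<close> only. The
  linear bound on the size of the candidate sets rests on this.\<close>

definition "mu = 16 * \<delta> + 3"

lemma ex3I: "P x y z \<Longrightarrow> \<exists>x y z. P x y z"
  by blast

lemma uniform_circuit:
  assumes g: "Geo y z g" and g': "Geo y' z g'" and s: "lev y z (Suc s) = Suc s"
    and far: "y = y' \<or> d y y' + 2 * \<delta> < s"
  shows "\<exists>e'\<in>edges_of (range g'). e' \<in> Circ mu {g s, g (Suc s)} \<and> crosses e' {x. s < d y x}"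
proof -
  have y: "y \<in> V" "y' \<in> V" using Geo_source g g' by blast+
  obtain f where f: "Geo y (Inl y') f"
    using ex_Geo_vertex y by blast
  have close: "\<exists>t'. d (g t) (g' t') \<le> 2 * \<delta>" if "t > d y y'" for t
    using slim[OF g g' f, of t] that by auto
  \<comment> \<open>The lower connector sits \<open>2 * \<delta>\<close> below level
    \<open>s\<close>, beyond the reach of the side from \<open>y\<close> to \<open>y'\<close>. Close
    to a common source it is the source itself.\<close>
  have "\<exists>a k1 t1. a + k1 \<le> s \<and> k1 \<le> 2 * \<delta> \<and> s \<le> a + 2 * \<delta> \<and> d (g a) (g' t1) \<le> k1"
  proof (cases "d y y' + 2 * \<delta> < s")
    case True
    then have "d y y' < s - 2 * \<delta>"
      by linarith
    then obtain t1 where "d (g (s - 2 * \<delta>)) (g' t1) \<le> 2 * \<delta>"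
      using close by blast
    then show ?thesis
      using True by (intro ex3I[of _ "s - 2 * \<delta>" "2 * \<delta>" t1]) auto
  next
    case False
    then show ?thesis
      using far y Geo_0[OF g] Geo_0[OF g']
      by (intro ex3I[of _ 0 0 0]) auto
  qed
  then obtain a k1 t1 where a: "a + k1 \<le> s" "k1 \<le> 2 * \<delta>" "s \<le> a + 2 * \<delta>" "d (g a) (g' t1) \<le> k1"
    by blast
  \<comment> \<open>The upper connector sits \<open>2 * \<delta> + 1\<close> above level
    \<open>s\<close>. If \<open>z\<close> is a vertex that comes earlier, both geodesics end there
    and the connector is trivial.\<close>
  have "\<exists>b k2 t2. lev y z b = b \<and> s + k2 < b \<and> k2 \<le> 2 * \<delta> \<and> b \<le> s + 2 * \<delta> + 1 \<and> d (g b) (g' t2) \<le> k2"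
  proof (cases "lev y z (s + 2 * \<delta> + 1) = s + 2 * \<delta> + 1")
    case True
    obtain t2 where "d (g (s + 2 * \<delta> + 1)) (g' t2) \<le> 2 * \<delta>"
    proof (cases "y = y'")
      case True then show ?thesis using close[of "s + 2 * \<delta> + 1"] that y by auto
    next
      case False then show ?thesis using close[of "s + 2 * \<delta> + 1"] that far by auto
    qed
    then show ?thesis
      using True by (intro ex3I[of _ "s + 2 * \<delta> + 1" "2 * \<delta>" t2]) auto
  next
    case False
    then obtain x where x: "z = Inl x" "d y x < s + 2 * \<delta> + 1"
      by (cases z) auto
    then have "g (d y x) = x" "g' (d y' x) = x" "x \<in> V"
      using Geo_vertex_end g g' Geo_target[OF g] by auto
    then show ?thesis
      using x s by (intro ex3I[of _ "d y x" 0 "d y' x"]) auto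
  qed
  then obtain b k2 t2 where b: "lev y z b = b" "s + k2 < b" "k2 \<le> 2 * \<delta>" "b \<le> s + 2 * \<delta> + 1"
      "d (g b) (g' t2) \<le> k2"
    by blast
  note V = Geo_V[OF g] Geo_V[OF g']
  have "d (g' t1) (g' t2) \<le> d (g' t1) (g a) + d (g a) (g b) + d (g b) (g' t2)"
    using dist_triangle[OF V(2) V(1) V(2), of t1 t2 a] dist_triangle[OF V(1) V(1) V(2), of a t2 b]
    by linarith
  then have len: "d (g' t1) (g' t2) \<le> k1 + (b - a) + k2"
    using a b dist_sym[OF V(2) V(1), of t1 a] Geo_dist_le[OF g, of a b] by linarith
  have "\<exists>e'\<in>edges_of (range g'). e' \<in> Circ (b - a + k1 + k2 + d (g' t1) (g' t2) + 1) {g s, g (Suc s)} \<and>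
      crosses e' {x. s < d y x}"
    using a b V by (intro quadrilateral_circuit[OF g b(1) _ _ Geo_walk[OF g'] edges_of_subset_E]) auto
  \<comment> \<open>Here \<open>b - a\<close> is at most \<open>4 * \<delta> + 1\<close> and
    \<open>k1 + k2\<close> at most \<open>4 * \<delta>\<close>. Their sum also bounds the arc of
    \<open>g'\<close>, so the total is \<open>2 * (8 * \<delta> + 1) + 1\<close>.\<close>
  moreover have "b - a + k1 + k2 + d (g' t1) (g' t2) + 1 \<le> mu"
    using len a b unfolding mu_def by linarith
  ultimately show ?thesis
    using Circ_mono by blast
qed

lemma bigon_circuit:
  assumes g: "Geo y z g" and g': "Geo y z g'" and s: "lev y z (Suc s) = Suc s"
  shows "{g' s, g' (Suc s)} \<in> Circ mu {g s, g (Suc s)}"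
  using uniform_circuit[OF g g' s] Geo_crossing_edge[OF g'] by metis

end

section \<open>Rays and neighbourhoods of boundary points\<close>

text \<open>Prefixes are extended so that infinitely many \<open>h n\<close> agree with them; the
  limit \<open>p\<close> is thus reproduced on every initial segment by arbitrarily late
  \<open>h n\<close>. That \<open>h n s\<close> lies in \<open>F s\<close> only for large
  \<open>n\<close> is harmless, as finitely many \<open>n\<close> can be discarded.\<close>

lemma koenig:
  fixes h :: "nat \<Rightarrow> nat \<Rightarrow> 'a"
  assumes fin: "\<And>s. finite (F s)" and ev: "\<And>s. \<exists>n1. \<forall>n\<ge>n1. h n s \<in> F s"
  shows "\<exists>p. \<forall>s N. \<exists>n\<ge>N. \<forall>i\<le>s. h n i = p i"
proof -
  let ?A = "\<lambda>xs. {n. \<forall>i<length xs. h n i = xs ! i}"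
  have "\<exists>f. \<forall>s. (length (f s) = s \<and> infinite (?A (f s))) \<and> (\<exists>a. f (Suc s) = f s @ [a])"
  proof (rule dependent_nat_choice)
    show "\<exists>xs. length xs = 0 \<and> infinite (?A xs)" by auto
  next
    fix xs and s :: nat
    assume xs: "length xs = s \<and> infinite (?A xs)"
    obtain n1 where n1: "\<And>n. n \<ge> n1 \<Longrightarrow> h n s \<in> F s"
      using ev by blast
    let ?B = "?A xs - {..<n1}"
    have len: "length xs = s" and inf: "infinite (?A xs)"
      using xs by auto
    have "infinite ?B" using inf by (rule Diff_infinite_finite[rotated]) simp
    moreover have "(\<lambda>n. h n s) ` ?B \<subseteq> F s"
      by (auto intro!: n1 simp: not_less)
    then have "finite ((\<lambda>n. h n s) ` ?B)"
      using fin finite_subset by blast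
    ultimately obtain n0 where n0: "infinite {n \<in> ?B. h n s = h n0 s}"
      using pigeonhole_infinite by blast
    have "{n \<in> ?B. h n s = h n0 s} \<subseteq> ?A (xs @ [h n0 s])"
      using len by (auto simp: nth_append less_Suc_eq)
    then have "infinite (?A (xs @ [h n0 s]))"
      using n0 finite_subset by blast
    then show "\<exists>ys. (length ys = Suc s \<and> infinite (?A ys)) \<and> (\<exists>a. ys = xs @ [a])"
      using len by (intro exI[of _ "xs @ [h n0 s]"] conjI) simp_all
  qed
  then obtain f where f: "\<And>s. length (f s) = s" "\<And>s. infinite (?A (f s))" "\<And>s. \<exists>a. f (Suc s) = f s @ [a]"
    by blast
  have pre: "f (s + k) ! i = f s ! i" if "i < s" for s k i
  proof (induction k)
    case (Suc k)
    obtain a where "f (Suc (s + k)) = f (s + k) @ [a]" using f(3) by blast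
    then show ?case using Suc that f(1)[of "s + k"] by (simp add: nth_append)
  qed simp
  have "\<exists>n\<ge>N. \<forall>i\<le>s. h n i = f (Suc i) ! i" for s N
  proof -
    obtain n where n: "n \<ge> N" "n \<in> ?A (f (Suc s))"
      using f(2)[of "Suc s"] by (meson infinite_nat_iff_unbounded_le)
    have "h n i = f (Suc i) ! i" if "i \<le> s" for i
      using n(2) that pre[of i "Suc i" "s - i"] f(1)[of "Suc s"] by simp
    then show ?thesis using n(1) by blast
  qed
  then show ?thesis by (intro exI[of _ "\<lambda>i. f (Suc i) ! i"]) simp
qed

context connected_graph
begin

text \<open>For an edge these sets are finite by fineness. They supply the finite sets
  \<open>A\<close> that define the neighbourhoods \<open>M x A\<close>.\<close>

definition cvert :: "nat \<Rightarrow> 'v set \<Rightarrow> 'v set" where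
  "cvert n e = \<Union> (Circ n e)"

lemma cvert_subset_V: "cvert n e \<subseteq> V"
  using Circ_subset_E edge_subset_V by (fastforce simp: cvert_def)

text \<open>\<open>dbl a z w k1 k2\<close>: the sequences \<open>k1\<close> and \<open>k2\<close> are the two halves of a geodesic between
  \<open>z\<close> and \<open>w\<close> that is cut at its vertex \<open>a\<close>.\<close>

definition dbl :: "'v \<Rightarrow> 'v + (nat \<Rightarrow> 'v) set \<Rightarrow> 'v + (nat \<Rightarrow> 'v) set \<Rightarrow> (nat \<Rightarrow> 'v) \<Rightarrow> (nat \<Rightarrow> 'v) \<Rightarrow> bool"
  where "dbl a z w k1 k2 \<longleftrightarrow> Geo a z k1 \<and> Geo a w k2 \<and> (\<forall>i j. d (k1 i) (k2 j) = lev a z i + lev a w j)"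

lemma dbl_walk:
  assumes k: "dbl a z w k1 k2" and x: "x1 \<in> range k1 \<union> range k2" "x2 \<in> range k1 \<union> range k2"
  shows "walk (edges_of (range k1 \<union> range k2)) (d x1 x2) x1 x2"
proof -
  let ?B = "edges_of (range k1 \<union> range k2)"
  have k1: "Geo a z k1" and k2: "Geo a w k2" and s: "d (k1 i) (k2 j) = lev a z i + lev a w j" for i j
    using k by (auto simp: dbl_def)
  have w1: "walk ?B (d (k1 i) (k1 j)) (k1 i) (k1 j)" and w2: "walk ?B (d (k2 i) (k2 j)) (k2 i) (k2 j)" for i j
    by (rule walk_mono[OF Geo_walk[OF k1]] walk_mono[OF Geo_walk[OF k2]], force simp: edges_of_def)+
  have w12: "walk ?B (d (k1 i) (k2 j)) (k1 i) (k2 j)" for i j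
  proof -
    have "walk ?B (d (k1 i) (k1 0) + d (k2 0) (k2 j)) (k1 i) (k2 j)"
      using w1[of i 0] w2[of 0 j] Geo_0[OF k1] Geo_0[OF k2] by (intro walk_trans) auto
    moreover have "d (k1 i) (k1 0) = lev a z i" "d (k2 0) (k2 j) = lev a w j"
      using Geo_dist[OF k1, of i 0] Geo_dist[OF k2, of 0 j] by auto
    ultimately show ?thesis using s by simp
  qed
  then have "walk ?B (d (k2 j) (k1 i)) (k2 j) (k1 i)" for i j
    using dist_sym[OF Geo_V[OF k1] Geo_V[OF k2]] walk_sym by metis
  then show ?thesis
    using x w1 w2 w12 by auto
qed

text \<open>A shortcut between the two halves would make the way from \<open>x\<close> to
  \<open>y\<close> shorter than \<open>d x a + d a y\<close>.\<close>

lemma dbl_vertices: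
  assumes p: "Geo a (Inl x) p" and q: "Geo a (Inl y) q" and a: "d x a + d a y = d x y"
  shows "dbl a (Inl x) (Inl y) p q"
proof -
  have "d (p i) (q j) = lev a (Inl x) i + lev a (Inl y) j" for i j
  proof -
    have V: "a \<in> V" "x \<in> V" "y \<in> V" "p i \<in> V" "q j \<in> V"
      using Geo_source[OF p] Geo_target[OF p] Geo_target[OF q] Geo_V[OF p] Geo_V[OF q] by auto
    have "d (p i) x = d a x - lev a (Inl x) i" "d (q j) y = d a y - lev a (Inl y) j"
      using Geo_dist[OF p, of i "d a x"] Geo_dist[OF q, of j "d a y"]
        Geo_vertex_end[OF p order_refl] Geo_vertex_end[OF q order_refl] by auto
    moreover have "d a (p i) = lev a (Inl x) i" "d a (q j) = lev a (Inl y) j"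
      using Geo_dist_source p q by blast+
    moreover have "lev a (Inl x) i \<le> d a x" "lev a (Inl y) j \<le> d a y" by simp_all
    moreover have "d x y \<le> d x (p i) + (d (p i) (q j) + d (q j) y)"
      using dist_triangle[OF V(2,4,3)] dist_triangle[OF V(4,5,3)] by linarith
    moreover have "d (p i) (q j) \<le> d (p i) a + d a (q j)"
      using dist_triangle[OF V(4,1,5)] .
    ultimately show ?thesis
      using a dist_sym[OF V(4,2)] dist_sym[OF V(1,2)] dist_sym[OF V(1,4)] by linarith
  qed
  then show ?thesis
    using p q by (simp add: dbl_def)
qed

lemma Geo_split:
  assumes g: "Geo y z g" and a: "a \<in> range g"
  shows "g (d y a) = a" "lev y z (d y a) = d y a"
proof -
  obtain i where "a = g i" using a by blast
  then have "d y a = lev y z i" "g (lev y z i) = a"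
    using Geo_dist_source[OF g] Geo_lev[OF g] by auto
  then show "g (d y a) = a" "lev y z (d y a) = d y a" by auto
qed

lemma Geo_of_finite_geodesic:
  assumes p: "finite_geodesic p"
  shows "Geo (hd p) (Inl (last p)) (\<lambda>i. p ! min i (length p - 1))"
    "range (\<lambda>i. p ! min i (length p - 1)) = set p"
proof -
  have ne: "p \<noteq> []" and sub: "set p \<subseteq> V"
    and dist: "\<And>m n. m < length p \<Longrightarrow> n < length p \<Longrightarrow> int (d (p ! m) (p ! n)) = \<bar>int m - int n\<bar>"
    using p by (auto simp: finite_geodesic_def finite_path_def)
  have le: "min i (length p - 1) < length p" for i
    using ne by (simp add: min.strict_coboundedI2)
  show r: "range (\<lambda>i. p ! min i (length p - 1)) = set p"
  proof (intro equalityI subsetI)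
    fix x assume "x \<in> set p"
    then obtain i where "i < length p" "x = p ! i" by (metis in_set_conv_nth)
    then show "x \<in> range (\<lambda>i. p ! min i (length p - 1))" by (intro image_eqI[of _ _ i]) auto
  qed (use le in auto)
  have D: "d (hd p) (last p) = length p - 1"
    using dist[of 0 "length p - 1"] ne by (simp add: hd_conv_nth last_conv_nth)
  have "hd p \<in> V" "last p \<in> V"
    using ne sub by auto
  then show "Geo (hd p) (Inl (last p)) (\<lambda>i. p ! min i (length p - 1))"
  proof (rule Geo_vertexI)
    show "int (d (p ! min i (length p - 1)) (p ! min j (length p - 1))) =
        \<bar>int (min i (d (hd p) (last p))) - int (min j (d (hd p) (last p)))\<bar>" for i j
      unfolding D by (rule dist[OF le le])
  qed (unfold D, use ne sub r in \<open>auto simp: hd_conv_nth last_conv_nth\<close>)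
qed

lemma Geo_imp_geodesics:
  assumes g: "Geo x z g"
  shows "\<exists>\<alpha>\<in>geodesics (Inl x) z. vertices \<alpha> = range g"
proof (cases z)
  case (Inl w)
  let ?p = "map g [0..<Suc (d x w)]"
  have g': "Geo x (Inl w) g" using g Inl by simp
  have "g i \<in> set ?p" for i
    using Geo_lev[OF g', of i] by (auto intro!: image_eqI[of _ _ "min i (d x w)"] simp del: upt_Suc)
  then have "set ?p = range g" by (auto simp del: upt_Suc)
  moreover have "finite_geodesic ?p" "hd ?p = x" "last ?p = w"
    using Geo_finite_geodesic[OF g'] Geo_0[OF g'] Geo_vertex_end[OF g' order_refl]
    by (auto simp: hd_map last_map simp del: upt_Suc)
  ultimately show ?thesis
    unfolding Inl geodesics.simps by (intro bexI[of _ "Finite ?p"]) auto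
next
  case (Inr c)
  then show ?thesis
    using Geo_boundaryD[of x c g] g by auto
qed

lemma geodesics_imp_Geo:
  assumes x: "x \<in> V" and z: "z \<in> delta_set" and \<alpha>: "\<alpha> \<in> geodesics (Inl x) z"
  shows "\<exists>g. Geo x z g \<and> vertices \<alpha> = range g"
proof (cases z)
  case (Inl w)
  then obtain p where "\<alpha> = Finite p" "finite_geodesic p" "hd p = x" "last p = w"
    using \<alpha> by auto
  then show ?thesis
    using Geo_of_finite_geodesic[of p] Inl by auto
next
  case (Inr c)
  then obtain g where "\<alpha> = Infinite g" "infinite_geodesic g" "g 0 = x" "g \<in> c"
    using \<alpha> by auto
  then show ?thesis
    using Geo_boundaryI[of c g] Inr z by auto
qed

lemma M_vertex:
  assumes "x \<in> V"
  shows "z \<in> M (Inl x) A \<longleftrightarrow> z \<in> delta_set \<and> (\<forall>g. Geo x z g \<longrightarrow> range g \<inter> (A - {x}) = {})"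
proof -
  have *: "Inl ` S \<inter> (Inl ` A - {Inl x}) = {} \<longleftrightarrow> S \<inter> (A - {x}) = {}" for S :: "'v set"
    by auto
  show ?thesis
    unfolding M_def mem_Collect_eq *
    using Geo_imp_geodesics[of x z] geodesics_imp_Geo[OF assms, of z] by metis
qed

lemma M_subset: "M x A \<subseteq> delta_set"
  by (auto simp: M_def)

lemma M_Un: "M x (A \<union> B) \<subseteq> M x A \<inter> M x B"
  unfolding M_def by blast

lemma M_D: "z \<in> M x A \<Longrightarrow> \<alpha> \<in> geodesics x z \<Longrightarrow> v \<in> vertices \<alpha> \<Longrightarrow> v \<in> A \<Longrightarrow> x = Inl v"
  unfolding M_def by blast

lemma shift_in_boundary:
  assumes c: "c \<in> boundary" "g \<in> c" and h: "infinite_geodesic h" "\<And>t. d (g t) (h t) \<le> C"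
  shows "h \<in> c"
  using boundary_mem_iff[OF c] h by blast

text \<open>A geodesic between \<open>c\<close> and \<open>z\<close> through \<open>a\<close>
  becomes a pair of one-sided sequences from \<open>a\<close>: the part of a ray before
  \<open>a\<close> is reversed, and a biinfinite geodesic is split at \<open>a\<close>.\<close>

lemma M_boundaryI:
  assumes c: "c \<in> boundary" and z: "z \<in> delta_set"
    and no: "\<And>a k1 k2. a \<in> A \<Longrightarrow> \<not> dbl a (Inr c) z k1 k2"
  shows "z \<in> M (Inr c) A"
proof -
  have "a \<notin> vertices \<alpha>" if \<alpha>: "\<alpha> \<in> geodesics (Inr c) z" and a: "a \<in> A" for \<alpha> a
  proof
    assume v: "a \<in> vertices \<alpha>"
    show False
    proof (cases z)
      case (Inl w)
      then obtain g where g: "\<alpha> = Infinite g" "infinite_geodesic g" "g 0 = w" "g \<in> c"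
        using \<alpha> by auto
      then have G: "Geo w (Inr c) g"
        using Geo_boundaryI[OF c] by auto
      obtain m where m: "a = g m" using v g by auto
      have "Geo a (Inr c) (\<lambda>i. g (m + i))"
        using Geo_tail[OF G, of m] m by simp
      moreover have T: "Geo a (Inl w) (\<lambda>i. g (min (m - i) m))"
        using Geo_rev[OF Geo_trunc[OF G, of m]] Geo_dist_source[OF G, of m] m by simp
      moreover have "d a w = m"
        using Geo_dist[OF G, of m 0] m g by simp
      then have "d (g (m + i)) (g (min (m - j) m)) = lev a (Inr c) i + lev a (Inl w) j" for i j
        using Geo_dist[OF G, of "m + i" "min (m - j) m"] by (simp split: if_splits)
      ultimately have "dbl a (Inr c) (Inl w) (\<lambda>i. g (m + i)) (\<lambda>i. g (min (m - i) m))"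
        unfolding dbl_def by blast
      then show False using no a Inl by blast
    next
      case (Inr c')
      then obtain b where b: "\<alpha> = Biinfinite b" "biinfinite_geodesic b"
          "(\<lambda>n. b (- int n)) \<in> c" "(\<lambda>n. b (int n)) \<in> c'"
        using \<alpha> by auto
      obtain m where m: "a = b m" using v b by auto
      have bd: "int (d (b i) (b j)) = \<bar>i - j\<bar>" "b i \<in> V" for i j
        using b by (auto simp: biinfinite_geodesic_def biinfinite_path_def)
      let ?k1 = "\<lambda>n. b (m - int n)" and ?k2 = "\<lambda>n. b (m + int n)"
      have "c' \<in> boundary" using z Inr by simp
      have "infinite_geodesic ?k1" "infinite_geodesic ?k2"
        unfolding infinite_geodesic_iff using bd by auto
      moreover have "d (b (- int t)) (?k1 t) \<le> nat \<bar>m\<bar>" "d (b (int t)) (?k2 t) \<le> nat \<bar>m\<bar>" for t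
        using bd(1)[of "- int t" "m - int t"] bd(1)[of "int t" "m + int t"] by auto
      ultimately have "?k1 \<in> c" "?k2 \<in> c'"
        using shift_in_boundary[OF c b(3), of ?k1] shift_in_boundary[OF \<open>c' \<in> boundary\<close> b(4), of ?k2]
        by blast+
      then have "Geo a (Inr c) ?k1" "Geo a (Inr c') ?k2"
        using Geo_boundaryI[OF c, of ?k1] Geo_boundaryI[OF \<open>c' \<in> boundary\<close>, of ?k2] m by auto
      moreover have "d (?k1 i) (?k2 j) = i + j" for i j
        using bd(1)[of "m - int i" "m + int j"] by linarith
      ultimately have "dbl a (Inr c) (Inr c') ?k1 ?k2"
        by (simp add: dbl_def)
      then show False using no a Inr by blast
    qed
  qed
  then show ?thesis
    unfolding M_def using z by auto
qed

lemma M_boundary_vertexD: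
  assumes z: "Inl w \<in> M (Inr c) A" and g: "Geo w (Inr c) g"
  shows "range g \<inter> A = {}"
proof -
  have "Infinite g \<in> geodesics (Inr c) (Inl w)"
    using Geo_boundaryD[OF g] by auto
  then show ?thesis
    using M_D[OF z] by fastforce
qed

text \<open>The halves are glued at \<open>a\<close>, one of them reversed; the additive distances
  in \<open>dbl\<close> make the result geodesic.\<close>

lemma M_boundary_boundaryD:
  assumes z: "Inr c' \<in> M (Inr c) A" and k: "dbl a (Inr c) (Inr c') k1 k2"
  shows "(range k1 \<union> range k2) \<inter> A = {}"
proof -
  let ?b = "\<lambda>i. if 0 \<le> i then k2 (nat i) else k1 (nat (- i))"
  have k1: "Geo a (Inr c) k1" and k2: "Geo a (Inr c') k2" and s: "\<And>i j. d (k1 i) (k2 j) = i + j"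
    using k by (auto simp: dbl_def)
  have "d (k2 j) (k1 i) = i + j" for i j
    using s dist_sym[OF Geo_V[OF k1] Geo_V[OF k2]] by metis
  then have dist: "int (d (?b i) (?b j)) = \<bar>i - j\<bar>" for i j
    using s[of "nat (- i)" "nat j"] Geo_dist[OF k1, of "nat (- i)" "nat (- j)"]
      Geo_dist[OF k2, of "nat i" "nat j"] by auto
  have V: "?b i \<in> V" for i
    using Geo_V[OF k1] Geo_V[OF k2] by simp
  have "{?b i, ?b (i + 1)} \<in> E" for i
  proof (rule dist_1_edge[OF V V])
    show "d (?b i) (?b (i + 1)) = 1" using dist[of i "i + 1"] by simp
  qed
  then have "biinfinite_geodesic ?b"
    unfolding biinfinite_geodesic_def biinfinite_path_def using dist image_subsetI[of UNIV ?b V, OF V] by blast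
  moreover have "(\<lambda>n. ?b (- int n)) = k1" "(\<lambda>n. ?b (int n)) = k2"
    using Geo_0[OF k1] Geo_0[OF k2] by (auto simp: fun_eq_iff)
  ultimately have "Biinfinite ?b \<in> geodesics (Inr c) (Inr c')"
    using Geo_boundaryD[OF k1] Geo_boundaryD[OF k2] by simp
  then have "range ?b \<inter> A = {}"
    using M_D[OF z, of "Biinfinite ?b"] by auto
  moreover have "k1 n \<in> range ?b" "k2 n \<in> range ?b" for n
    using fun_cong[OF \<open>(\<lambda>n. ?b (- int n)) = k1\<close>, of n] fun_cong[OF \<open>(\<lambda>n. ?b (int n)) = k2\<close>, of n]
      rangeI[of ?b "- int n"] rangeI[of ?b "int n"] by argo+
  ultimately show ?thesis by blast
qed

end

context fine_hyperbolic_graph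
begin

section \<open>Existence of rays and biinfinite geodesics, and neighbourhoods in terms of
  them\<close>

lemma finite_cvert: "e \<in> E \<Longrightarrow> finite (cvert n e)"
proof -
  assume "e \<in> E"
  moreover have "finite e'" if "e' \<in> E" for e'
    using edges[OF that] by auto
  ultimately show ?thesis
    unfolding cvert_def using finite_Circ[OF fine] Circ_subset_E by blast
qed

text \<open>A substitute for local finiteness. The geodesic \<open>q\<close> to \<open>g n1\<close>
  is a reference: from \<open>n1\<close> on, the geodesics from \<open>a\<close> to
  \<open>g n\<close> are \<delta>-close to it at time \<open>s + \<delta> + 1\<close>, the least one
  for which \<open>same_source_circuit\<close> reaches level \<open>s\<close>.\<close>

lemma initial_vertices_finite:
  assumes a: "a \<in> V" and g: "infinite_geodesic g"
  shows "\<exists>F n1. finite F \<and> (\<forall>n\<ge>n1. \<forall>p. Geo a (Inl (g n)) p \<longrightarrow> p s \<in> F)"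
proof -
  have V: "\<And>n. g n \<in> V" and gd: "\<And>m n. int (d (g m) (g n)) = \<bar>int m - int n\<bar>"
    using g by (auto simp: infinite_geodesic_iff)
  define r where "r = d a (g 0)"
  define t where "t = s + \<delta> + 1"
  define n1 where "n1 = t + r"
  have ge: "n \<le> d a (g n) + r" for n
    using dist_triangle[OF V a V, of 0 n] gd[of 0 n] dist_sym[OF a V] by (simp add: r_def)
  obtain q where q: "Geo a (Inl (g n1)) q"
    using ex_Geo_vertex a V by blast
  have "t \<le> d a (g n1)"
    using ge[of n1] by (simp add: n1_def)
  then have lt: "lev a (Inl (g n1)) t = t"
    by simp
  have eE: "{q s, q (Suc s)} \<in> E"
    using lev_eqI[OF lt, of "Suc s"] by (intro Geo_edge[OF q]) (simp add: t_def)
  have "p s \<in> cvert (2 * t + \<delta> + 1) {q s, q (Suc s)}" if n: "n \<ge> n1" and p: "Geo a (Inl (g n)) p" for n p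
  proof -
    have "2 * t + d (g n1) (g n) \<le> d a (g n1) + d a (g n)"
      using ge[of n] ge[of n1] gd[of n1 n] n by (simp add: n1_def)
    then have "d (q t) (p t) \<le> \<delta>"
      by (rule thin_Geo[OF q p])
    then have "{p s, p (Suc s)} \<in> Circ (2 * t + \<delta> + 1) {q s, q (Suc s)}"
      by (intro same_source_circuit[OF q p lt]) (simp_all add: t_def)
    then show ?thesis by (auto simp: cvert_def)
  qed
  then show ?thesis
    using finite_cvert[OF eE] by blast
qed

text \<open>Beyond time \<open>r\<close>, a geodesic from \<open>a\<close> to \<open>g n\<close> is
  \<delta>-close to the ray \<open>g\<close> by a slim triangle, at a parameter that differs by at
  most \<open>r + \<delta>\<close>. The limit therefore stays at bounded distance from
  \<open>g\<close> and lies in its class.\<close>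

lemma ray_limit:
  assumes c: "c \<in> boundary" "g \<in> c" and a: "a \<in> V"
    and lim: "\<And>s N. \<exists>n\<ge>N. \<exists>q. Geo a (Inl (g n)) q \<and> (\<forall>i\<le>s. q i = p i)"
  shows "Geo a (Inr c) p"
proof -
  have g: "infinite_geodesic g"
    using boundary_infinite_geodesic c by blast
  have V: "\<And>n. g n \<in> V" and gd: "\<And>m n. int (d (g m) (g n)) = \<bar>int m - int n\<bar>"
    using g by (auto simp: infinite_geodesic_iff)
  define r where "r = d a (g 0)"
  have ge: "n \<le> d a (g n) + r" for n
    using dist_triangle[OF V a V, of 0 n] gd[of 0 n] dist_sym[OF a V] by (simp add: r_def)
  have pV: "p i \<in> V" for i
    using lim[of 0 i] by (metis Geo_V order_refl)
  have p0: "p 0 = a"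
    using lim[of 0 0] Geo_0 by fastforce
  have pd: "int (d (p i) (p j)) = \<bar>int i - int j\<bar>" for i j
  proof -
    obtain n q where n: "n \<ge> i + j + r" and q: "Geo a (Inl (g n)) q" "\<forall>k\<le>i + j. q k = p k"
      using lim by blast
    have "i + j \<le> d a (g n)" using ge[of n] n by simp
    then show ?thesis
      using Geo_dist[OF q(1), of i j] q(2) by simp
  qed
  have G: "Geo (g 0) (Inr c) g"
    using Geo_boundaryI c by blast
  obtain f where f: "Geo a (Inl (g 0)) f"
    using ex_Geo_vertex a V by blast
  have "d (g t) (p t) \<le> 3 * r + 2 * \<delta>" for t
  proof (cases "t \<le> r")
    case True
    have "d (g t) (p t) \<le> d (g t) (g 0) + (d (g 0) a + d a (p t))"
      using dist_triangle[OF V V pV, of t t 0] dist_triangle[OF V a pV, of 0 t] by linarith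
    then show ?thesis
      using True gd[of t 0] pd[of 0 t] p0 dist_sym[OF V a, of 0] by (simp add: r_def)
  next
    case False
    obtain n q where n: "n \<ge> t" and q: "Geo a (Inl (g n)) q" "\<forall>k\<le>t. q k = p k"
      using lim by blast
    have "Geo (g 0) (Inl (g n)) (\<lambda>i. g (min i n))"
      using Geo_trunc[OF G, of n] by simp
    from slim_vertex[OF q(1) this f, of t] obtain t' where t': "d (p t) (g t') \<le> \<delta>"
      using False q(2) by (auto simp: r_def)
    have "d a (g t') \<le> r + t'" "t \<le> d a (g t') + \<delta>" "d a (g t') \<le> t + \<delta>"
      using dist_triangle[OF a V V, of t' 0] gd[of 0 t'] dist_triangle[OF a V pV, of t t']
        dist_triangle[OF a pV V, of t' t] pd[of 0 t] p0 t' dist_sym[OF pV V, of t t']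
      by (auto simp: r_def)
    then have "d (g t) (g t') \<le> r + \<delta>"
      using gd[of t t'] ge[of t'] by linarith
    then show ?thesis
      using dist_triangle[OF V V pV, of t t t'] t' dist_sym[OF pV V, of t t'] by linarith
  qed
  moreover have "infinite_geodesic p"
    unfolding infinite_geodesic_iff using pV pd by auto
  ultimately have "p \<in> c"
    using shift_in_boundary[OF c] by blast
  then show ?thesis
    using Geo_boundaryI[OF c(1)] p0 by blast
qed

lemma ex_Geo:
  assumes a: "a \<in> V" and z: "z \<in> delta_set"
  shows "\<exists>g. Geo a z g"
proof (cases z)
  case (Inl x)
  then show ?thesis using ex_Geo_vertex a z by simp
next
  case (Inr c)
  then obtain g where c: "c \<in> boundary" "g \<in> c"
    using z boundary_ex by auto
  then have g: "infinite_geodesic g"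
    using boundary_infinite_geodesic by blast
  then have "\<exists>h. Geo a (Inl (g n)) h" for n
    using ex_Geo_vertex[OF a] by (auto simp: infinite_geodesic_iff image_subset_iff)
  then obtain h where h: "\<And>n. Geo a (Inl (g n)) (h n)"
    by metis
  have "\<exists>F. finite F \<and> (\<exists>n1. \<forall>n\<ge>n1. h n s \<in> F)" for s
    using initial_vertices_finite[OF a g, of s] h by metis
  then obtain F where F: "\<And>s. finite (F s)" "\<And>s. \<exists>n1. \<forall>n\<ge>n1. h n s \<in> F s"
    by metis
  obtain p where "\<forall>s N. \<exists>n\<ge>N. \<forall>i\<le>s. h n i = p i"
    using koenig[of F h, OF F] by blast
  then have "Geo a (Inr c) p"
    using h by (intro ray_limit[OF c a]) blast
  then show ?thesis using Inr by blast
qed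

lemma boundary_diverge:
  assumes g: "Geo y (Inr c) g" and h: "Geo y (Inr c') h" and ne: "c \<noteq> c'"
  shows "\<exists>n. d (g n) (h n) > K"
proof (rule ccontr)
  assume "\<not> ?thesis"
  then have "\<forall>t. d (g t) (h t) \<le> K" by (simp add: not_less)
  then have "h \<in> c"
    using Geo_boundaryD[OF g] Geo_boundaryD[OF h] shift_in_boundary by blast
  then have "c \<inter> c' \<noteq> {}"
    using Geo_boundaryD[OF h] by blast
  then show False
    using ne Geo_boundaryD[OF g] Geo_boundaryD[OF h] quotient_disj[OF equiv_ray_equiv]
    unfolding boundary_def by blast
qed

text \<open>For large \<open>n\<close> a geodesic from \<open>h n\<close> to \<open>g n\<close> runs
  close to \<open>g\<close> past the point where the rays have diverged, hence through a fixed
  finite set. Infinitely many of these geodesics share a vertex \<open>a\<close>, and their halves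
  seen from \<open>a\<close> converge to rays.\<close>

lemma ex_dbl:
  assumes z: "Inr c \<in> delta_set" and w: "Inr c' \<in> delta_set" and ne: "c \<noteq> c'"
  shows "\<exists>a k1 k2. dbl a (Inr c) (Inr c') k1 k2"
proof -
  have c: "c \<in> boundary" "c' \<in> boundary" using z w by auto
  then obtain g where gc: "g \<in> c" using boundary_ex by blast
  define o' where "o' = g 0"
  have g: "Geo o' (Inr c) g"
    using Geo_boundaryI[OF c(1) gc] by (simp add: o'_def)
  then have oV: "o' \<in> V" by (rule Geo_source)
  then obtain h where h: "Geo o' (Inr c') h"
    using ex_Geo w by blast
  \<comment> \<open>By \<open>fellow_travel_below\<close> with \<open>K = \<delta>\<close>, a gap
    above \<open>5 * \<delta>\<close> at \<open>n0\<close> leaves a gap above \<delta> at all later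
    times.\<close>
  obtain n0 where n0: "d (g n0) (h n0) > 5 * \<delta>"
    using boundary_diverge[OF g h ne] by blast
  define s where "s = n0 + \<delta>"
  define b where "b = n0 + 2 * \<delta> + 1"
  define m where "m = (b - n0) + \<delta> + \<delta> + (4 * \<delta> + 1) + 1"
  let ?A = "cvert m {g s, g (Suc s)}"
  have eE: "{g s, g (Suc s)} \<in> E"
    by (rule Geo_edge[OF g]) simp
  have gap: "d (g t) (h t) > \<delta>" if "t \<ge> n0" for t
    using fellow_travel_below[OF g h, of t \<delta> n0] that n0 by linarith
  have hit: "\<exists>a\<in>?A. d (g n) a + d a (h n) = d (g n) (h n)" if n: "n \<ge> b" for n
  proof -
    have V: "g i \<in> V" "h i \<in> V" for i using Geo_V g h by auto
    obtain k where k: "Geo (h n) (Inl (g n)) k"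
      using ex_Geo_vertex V by blast
    have gn: "Geo o' (Inl (g n)) (\<lambda>i. g (min i n))" and hn: "Geo o' (Inl (h n)) (\<lambda>i. h (min i n))"
      using Geo_trunc[OF g, of n] Geo_trunc[OF h, of n] by auto
    have close: "\<exists>t'. d (g t) (k t') \<le> \<delta>" if "n0 \<le> t" "t \<le> n" for t
      using slim_vertex[OF gn k hn, of t] gap[OF that(1)] that(2) by auto
    obtain t1 t2 where t: "d (g n0) (k t1) \<le> \<delta>" "d (g b) (k t2) \<le> \<delta>"
      using close[of n0] close[of b] n by (auto simp: b_def)
    have "d (k t1) (k t2) \<le> d (k t1) (g n0) + (d (g n0) (g b) + d (g b) (k t2))"
      using dist_triangle[OF Geo_V[OF k] V(1) Geo_V[OF k], of t1 t2 n0]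
        dist_triangle[OF V(1) V(1) Geo_V[OF k], of n0 t2 b] by linarith
    then have "d (k t1) (k t2) \<le> 4 * \<delta> + 1"
      using t dist_sym[OF V(1) Geo_V[OF k], of n0 t1] Geo_dist_le[OF g, of n0 b] by (simp add: b_def)
    then have "walk (edges_of (range k)) (4 * \<delta> + 1) (k t1) (k t2)"
      by (rule walk_le[OF Geo_walk[OF k]])
    then have "\<exists>e'\<in>edges_of (range k). e' \<in> Circ m {g s, g (Suc s)} \<and> crosses e' {x. s < d o' x}"
      unfolding m_def using t Geo_V[OF k]
      by (intro quadrilateral_circuit[OF g _ _ _ _ edges_of_subset_E]) (auto simp: s_def b_def)
    then obtain e' where e': "e' \<in> edges_of (range k)" "e' \<in> Circ m {g s, g (Suc s)}" by blast
    then obtain a where a: "a \<in> e'" "a \<in> range k"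
      using edges[of e'] by (auto simp: edges_of_def)
    then have aA: "a \<in> ?A" using e' by (auto simp: cvert_def)
    obtain i where i: "a = k i" using a by blast
    have "d a (g n) = d (h n) (g n) - lev (h n) (Inl (g n)) i" "d (h n) a = lev (h n) (Inl (g n)) i"
      using Geo_dist[OF k, of i "d (h n) (g n)"] Geo_vertex_end[OF k order_refl] Geo_dist_source[OF k] i
      by auto
    moreover have "lev (h n) (Inl (g n)) i \<le> d (h n) (g n)" by simp
    ultimately have "d a (g n) + d (h n) a = d (h n) (g n)" by linarith
    moreover have "a \<in> V" using i Geo_V[OF k] by blast
    ultimately show ?thesis
      using aA dist_sym[of a "g n"] dist_sym[of "h n" a] dist_sym[of "h n" "g n"] V by auto
  qed
  have "\<exists>f. \<forall>n\<ge>b. f n \<in> ?A \<and> d (g n) (f n) + d (f n) (h n) = d (g n) (h n)"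
    using hit by metis
  then obtain f where f: "\<And>n. n \<ge> b \<Longrightarrow> f n \<in> ?A" "\<And>n. n \<ge> b \<Longrightarrow> d (g n) (f n) + d (f n) (h n) = d (g n) (h n)"
    by blast
  then have "finite (f ` {b..})"
    by (auto intro: finite_subset[OF _ finite_cvert[OF eE]])
  then obtain n1 where n1: "n1 \<in> {b..}" "infinite {n \<in> {b..}. f n = f n1}"
    using pigeonhole_infinite[of "{b..}" f] infinite_Ici by blast
  define I where "I = {n \<in> {b..}. f n = f n1}"
  define a where "a = f n1"
  have inf: "infinite I" using n1 by (simp add: I_def)
  have Ia: "d (g n) a + d a (h n) = d (g n) (h n)" if "n \<in> I" for n
    using f(2)[of n] that by (auto simp: I_def a_def)
  have aV: "a \<in> V"
    using f(1)[of n1] n1 cvert_subset_V by (auto simp: a_def)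
  define e where "e = enumerate I"
  have e: "e n \<in> I" "n \<le> e n" for n
    using enumerate_in_set[OF inf] le_enumerate[OF inf] by (auto simp: e_def)
  have "\<exists>p q. Geo a (Inl (g n)) p \<and> Geo a (Inl (h n)) q" for n
    using ex_Geo_vertex[OF aV] Geo_V g h by blast
  then obtain p q where p: "\<And>n. Geo a (Inl (g n)) (p n)" and q: "\<And>n. Geo a (Inl (h n)) (q n)"
    by metis
  \<comment> \<open>Pairs are used so that both halves are approximated along the same indices;
    otherwise their distances need not add up in the limit.\<close>
  define H where "H n s = (p (e n) s, q (e n) s)" for n s
  have gi: "infinite_geodesic g" "infinite_geodesic h"
    using Geo_boundaryD g h by blast+
  have "\<exists>F. finite F \<and> (\<exists>N. \<forall>n\<ge>N. H n s \<in> F)" for s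
  proof -
    obtain F1 N1 where F1: "finite F1" "\<And>n. n \<ge> N1 \<Longrightarrow> p n s \<in> F1"
      using initial_vertices_finite[OF aV gi(1), of s] p by metis
    obtain F2 N2 where F2: "finite F2" "\<And>n. n \<ge> N2 \<Longrightarrow> q n s \<in> F2"
      using initial_vertices_finite[OF aV gi(2), of s] q by metis
    have "\<forall>n\<ge>max N1 N2. H n s \<in> F1 \<times> F2"
      using F1(2) F2(2) e(2) unfolding H_def by (meson SigmaI le_trans max.boundedE)
    then show ?thesis using finite_cartesian_product[OF F1(1) F2(1)] by blast
  qed
  then obtain F where F: "\<And>s. finite (F s)" "\<And>s. \<exists>N. \<forall>n\<ge>N. H n s \<in> F s"
    by metis
  obtain P where P: "\<And>s N. \<exists>n\<ge>N. \<forall>i\<le>s. H n i = P i"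
    using koenig[of F H, OF F] by blast
  let ?k1 = "\<lambda>i. fst (P i)" and ?k2 = "\<lambda>i. snd (P i)"
  have "\<exists>n\<ge>N. \<exists>q. Geo a (Inl (g n)) q \<and> (\<forall>i\<le>s. q i = ?k1 i)" for s N
    using P[of N s] p e(2) unfolding H_def by (metis fst_conv le_trans)
  then have k1: "Geo a (Inr c) ?k1"
    by (rule ray_limit[OF c(1) gc aV])
  have "\<exists>n\<ge>N. \<exists>p. Geo a (Inl (h n)) p \<and> (\<forall>i\<le>s. p i = ?k2 i)" for s N
    using P[of N s] q e(2) unfolding H_def by (metis snd_conv le_trans)
  then have k2: "Geo a (Inr c') ?k2"
    using Geo_boundaryD[OF h] by (intro ray_limit[OF c(2) _ aV]) auto
  have "d (?k1 i) (?k2 j) = i + j" for i j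
  proof -
    obtain n where n: "n \<ge> i + j + d o' a" "\<forall>k\<le>i + j. H n k = P k"
      using P by blast
    have "dbl a (Inl (g (e n))) (Inl (h (e n))) (p (e n)) (q (e n))"
      by (rule dbl_vertices[OF p q Ia[OF e(1)]])
    moreover have "e n \<le> d o' a + d a (g (e n))" "e n \<le> d o' a + d a (h (e n))"
      using dist_triangle[OF oV aV Geo_V[OF g], of "e n"] dist_triangle[OF oV aV Geo_V[OF h], of "e n"]
        Geo_dist_source[OF g] Geo_dist_source[OF h] by simp_all
    then have "i \<le> d a (g (e n))" "j \<le> d a (h (e n))"
      using n(1) e(2)[of n] by linarith+
    moreover have "p (e n) i = ?k1 i" "q (e n) j = ?k2 j"
      using n(2) unfolding H_def by (metis fst_conv snd_conv le_add1 le_add2)+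
    ultimately show ?thesis unfolding dbl_def lev_simps by (metis min_absorb1)
  qed
  then show ?thesis
    using k1 k2 unfolding dbl_def by auto
qed

text \<open>Membership in \<open>M\<close> restricts all geodesics between \<open>c\<close> and
  \<open>z\<close>; this supplies one on which the restriction can be used.\<close>

lemma M_boundary_dbl:
  assumes c: "c \<in> boundary" and z: "z \<in> M (Inr c) A" "z \<noteq> Inr c"
  shows "\<exists>a k1 k2. dbl a (Inr c) z k1 k2 \<and> (range k1 \<union> range k2) \<inter> A = {}"
proof (cases z)
  case (Inl w)
  then have w: "w \<in> V" using z M_subset by fastforce
  then obtain k where k: "Geo w (Inr c) k"
    using ex_Geo c by fastforce
  have "dbl w (Inr c) (Inl w) k (\<lambda>_. w)"
    unfolding dbl_def using k Geo_const[OF w] Geo_dist_source[OF k] dist_sym[OF Geo_V[OF k] w] w by simp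
  moreover have "range k \<inter> A = {}"
    using M_boundary_vertexD[OF _ k] z Inl by blast
  moreover have "w \<in> range k" using Geo_0[OF k] by (metis rangeI)
  ultimately show ?thesis
    unfolding Inl by blast
next
  case (Inr c')
  then have "Inr c' \<in> delta_set" "c \<noteq> c'" using z M_subset by fastforce+
  then obtain a k1 k2 where "dbl a (Inr c) (Inr c') k1 k2"
    using ex_dbl[of c c'] c by auto
  then show ?thesis
    using M_boundary_boundaryD z Inr by blast
qed

text \<open>As \<open>n\<close> exceeds \<open>d y a\<close>, slim triangles bring both halves of a
  geodesic between \<open>c\<close> and \<open>w\<close> through \<open>a\<close> close to the
  \<open>K\<close>-close points \<open>g n\<close> and \<open>h n\<close>. Distances between the
  halves add up at \<open>a\<close>, so \<open>a\<close> itself is near \<open>g n\<close>, which is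
  too far from \<open>y\<close> for that.\<close>

lemma near_imp_M:
  assumes g: "Geo y (Inr c) g" and A: "finite A" "A \<subseteq> V"
  shows "\<exists>n. \<forall>w h. Geo y w h \<and> d (g n) (h n) \<le> K \<longrightarrow> w \<in> M (Inr c) A"
proof -
  define n where "n = (\<Sum>a\<in>A. d y a) + 6 * \<delta> + K + 1"
  have "w \<in> M (Inr c) A" if h: "Geo y w h" and K: "d (g n) (h n) \<le> K" for w h
  proof (rule M_boundaryI)
    show "c \<in> boundary" "w \<in> delta_set" using Geo_boundaryD[OF g] Geo_target[OF h] by auto
    fix a k1 k2 assume a: "a \<in> A"
    show "\<not> dbl a (Inr c) w k1 k2"
    proof
      assume k: "dbl a (Inr c) w k1 k2"
      then have k1: "Geo a (Inr c) k1" and k2: "Geo a w k2"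
        and s: "\<And>i j. d (k1 i) (k2 j) = i + lev a w j"
        by (auto simp: dbl_def)
      have n: "d y a + 6 * \<delta> + K < n"
        using member_le_sum[of a A "d y"] a A(1) by (simp add: n_def)
      have V: "y \<in> V" "a \<in> V" using Geo_source g k1 by blast+
      obtain f where f: "Geo y (Inl a) f" using ex_Geo_vertex V by blast
      obtain t1 where t1: "d (g n) (k1 t1) \<le> 2 * \<delta>"
        using slim[OF g k1 f, of n] n by auto
      obtain t2 where t2: "d (h n) (k2 t2) \<le> 2 * \<delta>"
        using slim[OF h k2 f, of n] n by auto
      note VV = Geo_V[OF g] Geo_V[OF h] Geo_V[OF k1] Geo_V[OF k2]
      have "d (k1 t1) (k2 t2) \<le> d (k1 t1) (g n) + (d (g n) (h n) + d (h n) (k2 t2))"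
        using dist_triangle[OF VV(3) VV(1) VV(4), of t1 t2 n] dist_triangle[OF VV(1) VV(2) VV(4), of n t2 n]
        by linarith
      then have "t1 \<le> 4 * \<delta> + K"
        using s[of t1 t2] t1 t2 K dist_sym[OF VV(1) VV(3), of n t1] by linarith
      moreover have "n \<le> d y a + (t1 + 2 * \<delta>)"
        using dist_triangle[OF V(1) V(2) VV(1), of n] dist_triangle[OF V(2) VV(3) VV(1), of n t1] t1
          dist_sym[OF VV(1) VV(3), of n t1] Geo_dist_source[OF g, of n] Geo_dist_source[OF k1, of t1]
        by simp
      ultimately show False using n by linarith
    qed
  qed
  then show ?thesis by blast
qed

text \<open>With a gap above \<open>13 * \<delta>\<close>, which is
  \<open>\<delta> + 4 * (3 * \<delta>)\<close>, at time \<open>n\<close>, the gap exceeds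
  \<open>3 * \<delta>\<close> at all later times. Then \<open>g\<close> beyond \<open>n\<close> runs
  along every geodesic between \<open>c\<close> and \<open>w\<close>, which must share a short
  circuit with a fixed edge of \<open>g\<close>.\<close>

lemma M_imp_near:
  assumes g: "Geo y (Inr c) g"
  shows "\<exists>A. finite A \<and> A \<subseteq> V \<and> (\<forall>w\<in>M (Inr c) A. \<forall>h. Geo y w h \<longrightarrow> d (g n) (h n) \<le> 13 * \<delta>)"
proof -
  \<comment> \<open>Connectors have length \<open>3 * \<delta>\<close>: \<delta> from
    \<open>g\<close> to the side \<open>f\<close> and \<open>2 * \<delta>\<close> on to the second
    half. The arc between their feet is at most
    \<open>3 * \<delta> + (6 * \<delta> + 1) + 3 * \<delta>\<close>.\<close>
  define s where "s = n + 3 * \<delta>"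
  define b where "b = n + 6 * \<delta> + 1"
  define m where "m = (b - n) + 3 * \<delta> + 3 * \<delta> + (12 * \<delta> + 1) + 1"
  let ?A = "cvert m {g s, g (Suc s)}"
  have eE: "{g s, g (Suc s)} \<in> E"
    by (rule Geo_edge[OF g]) simp
  have "d (g n) (h n) \<le> 13 * \<delta>" if w: "w \<in> M (Inr c) ?A" and h: "Geo y w h" for w h
  proof (rule ccontr)
    assume far: "\<not> d (g n) (h n) \<le> 13 * \<delta>"
    have "w \<noteq> Inr c"
      using bigon_synchronous[OF g, of h n] h far by auto
    then obtain a k1 k2 where k: "dbl a (Inr c) w k1 k2" and av: "(range k1 \<union> range k2) \<inter> ?A = {}"
      using M_boundary_dbl[OF _ w] Geo_boundaryD[OF g] by blast
    have k1: "Geo a (Inr c) k1" and k2: "Geo a w k2" using k by (auto simp: dbl_def)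
    have V: "y \<in> V" "a \<in> V" using Geo_source g k1 by blast+
    obtain f where f: "Geo y (Inl a) f" using ex_Geo_vertex V by blast
    note VV = Geo_V[OF g] Geo_V[OF h] Geo_V[OF k1] Geo_V[OF k2] Geo_V[OF f]
    let ?Z = "range k1 \<union> range k2"
    have close: "\<exists>x\<in>?Z. d (g t) x \<le> 3 * \<delta>" if t: "t \<ge> n" for t
    proof -
      have gap: "\<not> d (g t) (h t) \<le> 3 * \<delta>"
        using fellow_travel_below[OF g h _ t, of "3 * \<delta>"] far by auto
      from slim[OF g k1 f, of t] show ?thesis
      proof
        assume "\<exists>t'. d (g t) (k1 t') \<le> 2 * \<delta>"
        then obtain t' where "d (g t) (k1 t') \<le> 2 * \<delta>" by blast
        then have "d (g t) (k1 t') \<le> 3 * \<delta>" by simp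
        then show ?thesis by blast
      next
        assume gf: "t \<le> d y a \<and> d (g t) (f t) \<le> \<delta>"
        from slim'[OF h k2 f, of t] show ?thesis
        proof
          assume "d (f t) (h t) \<le> \<delta>"
          then show ?thesis
            using gf gap dist_triangle[OF VV(1) VV(5) VV(2), of t t t] by linarith
        next
          assume "\<exists>t'. d (f t) (k2 t') \<le> 2 * \<delta>"
          then obtain t' where "d (f t) (k2 t') \<le> 2 * \<delta>" by blast
          then have "d (g t) (k2 t') \<le> 3 * \<delta>"
            using gf dist_triangle[OF VV(1) VV(5) VV(4), of t t' t] by linarith
          then show ?thesis by blast
        qed
      qed
    qed
    obtain x1 x2 where x: "x1 \<in> ?Z" "d (g n) x1 \<le> 3 * \<delta>" "x2 \<in> ?Z" "d (g b) x2 \<le> 3 * \<delta>"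
      using close[of n] close[of b] by (auto simp: b_def)
    have xV: "x1 \<in> V" "x2 \<in> V" using x VV by auto
    have "d x1 x2 \<le> d x1 (g n) + (d (g n) (g b) + d (g b) x2)"
      using dist_triangle[OF xV(1) VV(1) xV(2), of n] dist_triangle[OF VV(1) VV(1) xV(2), of n b]
      by linarith
    then have "d x1 x2 \<le> 12 * \<delta> + 1"
      using x dist_sym[OF VV(1) xV(1), of n] Geo_dist_le[OF g, of n b] by (simp add: b_def)
    then have "walk (edges_of ?Z) (12 * \<delta> + 1) x1 x2"
      by (rule walk_le[OF dbl_walk[OF k x(1,3)]])
    then have "\<exists>e'\<in>edges_of ?Z. e' \<in> Circ m {g s, g (Suc s)} \<and> crosses e' {x. s < d y x}"
      unfolding m_def using x xV
      by (intro quadrilateral_circuit[OF g _ _ _ _ edges_of_subset_E]) (auto simp: s_def b_def)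
    then obtain e' where e': "e' \<in> edges_of ?Z" "e' \<in> Circ m {g s, g (Suc s)}" by blast
    then obtain v where "v \<in> e'" using edges[of e'] by (auto simp: edges_of_def)
    then have "v \<in> ?Z \<inter> ?A" using e' by (auto simp: edges_of_def cvert_def)
    then show False using av by blast
  qed
  then show ?thesis
    by (intro exI[of _ ?A] conjI finite_cvert[OF eE] cvert_subset_V) blast
qed

text \<open>If a geodesic from \<open>y\<close> to \<open>x\<close> misses \<open>w\<close>, then the last edge of a geodesic from \<open>y\<close> to \<open>w\<close> and the
  first edge of a geodesic from \<open>w\<close> to \<open>x\<close> lie on a common short circuit.\<close>

lemma gate:
  assumes V: "y \<in> V" "w \<in> V"
  shows "\<exists>B. finite B \<and> B \<subseteq> V \<and> (\<forall>x\<in>M (Inl w) B. \<forall>h. Geo y x h \<longrightarrow> w \<in> range h)"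
proof (cases "y = w")
  case True
  then show ?thesis using Geo_0 by (metis empty_subsetI finite.emptyI rangeI)
next
  case False
  obtain \<beta> where \<beta>: "Geo w (Inl y) \<beta>" using ex_Geo_vertex V by blast
  define r where "r = d w y"
  have r0: "r > 0" using False dist_eq_0[OF V(2,1)] by (simp add: r_def)
  then have lr: "lev w (Inl y) 1 = 1" by (simp add: r_def)
  have eE: "{w, \<beta> 1} \<in> E"
    using Geo_edge[OF \<beta>, of 0] lr Geo_0[OF \<beta>] by simp
  define t where "t = r + 2 * \<delta> + 1"
  define m where "m = r + (r + t + 2 * \<delta>) + 2 * \<delta> + t + 1"
  let ?B = "cvert m {w, \<beta> 1}"
  have "w \<in> range h" if x: "x \<in> M (Inl w) ?B" and h: "Geo y x h" for x h
  proof (rule ccontr)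
    assume wh: "w \<notin> range h"
    have "x \<in> delta_set" using x M_subset by blast
    then obtain k where k: "Geo w x k" using ex_Geo V by blast
    obtain f where f: "Geo w (Inl y) f" using ex_Geo_vertex V by blast
    let ?N = "{e \<in> E. w \<notin> e}"
    have eh: "edges_of (range h) \<subseteq> ?N" using wh by (auto simp: edges_of_def)
    obtain t' where t': "d (k t) (h t') \<le> 2 * \<delta>"
      using slim[OF k h f, of t] by (auto simp: t_def r_def)
    note VV = Geo_V[OF k] Geo_V[OF h]
    have "walk ?N (r - 1) (\<beta> 1) (\<beta> r)"
    proof (rule walk_segment)
      fix i assume i: "1 \<le> i" "i < r"
      then have "w \<noteq> \<beta> i" "w \<noteq> \<beta> (Suc i)"
        using Geo_dist_source[OF \<beta>, of i] Geo_dist_source[OF \<beta>, of "Suc i"] V by (auto simp: r_def)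
      moreover have "{\<beta> i, \<beta> (Suc i)} \<in> E"
        using i by (intro Geo_edge[OF \<beta>]) (simp add: r_def)
      ultimately show "\<beta> i = \<beta> (Suc i) \<or> {\<beta> i, \<beta> (Suc i)} \<in> ?N" by auto
    qed (use r0 in simp)
    moreover have "\<beta> r = y" using Geo_vertex_end[OF \<beta>] by (simp add: r_def)
    ultimately have w1: "walk ?N (r - 1) (\<beta> 1) y" by simp
    have "\<exists>t''. walk ?N (d y (h t'') + 2 * \<delta>) y (k t) \<and> d (k t) (h t'') \<le> 2 * \<delta>"
    proof (cases "lev w x t = t")
      case True
      have "walk {e \<in> E. \<not> crosses e (- {w})} (2 * \<delta>) (k t) (h t')"
      proof (rule walk_not_crossing[OF VV t'])
        have "p \<noteq> w" if "d (k t) p \<le> 2 * \<delta>" "p \<in> V" for p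
          using that Geo_dist_source[OF k, of t] True dist_sym[OF V(2) VV(1), of t] by (auto simp: t_def)
        then show "(\<forall>p\<in>V. d (k t) p \<le> 2 * \<delta> \<longrightarrow> p \<in> - {w}) \<or> (\<forall>p\<in>V. d (k t) p \<le> 2 * \<delta> \<longrightarrow> p \<notin> - {w})"
          by blast
      qed
      then have "walk ?N (2 * \<delta>) (k t) (h t')"
      proof (rule walk_mono, intro subsetI)
        fix e assume e: "e \<in> {e \<in> E. \<not> crosses e (- {w})}"
        then obtain x y where "e = {x, y}" "x \<noteq> y" using edges by blast
        then show "e \<in> ?N" using e by (auto simp: crosses_def)
      qed
      moreover have "walk ?N (d y (h t')) y (h t')"
        using walk_mono[OF Geo_walk[OF h, of 0 t'] eh] Geo_0[OF h] by simp
      ultimately have "walk ?N (d y (h t') + 2 * \<delta>) y (k t)"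
        by (intro walk_trans) (auto intro: walk_sym)
      then show ?thesis
        using t' by blast
    next
      case False
      then obtain v where v: "x = Inl v" "d w v < t"
        by (cases x) auto
      then have "k t = v" "h (d y v) = v" "v \<in> V"
        using Geo_vertex_end k h Geo_target[OF k] by auto
      moreover have "walk ?N (d y (h (d y v))) y (h (d y v))"
        using walk_mono[OF Geo_walk[OF h, of 0 "d y v"] eh] Geo_0[OF h] by simp
      ultimately show ?thesis
        using walk_le[of ?N "d y v" y v "d y v + 2 * \<delta>"] by (intro exI[of _ "d y v"]) auto
    qed
    then obtain t'' where t'': "walk ?N (d y (h t'') + 2 * \<delta>) y (k t)" "d (k t) (h t'') \<le> 2 * \<delta>" by blast
    have "d y (h t'') \<le> r + t + 2 * \<delta>"
      using dist_triangle[OF V(1,2) VV(2), of t''] dist_triangle[OF V(2) VV(1) VV(2), of t'' t] t''(2)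
        dist_sym[OF V] Geo_dist_le[OF k, of 0 t] Geo_0[OF k] by (simp add: r_def)
    then have "walk ?N (r - 1 + (r + t + 2 * \<delta> + 2 * \<delta>)) (\<beta> 1) (k t)"
      using w1 by (intro walk_trans[OF w1] walk_le[OF t''(1)]) simp
    moreover have "walk (edges_of (range k)) (d (k 0) (k t)) (k t) (k 0)"
      by (rule walk_sym[OF Geo_walk[OF k]])
    then have "walk (edges_of (range k)) t (k t) (k 0)"
      by (rule walk_le) (use Geo_dist_le[OF k, of 0 t] in simp)
    then have "walk (edges_of (range k)) t (k t) w"
      using Geo_0[OF k] by simp
    ultimately have "\<exists>e'\<in>edges_of (range k). e' \<in> Circ (r - 1 + (r + t + 2 * \<delta> + 2 * \<delta>) + t + 1) {w, \<beta> 1} \<and> w \<in> e'"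
      using edges_of_subset_E by (intro vertex_circuit[OF eE])
    moreover have "r - 1 + (r + t + 2 * \<delta> + 2 * \<delta>) + t + 1 \<le> m"
      by (simp add: m_def)
    ultimately obtain e' where e': "e' \<in> edges_of (range k)" "e' \<in> Circ m {w, \<beta> 1}"
      using Circ_mono by blast
    \<comment> \<open>The other end of an edge of \<open>k\<close> at \<open>w\<close> is a vertex
      of \<open>?B\<close> on a geodesic from \<open>w\<close> to \<open>x\<close>, which
      \<open>M (Inl w) ?B\<close> excludes.\<close>
    then obtain v where "v \<in> e'" "v \<noteq> w"
      using edges[of e'] by (auto simp: edges_of_def)
    then have "v \<in> range k \<inter> (?B - {w})"
      using e' by (auto simp: edges_of_def cvert_def)
    then show False
      using x k M_vertex[OF V(2)] by blast
  qed
  then show ?thesis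
    by (intro exI[of _ ?B] conjI finite_cvert[OF eE] cvert_subset_V) blast
qed

end

section \<open>Topology of the compactification\<close>

context connected_graph
begin

text \<open>The shadow of \<open>b\<close> under light from \<open>y\<close>. Basic neighbourhoods
  of a vertex are complements of finite unions of shadows, so the topology at vertices reduces to
  the closedness of shadows.\<close>

definition shadow :: "'v \<Rightarrow> 'v \<Rightarrow> ('v + (nat \<Rightarrow> 'v) set) set" where
  "shadow y b = {z. \<exists>g. Geo y z g \<and> b \<in> range g}"

lemma shadow_subset: "shadow y b \<subseteq> delta_set"
  using Geo_target by (fastforce simp: shadow_def)

lemma shadow_iff: "z \<in> shadow y b \<longleftrightarrow> (\<exists>g. Geo y z g \<and> g (d y b) = b \<and> lev y z (d y b) = d y b)"
proof
  assume "z \<in> shadow y b"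
  then obtain g where "Geo y z g" "b \<in> range g" unfolding shadow_def by blast
  then show "\<exists>g. Geo y z g \<and> g (d y b) = b \<and> lev y z (d y b) = d y b" using Geo_split by blast
next
  assume "\<exists>g. Geo y z g \<and> g (d y b) = b \<and> lev y z (d y b) = d y b"
  then obtain g where "Geo y z g" "g (d y b) = b" by blast
  then show "z \<in> shadow y b" unfolding shadow_def using rangeI[of g "d y b"] by auto
qed

lemma M_vertex_eq:
  assumes "x \<in> V" shows "M (Inl x) A = delta_set - (\<Union>a\<in>A - {x}. shadow x a)"
proof (rule Set.set_eqI)
  fix z show "z \<in> M (Inl x) A \<longleftrightarrow> z \<in> delta_set - (\<Union>a\<in>A - {x}. shadow x a)"
    unfolding M_vertex[OF assms] shadow_def by blast
qed

end

context fine_hyperbolic_graph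
begin

lemma shadow_self: "z \<in> delta_set \<Longrightarrow> y \<in> V \<Longrightarrow> z \<in> shadow y y"
  using ex_Geo[of y z] Geo_0 unfolding shadow_def by (metis (mono_tags, lifting) mem_Collect_eq rangeI)

text \<open>Near a vertex \<open>v\<close>, \<open>gate\<close> forces geodesics from
  \<open>y\<close> through \<open>v\<close>. Near a boundary point, geodesics through
  \<open>b\<close> have finitely many possible vertices at each position, and a limit ray still
  passes through \<open>b\<close>.\<close>

lemma closedin_shadow:
  assumes V: "y \<in> V" "b \<in> V"
  shows "closedin delta_topology (shadow y b)"
proof -
  have "\<exists>A. finite A \<and> A \<subseteq> V \<and> M w A \<subseteq> delta_set - shadow y b" if w: "w \<in> delta_set - shadow y b" for w
  proof (cases w)
    case (Inl v)
    then have vV: "v \<in> V" using w by simp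
    obtain B where B: "finite B" "B \<subseteq> V" "\<And>x h. x \<in> M (Inl v) B \<Longrightarrow> Geo y x h \<Longrightarrow> v \<in> range h"
      using gate[OF V(1) vV] by blast
    have "x \<notin> shadow y b" if x: "x \<in> M (Inl v) (insert b B)" for x
    proof
      assume "x \<in> shadow y b"
      then obtain h where h: "Geo y x h" "b \<in> range h" by (auto simp: shadow_def)
      have "v \<in> range h"
        using B(3)[OF _ h(1)] x M_Un[of "Inl v" "{b}" B] by auto
      note hv = Geo_split[OF h(1) this] and hb = Geo_split[OF h]
      show False
      \<comment> \<open>If \<open>b\<close> comes before \<open>v\<close> on \<open>h\<close>,
        truncation at \<open>v\<close> puts \<open>v\<close> itself into the shadow; if it comes
        after, the tail from \<open>v\<close> meets \<open>b\<close>, against the choice of the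
        neighbourhood.\<close>
      proof (cases "d y b \<le> d y v")
        case True
        have "Geo y (Inl (h (d y v))) (\<lambda>i. h (min i (d y v)))"
          by (rule Geo_trunc[OF h(1) hv(2)])
        moreover have "h (min (d y b) (d y v)) = b" using True hb by simp
        ultimately have "Inl v \<in> shadow y b"
          unfolding shadow_def using hv(1) by (metis (mono_tags, lifting) mem_Collect_eq rangeI)
        then show False using w Inl by simp
      next
        case False
        have tl: "Geo v x (\<lambda>i. h (d y v + i))"
          using Geo_tail[OF h(1) hv(2)] hv(1) by simp
        have "h (d y v + (d y b - d y v)) = b" using False hb by simp
        then have "b \<in> range (\<lambda>i. h (d y v + i))" by (metis rangeI)
        moreover have "b \<noteq> v" using False by auto
        ultimately have "range (\<lambda>i. h (d y v + i)) \<inter> (insert b B - {v}) \<noteq> {}" by blast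
        moreover have "range (\<lambda>i. h (d y v + i)) \<inter> (insert b B - {v}) = {}"
          using x tl unfolding M_vertex[OF vV] by (metis (no_types))
        ultimately show False by contradiction
      qed
    qed
    then have "M w (insert b B) \<subseteq> delta_set - shadow y b"
      using M_subset Inl by blast
    then show ?thesis using B V by (intro exI[of _ "insert b B"]) simp
  next
    case (Inr c)
    then obtain g where g: "Geo y (Inr c) g" using ex_Geo V(1) w by fastforce
    show ?thesis
    proof (rule ccontr)
      assume no: "\<not> ?thesis"
      define K where "K = \<delta> + 4 * (13 * \<delta>)"
      have "\<exists>h x. Geo y x h \<and> h (d y b) = b \<and> d (g n) (h n) \<le> 13 * \<delta>" for n
      proof -
        obtain A where A: "finite A" "A \<subseteq> V"
            "\<And>w h. w \<in> M (Inr c) A \<Longrightarrow> Geo y w h \<Longrightarrow> d (g n) (h n) \<le> 13 * \<delta>"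
          using M_imp_near[OF g, of n] by blast
        then have "\<not> M (Inr c) A \<subseteq> delta_set - shadow y b"
          using no Inr by metis
        then obtain x where "x \<in> M (Inr c) A" "x \<in> shadow y b"
          using M_subset[of "Inr c" A] by blast
        then show ?thesis using A(3) unfolding shadow_iff by blast
      qed
      then obtain h x where h: "\<And>n. Geo y (x n) (h n)" "\<And>n. h n (d y b) = b"
          "\<And>n. d (g n) (h n n) \<le> 13 * \<delta>"
        by metis
      have near: "d (g t) (h n t) \<le> K" if "t \<le> n" for t n
        unfolding K_def by (rule fellow_travel_below[OF g h(1) h(3) that])
      define t where "t s = s + K + 1" for s
      have edge: "{h n s, h n (Suc s)} \<in> Circ (2 * t s + K + 1) {g s, g (Suc s)}"
        "lev y (x n) (Suc s) = Suc s" if "t s \<le> n" for n s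
        using same_source_circuit[OF g h(1) _ near[OF that], of s] by (simp_all add: t_def)
      have "h n s \<in> cvert (2 * t s + K + 1) {g s, g (Suc s)}" if "t s \<le> n" for n s
        using edge[OF that] by (auto simp: cvert_def)
      moreover have "finite (cvert (2 * t s + K + 1) {g s, g (Suc s)})" for s
        by (rule finite_cvert[OF Geo_edge[OF g]]) simp
      ultimately obtain p where p: "\<And>s N. \<exists>n\<ge>N. \<forall>i\<le>s. h n i = p i"
        using koenig[of "\<lambda>s. cvert (2 * t s + K + 1) {g s, g (Suc s)}" h] by blast
      have pV: "p i \<in> V" for i
        using p[of 0 i] Geo_V[OF h(1)] by (metis order_refl)
      have "int (d (p i) (p j)) = \<bar>int i - int j\<bar>" for i j
      proof -
        obtain n where n: "n \<ge> t (i + j)" "\<forall>k\<le>i + j. h n k = p k" using p by blast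
        have "lev y (x n) i = i" "lev y (x n) j = j"
          using lev_eqI[OF edge(2)[OF n(1)]] by auto
        then show ?thesis using Geo_dist[OF h(1), of n i j] n(2) by simp
      qed
      then have "infinite_geodesic p"
        unfolding infinite_geodesic_iff using pV by auto
      moreover have "d (g s) (p s) \<le> K" for s
        using p[of s s] near by (metis order_refl)
      ultimately have "p \<in> c"
        using shift_in_boundary Geo_boundaryD[OF g] by blast
      moreover have "p 0 = y" using p[of 0 0] Geo_0[OF h(1)] by (metis order_refl)
      ultimately have "Geo y (Inr c) p"
        using Geo_boundaryI Geo_boundaryD[OF g] by blast
      moreover have "p (d y b) = b" using p[of 0 "d y b"] h(2) by (metis order_refl)
      ultimately have "Inr c \<in> shadow y b"
        unfolding shadow_def by (metis (mono_tags, lifting) mem_Collect_eq rangeI)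
      then show False using w Inr by simp
    qed
  qed
  then show ?thesis
    unfolding closedin_def openin_delta_topology using shadow_subset by auto
qed

lemma openin_M_vertex:
  assumes x: "x \<in> V" and A: "finite A" "A \<subseteq> V"
  shows "openin delta_topology (M (Inl x) A)"
proof -
  have "closedin delta_topology (\<Union>a\<in>A - {x}. shadow x a)"
    using A closedin_shadow[OF x] by (intro closedin_Union) auto
  then show ?thesis
    unfolding M_vertex_eq[OF x] by (simp add: closedin_def)
qed

lemma ray_in_M:
  assumes g: "Geo y (Inr c) g" and A: "finite A" "A \<subseteq> V"
  shows "Inr c \<in> M (Inr c) A"
proof -
  obtain n where "\<forall>w h. Geo y w h \<and> d (g n) (h n) \<le> 0 \<longrightarrow> w \<in> M (Inr c) A"
    using near_imp_M[OF g A] by blast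
  moreover have "d (g n) (g n) \<le> 0" using Geo_V[OF g] by simp
  ultimately show ?thesis using g by blast
qed

text \<open>Fellow-travelling with \<open>g\<close> at time \<open>n\<close> is stable:
  \<open>13 * \<delta>\<close> for points near \<open>c\<close> and another
  \<open>13 * \<delta>\<close> for points near such a point add up to \<open>26 * \<delta>\<close>,
  the tolerance for which \<open>n\<close> was chosen.\<close>

lemma M_boundary_neighbourhood:
  assumes z: "Inr c \<in> delta_set" and A: "finite A" "A \<subseteq> V" and y: "y \<in> V"
  shows "\<exists>B. finite B \<and> B \<subseteq> V \<and>
    (\<forall>w\<in>M (Inr c) B. \<exists>C. finite C \<and> C \<subseteq> V \<and> M w C \<subseteq> M (Inr c) A)"
proof -
  obtain g where g: "Geo y (Inr c) g" using ex_Geo y z by blast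
  obtain n where n: "\<And>w h. Geo y w h \<Longrightarrow> d (g n) (h n) \<le> 26 * \<delta> \<Longrightarrow> w \<in> M (Inr c) A"
    using near_imp_M[OF g A, of "26 * \<delta>"] by blast
  obtain B where B: "finite B" "B \<subseteq> V" "\<And>w h. w \<in> M (Inr c) B \<Longrightarrow> Geo y w h \<Longrightarrow> d (g n) (h n) \<le> 13 * \<delta>"
    using M_imp_near[OF g, of n] by blast
  have "\<exists>C. finite C \<and> C \<subseteq> V \<and> M w C \<subseteq> M (Inr c) A" if w: "w \<in> M (Inr c) B" for w
  proof -
    have wd: "w \<in> delta_set" using w M_subset by blast
    then obtain h where h: "Geo y w h" using ex_Geo y by blast
    have gh: "d (g n) (h n) \<le> 13 * \<delta>" using B(3)[OF w h] .
    have "\<exists>C. finite C \<and> C \<subseteq> V \<and> (\<forall>x\<in>M w C. \<forall>k. Geo y x k \<longrightarrow> d (h n) (k n) \<le> 13 * \<delta>)"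
    proof (cases w)
      case (Inr c')
      then show ?thesis using M_imp_near[of y c' h n] h by simp
    next
      case (Inl v)
      then have vV: "v \<in> V" using wd by simp
      obtain C where C: "finite C" "C \<subseteq> V" "\<And>x k. x \<in> M (Inl v) C \<Longrightarrow> Geo y x k \<Longrightarrow> v \<in> range k"
        using gate[OF y vV] by blast
      have "d (h n) (k n) \<le> 13 * \<delta>" if "x \<in> M (Inl v) C" and k: "Geo y x k" for x k
      proof -
        have kv: "k (d y v) = v" "lev y x (d y v) = d y v"
          using Geo_split[OF k C(3)[OF that]] by auto
        have h': "Geo y (Inl v) h" using h Inl by simp
        show ?thesis
        \<comment> \<open>Both geodesics pass through \<open>v\<close>. Up to \<open>v\<close> they
          form a bigon; beyond it \<open>h\<close> rests at \<open>v\<close>, which is at most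
          \<open>13 * \<delta>\<close> short of level \<open>n\<close> because \<open>h n\<close> is
          close to \<open>g n\<close>.\<close>
        proof (cases "n \<le> d y v")
          case True
          have "Geo y (Inl v) (\<lambda>i. k (min i (d y v)))"
            using Geo_trunc[OF k kv(2)] kv(1) by simp
          then have "d (h n) (k (min n (d y v))) \<le> 4 * \<delta>"
            by (rule bigon_synchronous[OF h'])
          then show ?thesis using True by simp
        next
          case False
          then have "h n = v" using Geo_vertex_end[OF h'] by simp
          have "n \<le> d y v + d (h n) (g n)"
            using dist_triangle[OF y vV Geo_V[OF g], of n] Geo_dist_source[OF g, of n] \<open>h n = v\<close> by simp
          then have "n - d y v \<le> 13 * \<delta>"
            using gh dist_sym[OF Geo_V[OF g] Geo_V[OF h], of n n] by linarith
          moreover have "d (k (d y v)) (k n) \<le> n - d y v"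
            using False by (intro Geo_dist_le[OF k]) simp
          ultimately show ?thesis using kv(1) \<open>h n = v\<close> by simp
        qed
      qed
      then show ?thesis using C(1,2) Inl by blast
    qed
    then obtain C where C: "finite C" "C \<subseteq> V"
        "\<And>x k. x \<in> M w C \<Longrightarrow> Geo y x k \<Longrightarrow> d (h n) (k n) \<le> 13 * \<delta>"
      by blast
    have "x \<in> M (Inr c) A" if x: "x \<in> M w C" for x
    proof -
      have "x \<in> delta_set" using x M_subset by blast
      then obtain k where k: "Geo y x k" using ex_Geo y by blast
      have "d (g n) (k n) \<le> 26 * \<delta>"
        using dist_triangle[OF Geo_V[OF g] Geo_V[OF h] Geo_V[OF k], of n n n] gh C(3)[OF x k] by linarith
      then show ?thesis by (rule n[OF k])
    qed
    then show ?thesis using C(1,2) by blast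
  qed
  then show ?thesis using B(1,2) by blast
qed

lemma M_interior:
  assumes w: "w \<in> delta_set" and A: "finite A" "A \<subseteq> V"
  shows "\<exists>B. finite B \<and> B \<subseteq> V \<and> (\<forall>w'\<in>M w B. \<exists>C. finite C \<and> C \<subseteq> V \<and> M w' C \<subseteq> M w A)"
proof (cases w)
  case (Inl x)
  then have "openin delta_topology (M w A)" using openin_M_vertex A w by simp
  then have "\<forall>w'\<in>M w A. \<exists>C. finite C \<and> C \<subseteq> V \<and> M w' C \<subseteq> M w A"
    by (simp add: openin_delta_topology)
  then show ?thesis using A by blast
next
  case (Inr c)
  then obtain g where "g \<in> c" "c \<in> boundary" using w boundary_ex by auto
  then have "g 0 \<in> V" using boundary_infinite_geodesic unfolding infinite_geodesic_iff by blast
  then show ?thesis using M_boundary_neighbourhood[of c A "g 0"] w A Inr by simp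
qed

lemma mem_M_self:
  assumes w: "w \<in> delta_set" and A: "finite A" "A \<subseteq> V"
  shows "w \<in> M w A"
proof (cases w)
  case (Inl x)
  then have x: "x \<in> V" using w by simp
  have "range g \<inter> (A - {x}) = {}" if "Geo x (Inl x) g" for g
    using Geo_vertex_end[OF that] x by auto
  then show ?thesis using M_vertex[OF x] x Inl by simp
next
  case (Inr c)
  then obtain g where "g \<in> c" "c \<in> boundary" using w boundary_ex by auto
  then show ?thesis using ray_in_M[OF Geo_boundaryI A] Inr by blast
qed

text \<open>The set \<open>U\<close> is the interior of \<open>M z A\<close>: the points that have
  \<open>M z A\<close> as a neighbourhood. \<open>M_interior\<close> is the axiom of neighbourhood
  systems that makes it open.\<close>

lemma open_in_M:
  assumes z: "z \<in> delta_set" and A: "finite A" "A \<subseteq> V"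
  shows "\<exists>U. openin delta_topology U \<and> z \<in> U \<and> U \<subseteq> M z A"
proof -
  define U where "U = {w \<in> M z A. \<exists>C. finite C \<and> C \<subseteq> V \<and> M w C \<subseteq> M z A}"
  have "\<exists>B. finite B \<and> B \<subseteq> V \<and> M w B \<subseteq> U" if w: "w \<in> U" for w
  proof -
    obtain C where C: "finite C" "C \<subseteq> V" "M w C \<subseteq> M z A"
      using w by (auto simp: U_def)
    have "w \<in> delta_set" using w M_subset by (auto simp: U_def)
    then obtain B where B: "finite B" "B \<subseteq> V"
        "\<forall>w'\<in>M w B. \<exists>D. finite D \<and> D \<subseteq> V \<and> M w' D \<subseteq> M w C"
      using M_interior[of w C] C(1,2) by metis
    have "M w (C \<union> B) \<subseteq> U"
    proof
      fix w' assume "w' \<in> M w (C \<union> B)"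
      then have "w' \<in> M z A" "w' \<in> M w B" using M_Un[of w C B] C(3) by blast+
      then obtain D where "finite D" "D \<subseteq> V" "M w' D \<subseteq> M w C" using B(3) by blast
      then have "finite D \<and> D \<subseteq> V \<and> M w' D \<subseteq> M z A" using C(3) by auto
      then show "w' \<in> U" unfolding U_def using \<open>w' \<in> M z A\<close> by blast
    qed
    then show ?thesis using B C by (intro exI[of _ "C \<union> B"]) simp
  qed
  moreover have "U \<subseteq> delta_set" using M_subset[of z A] by (auto simp: U_def)
  ultimately have "openin delta_topology U"
    unfolding openin_delta_topology by blast
  moreover have "z \<in> U"
    using mem_M_self[OF z A] A by (auto simp: U_def)
  ultimately show ?thesis by (auto simp: U_def)
qed

section \<open>Hausdorff separation and compactness\<close>

lemma near_first_step:
  assumes g: "Geo y (Inr c) g" and h: "Geo y w h" and near: "d (g n) (h n) \<le> 13 * \<delta>" "n = 13 * \<delta> + 1"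
  shows "h 1 \<in> cvert (2 * n + 13 * \<delta> + 1) {g 0, g 1}" "h 1 \<noteq> y"
proof -
  have "{h 0, h (Suc 0)} \<in> Circ (2 * n + 13 * \<delta> + 1) {g 0, g (Suc 0)}" "lev y w (Suc 0) = Suc 0"
    using same_source_circuit[OF g h _ near(1), of 0] near(2) by simp_all
  then show "h 1 \<in> cvert (2 * n + 13 * \<delta> + 1) {g 0, g 1}" "h 1 \<noteq> y"
    using Geo_dist_source[OF h, of 1] Geo_source[OF h] by (auto simp: cvert_def)
qed

text \<open>Geodesics from \<open>x\<close> to points near \<open>c\<close> begin with an edge on a
  short circuit with the first edge of the ray. The finitely many possible second vertices form the
  set \<open>A\<close>.\<close>

lemma separated_vertex_boundary:
  assumes x: "x \<in> V" and c: "Inr c \<in> delta_set"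
  shows "\<exists>A B. finite A \<and> A \<subseteq> V \<and> finite B \<and> B \<subseteq> V \<and> M (Inl x) A \<inter> M (Inr c) B = {}"
proof -
  obtain g where g: "Geo x (Inr c) g" using ex_Geo x c by blast
  define n where "n = 13 * \<delta> + 1"
  let ?A = "cvert (2 * n + 13 * \<delta> + 1) {g 0, g 1}"
  have fA: "finite ?A" using Geo_edge[OF g, of 0] by (intro finite_cvert) simp
  obtain B where B: "finite B" "B \<subseteq> V" "\<And>w h. w \<in> M (Inr c) B \<Longrightarrow> Geo x w h \<Longrightarrow> d (g n) (h n) \<le> 13 * \<delta>"
    using M_imp_near[OF g, of n] by blast
  have "w \<notin> M (Inl x) ?A" if w: "w \<in> M (Inr c) B" for w
  proof -
    have "w \<in> delta_set" using w M_subset by blast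
    then obtain h where h: "Geo x w h" using ex_Geo x by blast
    have "h 1 \<in> ?A" "h 1 \<noteq> x"
      using near_first_step[OF g h B(3)[OF w h] n_def] by auto
    then have "range h \<inter> (?A - {x}) \<noteq> {}" by blast
    then show ?thesis using M_vertex[OF x] h by blast
  qed
  then show ?thesis
    using fA cvert_subset_V B(1,2) by (intro exI[of _ ?A] exI[of _ B]) blast
qed

lemma separated_boundary_boundary:
  assumes c: "Inr c \<in> delta_set" "Inr c' \<in> delta_set" and ne: "c \<noteq> c'"
  shows "\<exists>A B. finite A \<and> A \<subseteq> V \<and> finite B \<and> B \<subseteq> V \<and> M (Inr c) A \<inter> M (Inr c') B = {}"
proof -
  obtain g0 where "g0 \<in> c" using c boundary_ex by auto
  then have g: "Geo (g0 0) (Inr c) g0" using c Geo_boundaryI by auto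
  then obtain h where h: "Geo (g0 0) (Inr c') h" using ex_Geo Geo_source c by blast
  obtain n where n: "d (g0 n) (h n) > 26 * \<delta>" using boundary_diverge[OF g h ne] by blast
  obtain A where A: "finite A" "A \<subseteq> V" "\<And>w k. w \<in> M (Inr c) A \<Longrightarrow> Geo (g0 0) w k \<Longrightarrow> d (g0 n) (k n) \<le> 13 * \<delta>"
    using M_imp_near[OF g, of n] by blast
  obtain B where B: "finite B" "B \<subseteq> V" "\<And>w k. w \<in> M (Inr c') B \<Longrightarrow> Geo (g0 0) w k \<Longrightarrow> d (h n) (k n) \<le> 13 * \<delta>"
    using M_imp_near[OF h, of n] by blast
  have False if w: "w \<in> M (Inr c) A" "w \<in> M (Inr c') B" for w
  proof -
    have "w \<in> delta_set" using w M_subset by blast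
    then obtain k where k: "Geo (g0 0) w k" using ex_Geo Geo_source[OF g] by blast
    have "d (g0 n) (h n) \<le> 26 * \<delta>"
      using A(3)[OF w(1) k] B(3)[OF w(2) k] dist_triangle[OF Geo_V[OF g] Geo_V[OF k] Geo_V[OF h], of n n n]
        dist_sym[OF Geo_V[OF h] Geo_V[OF k], of n n] by linarith
    then show False using n by simp
  qed
  then show ?thesis
    using A(1,2) B(1,2) by (intro exI[of _ A] exI[of _ B]) blast
qed

text \<open>By \<open>gate\<close>, geodesics from \<open>x\<close> to points near \<open>x'\<close>
  pass through \<open>x'\<close>.\<close>

lemma separated_vertex_vertex:
  assumes x: "x \<in> V" "x' \<in> V" and ne: "x \<noteq> x'"
  shows "\<exists>A B. finite A \<and> A \<subseteq> V \<and> finite B \<and> B \<subseteq> V \<and> M (Inl x) A \<inter> M (Inl x') B = {}"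
proof -
  obtain B where B: "finite B" "B \<subseteq> V" "\<And>w h. w \<in> M (Inl x') B \<Longrightarrow> Geo x w h \<Longrightarrow> x' \<in> range h"
    using gate[OF x] by blast
  have "w \<notin> M (Inl x) {x'}" if w: "w \<in> M (Inl x') B" for w
  proof -
    have "w \<in> delta_set" using w M_subset by blast
    then obtain h where h: "Geo x w h" using ex_Geo x by blast
    then have "range h \<inter> ({x'} - {x}) \<noteq> {}" using B(3)[OF w h] ne by blast
    then show ?thesis using M_vertex[OF x(1)] h by blast
  qed
  then show ?thesis using B(1,2) x by (intro exI[of _ "{x'}"] exI[of _ B]) blast
qed

lemma Hausdorff_delta: "Hausdorff_space delta_topology"
  unfolding Hausdorff_space_def
proof (intro allI impI, elim conjE)
  fix z w assume zw: "z \<in> topspace delta_topology" "w \<in> topspace delta_topology" "z \<noteq> w"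
  have "\<exists>A B. finite A \<and> A \<subseteq> V \<and> finite B \<and> B \<subseteq> V \<and> M z A \<inter> M w B = {}"
  proof (cases z; cases w)
    fix x x' assume "z = Inl x" "w = Inl x'"
    then show ?thesis using separated_vertex_vertex[of x x'] zw by simp
  next
    fix x c assume "z = Inl x" "w = Inr c"
    then show ?thesis using separated_vertex_boundary[of x c] zw by simp
  next
    fix x c assume "z = Inr c" "w = Inl x"
    then show ?thesis using separated_vertex_boundary[of x c] zw by (metis Inl_in_delta_set Int_commute topspace_delta_topology)
  next
    fix c c' assume "z = Inr c" "w = Inr c'"
    then show ?thesis using separated_boundary_boundary[of c c'] zw by simp
  qed
  then obtain A B where AB: "finite A" "A \<subseteq> V" "finite B" "B \<subseteq> V" "M z A \<inter> M w B = {}" by blast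
  obtain U where U: "openin delta_topology U" "z \<in> U" "U \<subseteq> M z A"
    using open_in_M[of z A] AB zw by auto
  obtain W where W: "openin delta_topology W" "w \<in> W" "W \<subseteq> M w B"
    using open_in_M[of w B] AB zw by auto
  show "\<exists>U W. openin delta_topology U \<and> openin delta_topology W \<and> z \<in> U \<and> w \<in> W \<and> disjnt U W"
  proof (intro exI conjI)
    show "disjnt U W" using AB(5) U(3) W(3) by (auto simp: disjnt_def)
  qed (use U W in auto)
qed

text \<open>Let \<open>h\<close> pass through \<open>b\<close> to \<open>x\<close>, and let another
  geodesic \<kappa> from \<open>b\<close> to \<open>x\<close> meet \<open>a\<close> in
  \<open>A\<close>. Its part up to \<open>a\<close> forms a bigon with the fixed geodesic
  \<open>\<gamma> a\<close>, and \<kappa> forms one with the rest of \<open>h\<close>. The two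
  bigons explain the nested circuits in \<open>A'\<close>, which confine the next vertex of
  \<open>h\<close>.\<close>

lemma shadow_finite_branching:
  assumes V: "y \<in> V" "b \<in> V" and A: "finite A" "A \<subseteq> V"
  shows "\<exists>A'. finite A' \<and> A' \<subseteq> V \<and>
    shadow y b \<subseteq> M (Inl b) A \<union> (\<Union>a\<in>{a\<in>A'. {b, a} \<in> E \<and> d y a = Suc (d y b)}. shadow y a)"
proof -
  have "\<forall>a\<in>A. \<exists>\<gamma>. Geo b (Inl a) \<gamma>" using ex_Geo_vertex V A by blast
  then obtain \<gamma> where \<gamma>: "\<And>a. a \<in> A \<Longrightarrow> Geo b (Inl a) (\<gamma> a)" by metis
  define A' where "A' = (\<Union>a\<in>A - {b}. \<Union>e\<in>Circ mu {\<gamma> a 0, \<gamma> a 1}. cvert mu e)"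
  have eE: "{\<gamma> a 0, \<gamma> a 1} \<in> E" if "a \<in> A - {b}" for a
  proof -
    have "lev b (Inl a) (Suc 0) = Suc 0" using that dist_eq_0[of b a] V A by auto
    then show ?thesis using Geo_edge[OF \<gamma>, of a 0] that by simp
  qed
  have "finite A'"
    unfolding A'_def using A eE finite_Circ[OF fine] finite_cvert Circ_subset_E
    by (intro finite_UN_I) blast+
  moreover have "A' \<subseteq> V" using cvert_subset_V by (auto simp: A'_def)
  moreover have "shadow y b \<subseteq> M (Inl b) A \<union> (\<Union>a\<in>{a\<in>A'. {b, a} \<in> E \<and> d y a = Suc (d y b)}. shadow y a)"
  proof
    fix x assume x: "x \<in> shadow y b"
    show "x \<in> M (Inl b) A \<union> (\<Union>a\<in>{a\<in>A'. {b, a} \<in> E \<and> d y a = Suc (d y b)}. shadow y a)"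
    proof (cases "x \<in> M (Inl b) A")
      case False
      have xd: "x \<in> delta_set" using x shadow_subset by blast
      then obtain \<kappa> a where \<kappa>: "Geo b x \<kappa>" "a \<in> range \<kappa>" "a \<in> A - {b}"
        using False M_vertex[OF V(2)] by blast
      obtain h where h: "Geo y x h" "h (d y b) = b" "lev y x (d y b) = d y b"
        using x shadow_iff by blast
      have tail: "Geo b x (\<lambda>i. h (d y b + i))"
        using Geo_tail[OF h(1,3)] h(2) by simp
      have ka: "\<kappa> (d b a) = a" "lev b x (d b a) = d b a"
        using Geo_split[OF \<kappa>(1,2)] by auto
      have "d b a \<noteq> 0" using \<kappa>(3) dist_eq_0[of b a] V A by auto
      then have l1: "lev b x (Suc 0) = Suc 0" "lev b (Inl a) (Suc 0) = Suc 0"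
        using lev_eqI[OF ka(2), of "Suc 0"] by auto
      have "Geo b (Inl a) (\<lambda>i. \<kappa> (min i (d b a)))"
        using Geo_trunc[OF \<kappa>(1) ka(2)] ka(1) by simp
      then have "{\<kappa> 0, \<kappa> 1} \<in> Circ mu {\<gamma> a 0, \<gamma> a 1}"
        using bigon_circuit[OF \<gamma>[of a] _ l1(2)] \<kappa>(3) \<open>d b a \<noteq> 0\<close> by fastforce
      moreover have "{h (d y b), h (Suc (d y b))} \<in> Circ mu {\<kappa> 0, \<kappa> 1}"
        using bigon_circuit[OF \<kappa>(1) tail l1(1)] by simp
      ultimately have hA: "h (Suc (d y b)) \<in> A'"
        unfolding A'_def cvert_def using \<kappa>(3) by blast
      have edge: "{b, h (Suc (d y b))} \<in> E"
        using Geo_edge[OF tail, of 0] l1(1) h(2) by simp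
      have "d b (h (Suc (d y b))) = 1" using dist_edge[OF edge] .
      then have "d y (h (Suc (d y b))) = Suc (d y b)"
        using Geo_dist[OF h(1), of "d y b" "Suc (d y b)"] h(2,3) lev_step[of y x "d y b"]
          Geo_dist_source[OF h(1)] by auto
      moreover have "x \<in> shadow y (h (Suc (d y b)))" using h(1) by (auto simp: shadow_def)
      ultimately show ?thesis using hA edge by blast
    qed simp
  qed
  ultimately show ?thesis by blast
qed

text \<open>If no finite subfamily covers, then Koenig's argument yields a geodesic ray \<open>f\<close> all of whose
  shadows \<open>shadow y (f k)\<close> are not finitely covered, whereas they shrink to its endpoint.\<close>

lemma compact_delta: "compact_space delta_topology"
proof (cases "V = {}")
  case True
  then have "delta_set = {}"
    using boundary_ex boundary_infinite_geodesic unfolding delta_set_def infinite_geodesic_iff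
    by (metis (no_types, lifting) Plus_def Un_empty equals0I image_is_empty image_subset_iff empty_iff UNIV_I)
  then show ?thesis
    by (simp add: compact_space_def null_topspace_iff_trivial flip: topspace_delta_topology)
next
  case False
  then obtain y where y: "y \<in> V" by blast
  show ?thesis
    unfolding compact_space_alt topspace_delta_topology
  proof (intro allI impI, elim conjE)
    fix \<U> assume op: "\<forall>U\<in>\<U>. openin delta_topology U" and cov: "delta_set \<subseteq> \<Union>\<U>"
    define fc where "fc S \<longleftrightarrow> (\<exists>\<F>. finite \<F> \<and> \<F> \<subseteq> \<U> \<and> S \<subseteq> \<Union>\<F>)" for S
    have fc_Un: "fc (\<Union>i\<in>I. S i)" if I: "finite I" and fcS: "\<And>i. i \<in> I \<Longrightarrow> fc (S i)" for I :: "'v set" and S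
    proof -
      obtain \<F> where F: "\<And>i. i \<in> I \<Longrightarrow> finite (\<F> i) \<and> \<F> i \<subseteq> \<U> \<and> S i \<subseteq> \<Union>(\<F> i)"
        using fcS unfolding fc_def by metis
      then show ?thesis
        unfolding fc_def
      proof (intro exI[of _ "\<Union>i\<in>I. \<F> i"] conjI)
        show "finite (\<Union>i\<in>I. \<F> i)" using F I by simp
        show "(\<Union>i\<in>I. \<F> i) \<subseteq> \<U>" using F by blast
        show "(\<Union>i\<in>I. S i) \<subseteq> \<Union>(\<Union>i\<in>I. \<F> i)" using F by fastforce
      qed
    qed
    have fc_Un2: "fc (S \<union> T)" if "fc S" "fc T" for S T
    proof -
      from that(1) obtain \<F> where "finite \<F> \<and> \<F> \<subseteq> \<U> \<and> S \<subseteq> \<Union>\<F>"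
        unfolding fc_def ..
      moreover from that(2) obtain \<G> where "finite \<G> \<and> \<G> \<subseteq> \<U> \<and> T \<subseteq> \<Union>\<G>"
        unfolding fc_def ..
      ultimately show ?thesis
        unfolding fc_def by (intro exI[of _ "\<F> \<union> \<G>"]) auto
    qed
    have fc_mono: "fc S" if "fc T" "S \<subseteq> T" for S T
      using that unfolding fc_def by (meson subset_trans)
    have fc_M: "\<exists>A. finite A \<and> A \<subseteq> V \<and> fc (M z A)" if z: "z \<in> delta_set" for z
    proof -
      obtain U where U: "U \<in> \<U>" "z \<in> U" using cov z by blast
      have "openin delta_topology U" using op U(1) by (rule bspec)
      then have "\<exists>A. finite A \<and> A \<subseteq> V \<and> M z A \<subseteq> U"
        using U(2) unfolding openin_delta_topology by simp
      then obtain A where "finite A" "A \<subseteq> V" "M z A \<subseteq> U"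
        by (elim exE conjE)
      then show ?thesis
        unfolding fc_def using U by (intro exI[of _ A] conjI exI[of _ "{U}"]) auto
    qed
    have "fc delta_set"
    proof (rule ccontr)
      assume no: "\<not> fc delta_set"
      define bad where "bad k b \<longleftrightarrow> b \<in> V \<and> d y b = k \<and> \<not> fc (shadow y b)" for k b
      have "\<exists>f. \<forall>k. bad k (f k) \<and> {f k, f (Suc k)} \<in> E"
      proof (rule dependent_nat_choice)
        have "shadow y y = delta_set" using shadow_self[OF _ y] shadow_subset by blast
        then show "\<exists>b. bad 0 b" using no y by (intro exI[of _ y]) (simp add: bad_def)
      next
        fix b k assume b: "bad k b"
        then have bV: "b \<in> V" by (simp add: bad_def)
        obtain A where A: "finite A" "A \<subseteq> V" "fc (M (Inl b) A)"
          using fc_M[of "Inl b"] bV by auto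
        obtain A' where A': "finite A'" "A' \<subseteq> V"
            "shadow y b \<subseteq> M (Inl b) A \<union> (\<Union>a\<in>{a\<in>A'. {b, a} \<in> E \<and> d y a = Suc (d y b)}. shadow y a)"
          using shadow_finite_branching[OF y bV A(1,2)] by blast
        have "\<not> fc (\<Union>a\<in>{a\<in>A'. {b, a} \<in> E \<and> d y a = Suc (d y b)}. shadow y a)"
          using b fc_mono[OF fc_Un2[OF A(3)] A'(3)] by (auto simp: bad_def)
        then obtain a where "a \<in> A'" "{b, a} \<in> E" "d y a = Suc (d y b)" "\<not> fc (shadow y a)"
          using fc_Un[of "{a\<in>A'. {b, a} \<in> E \<and> d y a = Suc (d y b)}" "shadow y"] A'(1) by auto
        then show "\<exists>a. bad (Suc k) a \<and> {b, a} \<in> E"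
          using A'(2) b by (auto simp: bad_def)
      qed
      then obtain f where f: "\<And>k. bad k (f k)" "\<And>k. {f k, f (Suc k)} \<in> E" by blast
      have fV: "f k \<in> V" and fd: "d y (f k) = k" for k using f(1) by (auto simp: bad_def)
      have le: "d (f i) (f j) \<le> j - i" if "i \<le> j" for i j
        using walk_segment[of i j f E] f(2) that fV by (intro dist_le_walk) auto
      have eq: "d (f i) (f j) = j - i" if "i \<le> j" for i j
        using le[OF that] dist_triangle[OF y fV fV, of j i] fd by fastforce
      have "int (d (f i) (f j)) = \<bar>int i - int j\<bar>" for i j
        using eq[of i j] eq[of j i] dist_sym[OF fV fV, of i j] by (cases "i \<le> j") auto
      then have "infinite_geodesic f" unfolding infinite_geodesic_iff using fV by auto
      then obtain c where c: "c \<in> boundary" "f \<in> c" using class_in_boundary by blast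
      have "f 0 = y" using fd[of 0] dist_eq_0[OF y fV] by simp
      then have G: "Geo y (Inr c) f" using Geo_boundaryI[OF c] by simp
      obtain A where A: "finite A" "A \<subseteq> V" "fc (M (Inr c) A)"
        using fc_M[of "Inr c"] c by auto
      obtain n where n: "\<And>w h. Geo y w h \<Longrightarrow> d (f n) (h n) \<le> 0 \<Longrightarrow> w \<in> M (Inr c) A"
        using near_imp_M[OF G A(1,2)] by blast
      have "shadow y (f n) \<subseteq> M (Inr c) A"
      proof
        fix w assume "w \<in> shadow y (f n)"
        then obtain h where "Geo y w h" "h n = f n" using fd unfolding shadow_iff by metis
        then show "w \<in> M (Inr c) A" using n fV by simp
      qed
      then show False using f(1)[of n] fc_mono[OF A(3)] by (auto simp: bad_def)
    qed
    then show "\<exists>\<F>. finite \<F> \<and> \<F> \<subseteq> \<U> \<and> delta_set \<subseteq> \<Union>\<F>" by (simp add: fc_def)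
  qed
qed

lemma normal_delta: "normal_space delta_topology"
  using compact_Hausdorff_or_regular_imp_normal_space compact_delta Hausdorff_delta by blast

end

section \<open>Candidate sets\<close>

context connected_graph
begin

text \<open>Replacing the part of \<open>h\<close> before \<open>b\<close> creates no shortcut: the
  way through \<open>a\<close> and \<open>b\<close> is as long as the difference of levels, which is
  a lower bound for the distance. Towards a boundary point only finitely many terms change, so the
  class is the same.\<close>

lemma Geo_reroute:
  assumes h: "Geo y z h" and b: "h (Suc k) = b" "lev y z (Suc k) = Suc k"
    and a: "{a, b} \<in> E" "d y a = k"
  shows "\<exists>h'. Geo y z h' \<and> h' k = a \<and> h' (Suc k) = b"
proof -
  have V: "y \<in> V" "a \<in> V" "b \<in> V" using Geo_source[OF h] edge_in_V[OF a(1)] by auto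
  obtain f where f: "Geo y (Inl a) f" using ex_Geo_vertex V by blast
  define h' where "h' i = (if i \<le> k then f i else h i)" for i
  have VV: "f i \<in> V" "h i \<in> V" for i using Geo_V f h by auto
  have lk: "lev y z i = i" if "i \<le> k" for i using lev_eqI[OF b(2)] that by simp
  have lj: "Suc k \<le> lev y z j" if "\<not> j \<le> k" for j
    using lev_mono[of "Suc k" j y z] b(2) that by simp
  have fk: "f k = a" using Geo_vertex_end[OF f] a(2) by simp
  have fi: "d y (f i) = i" if "i \<le> k" for i using Geo_dist_source[OF f, of i] that a(2) by simp
  have mix: "d (f i) (h j) = lev y z j - i" if ij: "i \<le> k" "\<not> j \<le> k" for i j
  proof -
    have "d (f i) (h j) \<le> d (f i) a + (d a b + d b (h j))"
      using dist_triangle[OF VV(1) V(2) VV(2), of i j] dist_triangle[OF V(2,3) VV(2), of j] by linarith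
    moreover have "d (f i) a = k - i"
      using Geo_dist[OF f, of i k] ij(1) a(2) fk by simp
    moreover have "d b (h j) = lev y z j - Suc k"
      using Geo_dist[OF h, of "Suc k" j] b lj[OF ij(2)] by simp
    moreover have "lev y z j \<le> i + d (f i) (h j)"
      using dist_triangle[OF V(1) VV(1) VV(2), of j i] fi[OF ij(1)] Geo_dist_source[OF h, of j] by simp
    ultimately show ?thesis using dist_edge[OF a(1)] ij lj[OF ij(2)] by linarith
  qed
  have dist: "int (d (h' i) (h' j)) = \<bar>int (lev y z i) - int (lev y z j)\<bar>" for i j
  proof (cases "i \<le> k"; cases "j \<le> k")
    assume "i \<le> k" "j \<le> k"
    then show ?thesis using Geo_dist[OF f, of i j] lk a(2) by (simp add: h'_def)
  next
    assume ij: "i \<le> k" "\<not> j \<le> k"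
    then show ?thesis using mix[OF ij] lk[of i] lj[of j] by (simp add: h'_def)
  next
    assume ij: "\<not> i \<le> k" "j \<le> k"
    then show ?thesis using mix[OF ij(2,1)] lk[of j] lj[of i] dist_sym[OF VV, of i j] dist_sym[OF VV(1) VV(2), of j i]
      by (simp add: h'_def)
  next
    assume "\<not> i \<le> k" "\<not> j \<le> k"
    then show ?thesis using Geo_dist[OF h] by (simp add: h'_def)
  qed
  have V': "range h' \<subseteq> V" using VV by (auto simp: h'_def)
  have "Geo y z h'"
  proof (cases z)
    case (Inl x)
    then have "h' (d y x) = x"
      using Geo_vertex_end[of y x h] h b(2) by (auto simp: h'_def)
    then show ?thesis
      unfolding Geo_def using V(1) Geo_target[OF h] V' dist Geo_0[OF f] Inl by (auto simp: h'_def)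
  next
    case (Inr c)
    then have hc: "infinite_geodesic h" "h \<in> c" "c \<in> boundary" using Geo_boundaryD[of y c h] h by auto
    have "infinite_geodesic h'"
      unfolding infinite_geodesic_iff using V' dist Inr by simp
    moreover have "d (h t) (h' t) \<le> 2 * k" for t
    proof (cases "t \<le> k")
      case True
      have "d (h t) y = t" using Geo_dist_source[OF h, of t] Inr dist_sym[OF V(1) VV(2), of t] by simp
      then show ?thesis
        using dist_triangle[OF VV(2) V(1) VV(1), of t t] fi[OF True] True by (simp add: h'_def)
    qed (use VV in \<open>simp add: h'_def\<close>)
    ultimately have "h' \<in> c" using shift_in_boundary hc by blast
    moreover have "h' 0 = y" using Geo_0[OF f] by (simp add: h'_def)
    ultimately show ?thesis using Geo_boundaryI hc Inr by blast
  qed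
  moreover have "h' k = a" "h' (Suc k) = b" using fk b by (auto simp: h'_def)
  ultimately show ?thesis by blast
qed

lemma finite_range_Geo: "Geo y (Inl x) g \<Longrightarrow> finite (range g)"
proof -
  assume g: "Geo y (Inl x) g"
  have "range g \<subseteq> g ` {..d y x}"
    using Geo_lev[OF g] by (auto intro!: image_eqI[of _ _ "min _ (d y x)"])
  then show ?thesis using finite_subset by blast
qed

lemma finite_edges_of: "finite Z \<Longrightarrow> finite (edges_of Z)"
  by (rule finite_subset[of _ "Pow Z"]) (auto simp: edges_of_def)

lemma finite_Union_edges: "finite W \<Longrightarrow> W \<subseteq> E \<Longrightarrow> finite (\<Union>W)"
proof (rule finite_Union)
  show "finite e" if "W \<subseteq> E" "e \<in> W" for e using edges[of e] that by auto
qed auto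

lemma cvert_self: "e \<in> E \<Longrightarrow> 2 \<le> n \<Longrightarrow> e \<subseteq> cvert n e"
  using Circ_refl by (auto simp: cvert_def)

end

context fine_hyperbolic_graph
begin

text \<open>The second part thickens the geodesics from \<open>y\<close> to \<open>z\<close> along short circuits, so that it meets
  the geodesics to \<open>z\<close> from other base points. With \<open>Z\<close> and \<open>W\<close> finite the set depends upper
  semicontinuously on \<open>z\<close>.\<close>

definition candidates :: "'v \<Rightarrow> 'v set \<Rightarrow> 'v set set \<Rightarrow> nat \<Rightarrow> 'v + (nat \<Rightarrow> 'v) set \<Rightarrow> 'v set" where
  "candidates y Z W L z = {p \<in> Z. d y p \<le> L \<and> z \<in> shadow y p} \<union>
     {p. \<exists>a b. {a, b} \<in> W \<and> d y b = Suc (d y a) \<and> d y b \<le> L \<and> z \<in> shadow y b \<and> p \<in> cvert mu {a, b}}"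

lemma candidates_mono: "Z \<subseteq> Z' \<Longrightarrow> W \<subseteq> W' \<Longrightarrow> candidates y Z W L z \<subseteq> candidates y Z' W' L z"
  unfolding candidates_def by blast

lemma candidates_subset: "candidates y Z W L z \<subseteq> Z \<union> (\<Union>e\<in>W. cvert mu e)"
  unfolding candidates_def by blast

text \<open>For fixed \<open>p\<close> this is a finite union of shadows. Closedness for each
  \<open>p\<close> is the upper semicontinuity to which the Urysohn functions are adapted.\<close>

lemma closedin_candidates:
  assumes y: "y \<in> V" and Z: "Z \<subseteq> V" and W: "finite W" "W \<subseteq> E"
  shows "closedin delta_topology {z. p \<in> candidates y Z W L z}"
proof -
  let ?I = "{(a, b). {a, b} \<in> W \<and> d y b = Suc (d y a) \<and> d y b \<le> L \<and> p \<in> cvert mu {a, b}}"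
  have "{z. p \<in> candidates y Z W L z} = (if p \<in> Z \<and> d y p \<le> L then shadow y p else {}) \<union> (\<Union>(a, b)\<in>?I. shadow y b)"
    unfolding candidates_def by auto
  moreover have "finite ?I"
    by (rule finite_subset[OF _ finite_cartesian_product[OF finite_Union_edges[OF W] finite_Union_edges[OF W]]])
      auto
  then have "closedin delta_topology (\<Union>(a, b)\<in>?I. shadow y b)"
    using W edge_in_V by (intro closedin_Union) (auto intro!: closedin_shadow[OF y])
  moreover have "closedin delta_topology (if p \<in> Z \<and> d y p \<le> L then shadow y p else {})"
    using closedin_shadow[OF y] Z by auto
  ultimately show ?thesis by (simp only: closedin_Un)
qed

text \<open>Every geodesic from \<open>y\<close> to \<open>z\<close> has its edges on
  \<open>mu\<close>-circuits with the edges of one geodesic \<open>g\<close> at the same level, so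
  the first \<open>L\<close> edges of \<open>g\<close> account for everything. An edge in
  \<open>Circ mu e\<close> is a subset of \<open>cvert mu e\<close>, hence the factor
  \<open>2 ^ c\<close>. The sizes of \<open>Z\<close> and \<open>W\<close>, which are not
  controlled, do not enter the bound.\<close>

lemma card_candidates_le:
  assumes y: "y \<in> V" and z: "z \<in> delta_set" and Z: "Z \<subseteq> V" and W: "W \<subseteq> E"
    and c: "\<And>e. e \<in> E \<Longrightarrow> card (cvert mu e) \<le> c"
  shows "finite (candidates y Z W L z)" "card (candidates y Z W L z) \<le> 1 + L * (2 ^ c * c)"
proof -
  obtain g where g: "Geo y z g" using ex_Geo y z by blast
  let ?e = "\<lambda>k. {g k, g (Suc k)}"
  let ?I = "{k. k < L \<and> lev y z (Suc k) = Suc k}"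
  let ?T = "\<lambda>k. \<Union>e\<in>Circ mu (?e k). cvert mu e"
  have mu2: "2 \<le> mu" by (simp add: mu_def)
  have eE: "?e k \<in> E" if "k \<in> ?I" for k using Geo_edge[OF g, of k] that by simp
  have sub: "candidates y Z W L z \<subseteq> insert y (\<Union>k\<in>?I. ?T k)"
  proof
    fix p assume "p \<in> candidates y Z W L z"
    then consider (v) "p \<in> Z" "d y p \<le> L" "z \<in> shadow y p"
      | (e) a b where "{a, b} \<in> W" "d y b = Suc (d y a)" "d y b \<le> L" "z \<in> shadow y b" "p \<in> cvert mu {a, b}"
      unfolding candidates_def by blast
    then show "p \<in> insert y (\<Union>k\<in>?I. ?T k)"
    proof cases
      case v
      then obtain h where h: "Geo y z h" "h (d y p) = p" "lev y z (d y p) = d y p"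
        using shadow_iff by blast
      show ?thesis
      proof (cases "d y p")
        case 0
        then show ?thesis using dist_eq_0 y v Z by auto
      next
        case (Suc k)
        have "{h k, h (Suc k)} \<in> Circ mu (?e k)"
          using h Suc by (intro bigon_circuit[OF g]) simp_all
        moreover have "p \<in> cvert mu {h k, h (Suc k)}"
          using cvert_self[OF _ mu2, of "{h k, h (Suc k)}"] calculation Circ_subset_E h(2) Suc by auto
        moreover have "k \<in> ?I" using Suc v h by simp
        ultimately show ?thesis by blast
      qed
    next
      case e
      obtain h where h: "Geo y z h" "h (d y b) = b" "lev y z (d y b) = d y b"
        using shadow_iff e by blast
      have "\<exists>h'. Geo y z h' \<and> h' (d y a) = a \<and> h' (Suc (d y a)) = b"
        using h e W by (intro Geo_reroute[OF h(1)]) auto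
      then obtain h' where h': "Geo y z h'" "h' (d y a) = a" "h' (Suc (d y a)) = b" by blast
      have l: "lev y z (Suc (d y a)) = Suc (d y a)" using h(3) e by simp
      have "{a, b} \<in> Circ mu (?e (d y a))"
        using bigon_circuit[OF g h'(1) l] h' by simp
      moreover have "d y a \<in> ?I" using l e by simp
      ultimately show ?thesis using e(5) by blast
    qed
  qed
  have fT: "finite (?T k)" if "k \<in> ?I" for k
    using finite_Circ[OF fine eE[OF that]] finite_cvert Circ_subset_E by blast
  have cT: "card (?T k) \<le> 2 ^ c * c" if k: "k \<in> ?I" for k
  proof -
    have fC: "finite (Circ mu (?e k))" using finite_Circ[OF fine eE[OF k]] .
    have "card (?T k) \<le> (\<Sum>e\<in>Circ mu (?e k). card (cvert mu e))"
      by (rule card_UN_le[OF fC])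
    also have "\<dots> \<le> card (Circ mu (?e k)) * c"
      using sum_bounded_above[of "Circ mu (?e k)" "\<lambda>e. card (cvert mu e)" c] c Circ_subset_E by auto
    also have "card (Circ mu (?e k)) \<le> card (Pow (cvert mu (?e k)))"
      using finite_cvert[OF eE[OF k]] by (intro card_mono) (auto simp: cvert_def)
    also have "\<dots> \<le> 2 ^ c"
      using finite_cvert[OF eE[OF k]] c[OF eE[OF k]] by (simp add: card_Pow)
    finally show ?thesis by simp
  qed
  have fU: "finite (insert y (\<Union>k\<in>?I. ?T k))" using fT by simp
  then show "finite (candidates y Z W L z)" using sub finite_subset by blast
  have "card (candidates y Z W L z) \<le> card (insert y (\<Union>k\<in>?I. ?T k))"
    by (rule card_mono[OF fU sub])
  also have "\<dots> \<le> 1 + card (\<Union>k\<in>?I. ?T k)"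
    using card_insert_le_m1[of "Suc (card (\<Union>k\<in>?I. ?T k))" "\<Union>k\<in>?I. ?T k" y] by simp
  also have "card (\<Union>k\<in>?I. ?T k) \<le> (\<Sum>k\<in>?I. card (?T k))"
    by (rule card_UN_le) simp
  also have "\<dots> \<le> card ?I * (2 ^ c * c)"
    using sum_bounded_above[of ?I "\<lambda>k. card (?T k)" "2 ^ c * c"] cT by auto
  also have "card ?I \<le> card {..<L}" by (rule card_mono) auto
  finally show "card (candidates y Z W L z) \<le> 1 + L * (2 ^ c * c)" by simp
qed

text \<open>All base points \<open>y\<close> in a bounded finite set \<open>D\<close> see a common point. Follow a geodesic from
  \<open>y\<^sub>0\<close> to \<open>z\<close> through a growing sequence \<open>\<E>\<close> of finite edge sets. If an edge leaves the
  sequence, then all geodesics from \<open>D\<close> to \<open>z\<close> pass through its source by \<open>vertex_circuit\<close>;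
  otherwise \<open>z\<close> itself or an edge at distance \<open>s1\<close> from \<open>y\<^sub>0\<close> will do.\<close>

lemma common_point:
  assumes D: "finite D" "D \<subseteq> V" and y0: "y0 \<in> D" and R: "\<And>y. y \<in> D \<Longrightarrow> d y0 y \<le> R"
  shows "\<exists>Z W. finite Z \<and> Z \<subseteq> V \<and> finite W \<and> W \<subseteq> E \<and>
    (\<forall>z\<in>delta_set. \<exists>p. \<forall>y\<in>D. p \<in> candidates y Z W (2 * R + 2 * \<delta> + 2) z)"
proof -
  \<comment> \<open>At level \<open>s1\<close>, \<open>uniform_circuit\<close> applies to every base
    point in \<open>D\<close>. \<open>L\<close> is \<open>R + s1 + 1\<close>, \<open>t\<close> is
    more than \<open>2 * \<delta>\<close> beyond all levels up to \<open>s1\<close>, and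
    \<open>m\<close> bounds both \<open>mu\<close> and the length of the circuit that refutes an
    escaping edge.\<close>
  define s1 where "s1 = R + 2 * \<delta> + 1"
  define L where "L = 2 * R + 2 * \<delta> + 2"
  define t where "t = s1 + 2 * \<delta> + 1"
  define m where "m = (t + 2 * \<delta> + (2 * \<delta> + t + R)) + (R + s1) + 1 + mu"
  have DV: "y \<in> V" if "y \<in> D" for y using D that by blast
  have y0V: "y0 \<in> V" using y0 DV by blast
  have "\<forall>y\<in>D. \<exists>\<beta>. Geo y0 (Inl y) \<beta>" using ex_Geo_vertex y0V DV by blast
  then obtain \<beta> where \<beta>: "\<And>y. y \<in> D \<Longrightarrow> Geo y0 (Inl y) (\<beta> y)" by metis
  \<comment> \<open>Stage 0 consists of edges of the geodesics from \<open>y0\<close> to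
    \<open>D\<close>; each stage adds the edges on circuits of length at most \<open>m\<close> with
    earlier ones. Fineness keeps the stages finite, and they do not depend on
    \<open>z\<close>.\<close>
  define \<E> where "\<E> = rec_nat (\<Union>y\<in>D. edges_of (range (\<beta> y))) (\<lambda>_ F. F \<union> (\<Union>e\<in>F. Circ m e))"
  have E0: "\<E> 0 = (\<Union>y\<in>D. edges_of (range (\<beta> y)))" and
    ES: "\<And>i. \<E> (Suc i) = \<E> i \<union> (\<Union>e\<in>\<E> i. Circ m e)"
    by (simp_all add: \<E>_def)
  have EE: "finite (\<E> i) \<and> \<E> i \<subseteq> E" for i
  proof (induction i)
    case 0
    have "finite (edges_of (range (\<beta> y)))" if "y \<in> D" for y
      using finite_range_Geo[OF \<beta>[OF that]] by (rule finite_edges_of)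
    then show ?case unfolding E0 using D(1) edges_of_subset_E by blast
  next
    case (Suc i)
    then have "finite (Circ m e)" if "e \<in> \<E> i" for e using finite_Circ[OF fine] that by blast
    then show ?case unfolding ES using Suc Circ_subset_E by blast
  qed
  have Emono: "\<E> i \<subseteq> \<E> j" if "i \<le> j" for i j
    using that by (rule lift_Suc_mono_le[rotated]) (simp add: ES)
  define W where "W = \<E> (s1 + 2)"
  define Z where "Z = D \<union> \<Union>W"
  have WE: "finite W" "W \<subseteq> E" using EE by (auto simp: W_def)
  have Zf: "finite Z" "Z \<subseteq> V"
    using finite_Union_edges[OF WE] WE D edge_subset_V by (auto simp: Z_def)
  have "\<exists>p. \<forall>y\<in>D. p \<in> candidates y Z W L z" if z: "z \<in> delta_set" for z
  proof -
    obtain \<alpha> where \<alpha>: "Geo y0 z \<alpha>" using ex_Geo y0V z by blast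
    let ?e = "\<lambda>s. {\<alpha> s, \<alpha> (Suc s)}"
    let ?out = "\<lambda>s. s \<le> s1 \<and> lev y0 z (Suc s) = Suc s \<and> ?e s \<notin> \<E> (Suc s)"
    have aV: "\<alpha> i \<in> V" for i using Geo_V[OF \<alpha>] .
    show ?thesis
    proof (cases "\<exists>s. ?out s")
      case True
      \<comment> \<open>Before the first escaping edge, \<alpha> runs inside stage
        \<open>s\<close>.\<close>
      define s where "s = (LEAST s. ?out s)"
      have s: "?out s" unfolding s_def using True by (rule LeastI_ex)
      have below: "?e j \<in> \<E> s" if j: "j < s" for j
      proof -
        have "\<not> ?out j" using j not_less_Least unfolding s_def by blast
        then have "?e j \<in> \<E> (Suc j)" using j s lev_eqI[of y0 z "Suc s" "Suc j"] by auto
        then show ?thesis using Emono[of "Suc j" s] j by auto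
      qed
      let ?p = "\<alpha> s"
      have ds: "d y0 (\<alpha> i) = i" if "i \<le> Suc s" for i
        using Geo_dist_source[OF \<alpha>, of i] lev_eqI[of y0 z "Suc s" i] s that by simp
      have pZ: "?p \<in> Z"
      proof (cases s)
        case 0
        then show ?thesis using Geo_0[OF \<alpha>] y0 by (simp add: Z_def)
      next
        case (Suc j)
        then have "?e j \<in> W" using below[of j] Emono[of s "s1 + 2"] s by (auto simp: W_def)
        then show ?thesis using Suc by (auto simp: Z_def)
      qed
      have "?p \<in> candidates y Z W L z" if y: "y \<in> D" for y
      proof -
        have yV: "y \<in> V" using DV y .
        obtain \<alpha>' where \<alpha>': "Geo y z \<alpha>'" using ex_Geo yV z by blast
        have yR: "d y y0 \<le> R" using R[OF y] dist_sym[OF y0V yV] by simp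
        have "?p \<in> range \<alpha>'"
        proof (rule ccontr)
          assume np: "?p \<notin> range \<alpha>'"
          let ?N = "{e \<in> E. ?p \<notin> e}"
          have nb: "edges_of (range \<alpha>') \<subseteq> ?N" using np by (auto simp: edges_of_def)
          have seg: "walk ?N (b - Suc s) (\<alpha> (Suc s)) (\<alpha> b)" if b: "lev y0 z b = b" "Suc s \<le> b" for b
          proof (rule walk_segment[OF _ b(2)])
            fix i assume i: "Suc s \<le> i" "i < b"
            then have l: "lev y0 z i = i" "lev y0 z (Suc i) = Suc i"
              using lev_eqI[OF b(1)] by auto
            then have "\<alpha> i \<noteq> ?p" "\<alpha> (Suc i) \<noteq> ?p"
              using Geo_dist_source[OF \<alpha>, of i] Geo_dist_source[OF \<alpha>, of "Suc i"] ds[of s] i by auto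
            then show "\<alpha> i = \<alpha> (Suc i) \<or> {\<alpha> i, \<alpha> (Suc i)} \<in> ?N"
              using Geo_edge[OF \<alpha> l(2)] by auto
          qed
          have homeward: "walk ?N (d (\<alpha>' i) y) (\<alpha>' i) y" for i
            using walk_mono[OF Geo_walk[OF \<alpha>', of i 0] nb] Geo_0[OF \<alpha>'] by simp
          \<comment> \<open>Along \<alpha> away from its \<open>s\<close>-th vertex up to level
            \<open>t\<close> or to the end, over to \<open>\<alpha>'\<close> and back to
            \<open>y\<close>, without touching that vertex.\<close>
          have far: "walk ?N (t + 2 * \<delta> + (2 * \<delta> + t + R)) (\<alpha> (Suc s)) y"
          proof (cases "lev y0 z t = t")
            case True
            have "t > d y0 y" using R[OF y] by (simp add: t_def s1_def)
            then obtain t' where t': "d (\<alpha> t) (\<alpha>' t') \<le> 2 * \<delta>"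
              using slim[OF \<alpha> \<alpha>' \<beta>[OF y], of t] by auto
            have "walk {e \<in> E. \<not> crosses e (- {?p})} (2 * \<delta>) (\<alpha> t) (\<alpha>' t')"
            proof (rule walk_not_crossing[OF aV Geo_V[OF \<alpha>'] t'])
              have "x \<noteq> ?p" if "d (\<alpha> t) x \<le> 2 * \<delta>" "x \<in> V" for x
              proof
                assume "x = ?p"
                then have "t \<le> s + 2 * \<delta>"
                  using dist_triangle[OF y0V aV aV, of t s] ds[of s] that(1) dist_sym[OF aV aV, of s t]
                    Geo_dist_source[OF \<alpha>, of t] True by simp
                then show False using s by (simp add: t_def)
              qed
              then show "(\<forall>x\<in>V. d (\<alpha> t) x \<le> 2 * \<delta> \<longrightarrow> x \<in> - {?p}) \<or> (\<forall>x\<in>V. d (\<alpha> t) x \<le> 2 * \<delta> \<longrightarrow> x \<notin> - {?p})"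
                by blast
            qed
            then have conn: "walk ?N (2 * \<delta>) (\<alpha> t) (\<alpha>' t')"
            proof (rule walk_mono, intro subsetI)
              fix e assume e: "e \<in> {e \<in> E. \<not> crosses e (- {?p})}"
              then obtain x x' where "e = {x, x'}" "x \<noteq> x'" using edges by blast
              then show "e \<in> ?N" using e by (auto simp: crosses_def)
            qed
            have "d (\<alpha>' t') y \<le> d (\<alpha>' t') (\<alpha> t) + (d (\<alpha> t) y0 + d y0 y)"
              using dist_triangle[OF Geo_V[OF \<alpha>'] aV yV, of t' t] dist_triangle[OF aV y0V yV, of t] by linarith
            then have "d (\<alpha>' t') y \<le> 2 * \<delta> + t + R"
              using t' R[OF y] dist_sym[OF aV Geo_V[OF \<alpha>'], of t t'] dist_sym[OF aV y0V, of t]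
                Geo_dist_source[OF \<alpha>, of t] True by simp
            then have "walk ?N (2 * \<delta> + t + R) (\<alpha>' t') y" using walk_le[OF homeward] by blast
            moreover have "walk ?N t (\<alpha> (Suc s)) (\<alpha> t)"
              using walk_le[OF seg[OF True], of t] s by (simp add: t_def)
            ultimately show ?thesis using walk_trans[OF walk_trans[OF _ conn]] by blast
          next
            case False
            then obtain x where x: "z = Inl x" "d y0 x < t" by (cases z) auto
            have ends: "\<alpha> (d y0 x) = x" "\<alpha>' (d y x) = x" "x \<in> V"
              using Geo_vertex_end \<alpha> \<alpha>' x z by auto
            have "min (Suc s) (d y0 x) = Suc s" using s x(1) by (metis lev_simps(1))
            then have "Suc s \<le> d y0 x" by linarith
            then have "walk ?N (d y0 x - Suc s) (\<alpha> (Suc s)) x"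
              using seg[of "d y0 x"] x(1) ends(1) by simp
            then have w: "walk ?N t (\<alpha> (Suc s)) x"
              by (rule walk_le) (use x in simp)
            have "d x y \<le> R + t"
              using dist_triangle[OF ends(3) y0V yV] R[OF y] x dist_sym[OF ends(3) y0V] by simp
            then have "walk ?N (R + t) x y"
              using homeward[of "d y x"] ends by (auto intro: walk_le)
            then have "walk ?N (t + (R + t)) (\<alpha> (Suc s)) y" by (rule walk_trans[OF w])
            then show ?thesis by (rule walk_le) simp
          qed
          have near: "walk (\<E> s) (R + s1) y ?p"
          proof -
            have "edges_of (range (\<beta> y)) \<subseteq> \<E> s" using E0 Emono[of 0 s] y by auto
            then have "walk (\<E> s) (d (\<beta> y (d y0 y)) (\<beta> y 0)) (\<beta> y (d y0 y)) (\<beta> y 0)"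
              by (rule walk_mono[OF Geo_walk[OF \<beta>[OF y]]])
            then have "walk (\<E> s) (d y y0) y y0"
              using Geo_0[OF \<beta>[OF y]] Geo_vertex_end[OF \<beta>[OF y] order_refl] by simp
            then have "walk (\<E> s) R y y0" by (rule walk_le) (rule yR)
            moreover have "walk (\<E> s) (s - 0) (\<alpha> 0) (\<alpha> s)"
              by (rule walk_segment) (use below in auto)
            then have "walk (\<E> s) s1 y0 ?p"
              using Geo_0[OF \<alpha>] s by (auto intro: walk_le)
            ultimately show ?thesis by (rule walk_trans)
          qed
          have pq: "{?p, \<alpha> (Suc s)} \<in> E" using Geo_edge[OF \<alpha>] s by blast
          obtain e' where e': "e' \<in> \<E> s"
              "e' \<in> Circ (t + 2 * \<delta> + (2 * \<delta> + t + R) + (R + s1) + 1) {?p, \<alpha> (Suc s)}"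
            using vertex_circuit[OF pq far near] EE by blast
          then have "e' \<in> Circ m {?p, \<alpha> (Suc s)}"
            using Circ_mono[of "t + 2 * \<delta> + (2 * \<delta> + t + R) + (R + s1) + 1" m] by (auto simp: m_def)
          then have "{?p, \<alpha> (Suc s)} \<in> Circ m e'" using Circ_sym pq by blast
          \<comment> \<open>The circuit ties the escaping edge to an edge of stage \<open>s\<close>,
            so it belongs to the next stage after all.\<close>
          then have "?e s \<in> \<E> (Suc s)" using e'(1) unfolding ES by blast
          then show False using s by blast
        qed
        then have "z \<in> shadow y ?p" using \<alpha>' by (auto simp: shadow_def)
        moreover have "d y ?p \<le> L"
          using dist_triangle[OF yV y0V aV, of s] yR ds[of s] s by (simp add: L_def s1_def)
        ultimately show ?thesis using pZ by (simp add: candidates_def)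
      qed
      then show ?thesis by blast
    next
      case False
      then have in_E: "?e s \<in> \<E> (Suc s)" if "s \<le> s1" "lev y0 z (Suc s) = Suc s" for s
        using that by blast
      show ?thesis
      proof (cases "lev y0 z (Suc s1) = Suc s1")
        case True
        have "\<alpha> s1 \<in> candidates y Z W L z" if y: "y \<in> D" for y
        proof -
          have yV: "y \<in> V" using DV y .
          obtain \<alpha>' where \<alpha>': "Geo y z \<alpha>'" using ex_Geo yV z by blast
          have yR: "d y y0 \<le> R" using R[OF y] dist_sym[OF y0V yV] by simp
          obtain e' where e': "e' \<in> edges_of (range \<alpha>')" "e' \<in> Circ mu (?e s1)" "crosses e' {x. s1 < d y0 x}"
            using uniform_circuit[OF \<alpha> \<alpha>' True] R[OF y] by (auto simp: s1_def)
          have e1: "?e s1 \<in> \<E> (Suc s1)" using in_E[OF order_refl True] .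
          have "Circ mu (?e s1) \<subseteq> Circ m (?e s1)" by (rule Circ_mono) (simp add: m_def)
          \<comment> \<open>The edge of \<alpha> at level \<open>s1\<close> is in stage
            \<open>s1 + 1\<close>, so its partner on \<open>\<alpha>'\<close> is in stage
            \<open>s1 + 2\<close>, which is \<open>W\<close>.\<close>
          then have "e' \<in> \<E> (Suc (Suc s1))"
            using e1 e'(2) by (subst ES) blast
          then have e'W: "e' \<in> W" by (simp add: W_def)
          have "?e s1 \<in> Circ mu e'" using Circ_sym e'(2) e1 EE by blast
          then have p: "\<alpha> s1 \<in> cvert mu e'" by (auto simp: cvert_def)
          obtain u v where uv: "e' = {u, v}" "u \<in> V" "v \<in> V"
            using edges[of e'] e'(1) unfolding edges_of_def by blast
          then have E': "{u, v} \<in> E" "u \<in> range \<alpha>'" "v \<in> range \<alpha>'"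
            using e'(1) by (auto simp: edges_of_def)
          have *: "\<alpha> s1 \<in> candidates y Z W L z"
            if "e' = {a, b}" "d y b = Suc (d y a)" "d y b \<le> L" "z \<in> shadow y b" for a b
            unfolding candidates_def using e'W p that by blast
          obtain i j where "u = \<alpha>' i" "v = \<alpha>' j" using E' by blast
          then have "\<bar>int (d y u) - int (d y v)\<bar> = 1"
            using dist_edge[OF E'(1)] Geo_dist[OF \<alpha>', of i j] Geo_dist_source[OF \<alpha>', of i] Geo_dist_source[OF \<alpha>', of j]
            by simp
          moreover have "d y0 u \<le> s1 \<or> d y0 v \<le> s1"
            using e'(3) uv by (auto simp: crosses_def)
          then have "d y u \<le> R + s1 \<or> d y v \<le> R + s1"
            using dist_triangle[OF yV y0V uv(2)] dist_triangle[OF yV y0V uv(3)] yR by linarith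
          \<comment> \<open>Either end of \<open>e'\<close> may be the one nearer to
            \<open>y\<close>. As one end is at level at most \<open>R + s1\<close>, the other is at
            level at most \<open>R + s1 + 1\<close>, which is \<open>L\<close>.\<close>
          ultimately have "d y u = Suc (d y v) \<and> d y u \<le> L \<or> d y v = Suc (d y u) \<and> d y v \<le> L"
            unfolding L_def s1_def by linarith
          moreover have "z \<in> shadow y u" "z \<in> shadow y v" using \<alpha>' E' by (auto simp: shadow_def)
          ultimately show ?thesis
            using *[of u v] *[of v u] uv(1) by (auto simp: insert_commute)
        qed
        then show ?thesis by blast
      next
        case False
        then obtain x where x: "z = Inl x" "d y0 x \<le> s1" by (cases z) auto
        then have xV: "x \<in> V" and fin: "\<alpha> (d y0 x) = x" using z Geo_vertex_end \<alpha> by auto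
        have xZ: "x \<in> Z"
        proof (cases "d y0 x")
          case 0
          then show ?thesis using dist_eq_0[OF y0V xV] y0 by (simp add: Z_def)
        next
          case (Suc j)
          then have "?e j \<in> W"
            using in_E[of j] x Emono[of "Suc j" "s1 + 2"] by (auto simp: W_def)
          then show ?thesis using Suc fin by (auto simp: Z_def)
        qed
        have "x \<in> candidates y Z W L z" if y: "y \<in> D" for y
        proof -
          have yV: "y \<in> V" using DV y .
          obtain h where h: "Geo y (Inl x) h" using ex_Geo_vertex yV xV by blast
          then have "h (d y x) = x" using Geo_vertex_end by blast
          then have "x \<in> range h" by (metis rangeI)
          then have "z \<in> shadow y x" using h x by (auto simp: shadow_def)
          moreover have "d y x \<le> L"
            using dist_triangle[OF yV y0V xV] R[OF y] dist_sym[OF y0V yV] x by (simp add: L_def s1_def)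
          ultimately show ?thesis using xZ by (simp add: candidates_def)
        qed
        then show ?thesis by blast
      qed
    qed
  qed
  then show ?thesis
    using WE Zf by (intro exI[of _ Z] exI[of _ W]) (simp add: L_def)
qed

end

section \<open>Averaging over translates\<close>

text \<open>The sets are enlarged one at a time; the next one only has to avoid the \<open>N\<close>-fold
  intersections of the others.\<close>

lemma swell_closed_family:
  assumes nX: "normal_space X" and I: "finite I" and J: "finite J" "J \<subseteq> I"
    and cl: "\<And>i. i \<in> I \<Longrightarrow> closedin X (C i)"
    and N: "\<And>x. x \<in> topspace X \<Longrightarrow> card {i \<in> I. x \<in> C i} \<le> N"
  shows "\<exists>U D. (\<forall>i\<in>J. openin X (U i) \<and> C i \<subseteq> U i \<and> U i \<subseteq> D i) \<and> (\<forall>i\<in>I - J. D i = C i) \<and>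
    (\<forall>i\<in>I. closedin X (D i)) \<and> (\<forall>x\<in>topspace X. card {i \<in> I. x \<in> D i} \<le> N)"
  using J
proof (induction J rule: finite_induct)
  case empty
  show ?case using cl N by (intro exI[of _ C]) auto
next
  case (insert j J)
  then have "J \<subseteq> I" by simp
  from insert.IH[OF this] obtain U D
    where "(\<forall>i\<in>J. openin X (U i) \<and> C i \<subseteq> U i \<and> U i \<subseteq> D i) \<and> (\<forall>i\<in>I - J. D i = C i) \<and>
      (\<forall>i\<in>I. closedin X (D i)) \<and> (\<forall>x\<in>topspace X. card {i \<in> I. x \<in> D i} \<le> N)"
    by (elim exE)
  then have IH: "\<And>i. i \<in> J \<Longrightarrow> openin X (U i) \<and> C i \<subseteq> U i \<and> U i \<subseteq> D i"
      "\<And>i. i \<in> I - J \<Longrightarrow> D i = C i" "\<And>i. i \<in> I \<Longrightarrow> closedin X (D i)"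
      "\<And>x. x \<in> topspace X \<Longrightarrow> card {i \<in> I. x \<in> D i} \<le> N"
    by simp_all
  have jI: "j \<in> I" "j \<notin> J" using insert by auto
  let ?\<T> = "{T. T \<subseteq> I - {j} \<and> card T = N}"
  \<comment> \<open>The points where \<open>N\<close> of the other sets meet. Since
    \<open>C j\<close> is disjoint from it, normality gives an open set around \<open>C j\<close>
    whose closure avoids \<open>F\<close>. Intersecting with the space covers the empty family for
    \<open>N = 0\<close>.\<close>
  define F where "F = (\<Union>T\<in>?\<T>. topspace X \<inter> \<Inter>(D ` T))"
  have fin: "finite ?\<T>" by (rule finite_subset[of _ "Pow I"]) (use I in auto)
  have "closedin X (topspace X \<inter> \<Inter>(D ` T))" if "T \<in> ?\<T>" for T
  proof (cases "T = {}")
    case False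
    then have "closedin X (\<Inter>(D ` T))" using that IH(3) by (intro closedin_Inter) auto
    then show ?thesis by (intro closedin_Int) auto
  qed simp
  then have clF: "closedin X F"
    unfolding F_def using fin by (intro closedin_Union) auto
  have disj: "C j \<subseteq> topspace X - F"
  proof
    fix x assume x: "x \<in> C j"
    then have xX: "x \<in> topspace X" using closedin_subset[OF cl[OF jI(1)]] by blast
    have "x \<notin> topspace X \<inter> \<Inter>(D ` T)" if T: "T \<in> ?\<T>" for T
    proof
      assume "x \<in> topspace X \<inter> \<Inter>(D ` T)"
      then have "insert j T \<subseteq> {i \<in> I. x \<in> D i}"
        using T jI x IH(2)[of j] by auto
      then have "card (insert j T) \<le> N"
        using IH(4)[OF xX] I card_mono[of "{i \<in> I. x \<in> D i}" "insert j T"] by simp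
      moreover have "finite T" "j \<notin> T" using T finite_subset[OF _ I] by auto
      ultimately show False using T by simp
    qed
    then show "x \<in> topspace X - F" using xX by (auto simp: F_def)
  qed
  have "openin X (topspace X - F)" using clF by (simp add: closedin_def)
  then obtain O' where O': "openin X O'" "C j \<subseteq> O'" "X closure_of O' \<subseteq> topspace X - F"
    using nX[unfolded normal_space_alt, rule_format, of "C j" "topspace X - F"] cl[OF jI(1)] disj by auto
  define U' where "U' = U(j := O')"
  define D' where "D' = D(j := X closure_of O')"
  have "card {i \<in> I. x \<in> D' i} \<le> N" if x: "x \<in> topspace X" for x
  proof (cases "x \<in> X closure_of O'")
    case False
    then have "{i \<in> I. x \<in> D' i} \<subseteq> {i \<in> I. x \<in> D i}" by (auto simp: D'_def)
    then have "card {i \<in> I. x \<in> D' i} \<le> card {i \<in> I. x \<in> D i}" using I by (intro card_mono) auto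
    then show ?thesis using IH(4)[OF x] by linarith
  next
    case True
    let ?K = "{i \<in> I - {j}. x \<in> D i}"
    have "card ?K < N"
    proof (rule ccontr)
      assume "\<not> ?thesis"
      then have "N \<le> card ?K" by simp
      then obtain T where T: "T \<subseteq> ?K" "card T = N"
        by (rule obtain_subset_with_card_n)
      then have "x \<in> F" unfolding F_def using x by blast
      then show False using True O'(3) by blast
    qed
    moreover have "{i \<in> I. x \<in> D' i} \<subseteq> insert j ?K" by (auto simp: D'_def)
    then have "card {i \<in> I. x \<in> D' i} \<le> card (insert j ?K)" using I by (intro card_mono) auto
    moreover have "card (insert j ?K) \<le> Suc (card ?K)"
      by (simp add: card_insert_if I)
    ultimately show ?thesis by linarith
  qed
  moreover have "O' \<subseteq> X closure_of O'"
    using closure_of_subset[of O' X] openin_subset[OF O'(1)] by blast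
  moreover have "closedin X (X closure_of O')" by simp
  ultimately show ?case
    using IH jI O' unfolding U'_def D'_def by (intro exI[of _ "U(j := O')"] exI[of _ "D(j := X closure_of O')"]) auto
qed

text \<open>Each \<open>u i\<close> vanishes off \<open>U i\<close>, hence off \<open>D i\<close>,
  so at most \<open>N\<close> of these functions are nonzero at a point. Without swelling, the
  supports could overlap more often than the sets \<open>C i\<close>.\<close>

lemma Urysohn_family:
  assumes nX: "normal_space X" and I: "finite I"
    and cl: "\<And>i. i \<in> I \<Longrightarrow> closedin X (C i)"
    and N: "\<And>x. x \<in> topspace X \<Longrightarrow> card {i \<in> I. x \<in> C i} \<le> N"
  shows "\<exists>u. (\<forall>i\<in>I. continuous_map X euclideanreal (u i)) \<and>
    (\<forall>x\<in>topspace X. (\<forall>i\<in>I. 0 \<le> u i x \<and> (x \<in> C i \<longrightarrow> u i x = 1)) \<and> (\<Sum>i\<in>I. u i x) \<le> real N)"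
proof -
  have "\<exists>U D. (\<forall>i\<in>I. openin X (U i) \<and> C i \<subseteq> U i \<and> U i \<subseteq> D i) \<and> (\<forall>i\<in>I - I. D i = C i) \<and>
      (\<forall>i\<in>I. closedin X (D i)) \<and> (\<forall>x\<in>topspace X. card {i \<in> I. x \<in> D i} \<le> N)"
    by (rule swell_closed_family[OF nX I I order_refl]) (simp_all add: cl N)
  then obtain U D
    where "(\<forall>i\<in>I. openin X (U i) \<and> C i \<subseteq> U i \<and> U i \<subseteq> D i) \<and> (\<forall>i\<in>I - I. D i = C i) \<and>
      (\<forall>i\<in>I. closedin X (D i)) \<and> (\<forall>x\<in>topspace X. card {i \<in> I. x \<in> D i} \<le> N)"
    by (elim exE)
  then have UD: "\<And>i. i \<in> I \<Longrightarrow> openin X (U i) \<and> C i \<subseteq> U i \<and> U i \<subseteq> D i"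
      "\<And>x. x \<in> topspace X \<Longrightarrow> card {i \<in> I. x \<in> D i} \<le> N"
    by simp_all
  have "\<exists>u. continuous_map X (top_of_set {0..1::real}) u \<and> u ` (topspace X - U i) \<subseteq> {0} \<and> u ` C i \<subseteq> {1}"
    if "i \<in> I" for i
  proof -
    have "closedin X (topspace X - U i)" "disjnt (topspace X - U i) (C i)"
      using UD(1)[OF that] by (auto simp: disjnt_def)
    then show ?thesis
      using Urysohn_lemma[OF nX _ cl[OF that], of "topspace X - U i" 0 1] by (metis zero_le_one)
  qed
  then obtain u where u: "\<And>i. i \<in> I \<Longrightarrow> continuous_map X (top_of_set {0..1::real}) (u i) \<and>
      u i ` (topspace X - U i) \<subseteq> {0} \<and> u i ` C i \<subseteq> {1}"
    by metis
  have r: "u i x \<in> {0..1}" if "i \<in> I" "x \<in> topspace X" for i x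
    using u[OF that(1)] that(2) continuous_map_image_subset_topspace[of X "top_of_set {0..1}" "u i"]
    by (simp add: image_subset_iff)
  have "(\<Sum>i\<in>I. u i x) \<le> real N" if x: "x \<in> topspace X" for x
  proof -
    have "(\<Sum>i\<in>I. u i x) \<le> (\<Sum>i\<in>I. if x \<in> D i then 1 else 0)"
    proof (rule sum_mono)
      fix i assume i: "i \<in> I"
      show "u i x \<le> (if x \<in> D i then 1 else 0)"
        using r[OF i x] UD(1)[OF i] u[OF i] x by (cases "x \<in> U i") auto
    qed
    also have "\<dots> = real (card {i \<in> I. x \<in> D i})" using I by (simp add: sum.If_cases Int_def)
    finally show ?thesis using UD(2)[OF x] by simp
  qed
  moreover have "0 \<le> u i x" if "i \<in> I" "x \<in> topspace X" for i x
    using r[OF that] by simp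
  moreover have "continuous_map X euclideanreal (u i)" if "i \<in> I" for i
    using u[OF that] continuous_map_into_fulltopology by blast
  moreover have "u i x = 1" if "i \<in> I" "x \<in> C i" for i x
    using u[OF that(1)] that(2) by blast
  ultimately show ?thesis
    by (intro exI[of _ u]) auto
qed

section \<open>Iterated minima over translates\<close>

primrec words :: "'g monoid \<Rightarrow> 'g set \<Rightarrow> nat \<Rightarrow> 'g set" where
  "words G A 0 = {\<one>\<^bsub>G\<^esub>}"
| "words G A (Suc n) = {w \<otimes>\<^bsub>G\<^esub> s | w s. w \<in> words G A n \<and> s \<in> A}"

lemma finite_words: "finite A \<Longrightarrow> finite (words G A n)"
proof (induction n)
  case (Suc n)
  have "words G A (Suc n) = (\<lambda>(w, s). w \<otimes>\<^bsub>G\<^esub> s) ` (words G A n \<times> A)" by auto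
  then show ?case using Suc by (metis finite_cartesian_product finite_imageI)
qed simp

lemma words_closed: "group G \<Longrightarrow> A \<subseteq> carrier G \<Longrightarrow> words G A n \<subseteq> carrier G"
proof (induction n)
  case (Suc n)
  then show ?case by (auto intro!: monoid.m_closed[OF group.is_monoid])
next
  case 0
  then show ?case by (simp add: group.is_monoid)
qed

lemma continuous_map_Min:
  assumes "finite A" "A \<noteq> {}" "\<And>a. a \<in> A \<Longrightarrow> continuous_map X euclideanreal (h a)"
  shows "continuous_map X euclideanreal (\<lambda>x. Min ((\<lambda>a. h a x) ` A))"
  using assms
proof (induction A rule: finite_ne_induct)
  case (insert a A)
  then have "continuous_map X euclideanreal (\<lambda>x. min (h a x) (Min ((\<lambda>a. h a x) ` A)))"
    by (intro continuous_map_real_min) auto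
  then show ?case using insert by simp
qed simp

lemma group_action_one:
  assumes "group_action G V \<phi>" "x \<in> V" shows "\<phi> \<one>\<^bsub>G\<^esub> x = x"
  using group_action.id_eq_one[OF assms(1)] assms(2) by (metis restrict_apply')

lemma group_action_group: "group_action G V \<phi> \<Longrightarrow> group G"
  using group_action.group_hom group_hom.axioms(1) by blast

lemma group_action_closed: "group_action G V \<phi> \<Longrightarrow> g \<in> carrier G \<Longrightarrow> x \<in> V \<Longrightarrow> \<phi> g x \<in> V"
  using group_action.element_image by metis

lemma group_action_inv:
  assumes "group_action G V \<phi>" "g \<in> carrier G" "x \<in> V"
  shows "\<phi> (inv\<^bsub>G\<^esub> g) (\<phi> g x) = x" "\<phi> g (\<phi> (inv\<^bsub>G\<^esub> g) x) = x"
proof -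
  note G = group_action_group[OF assms(1)]
  have ig: "inv\<^bsub>G\<^esub> g \<in> carrier G" using group.inv_closed[OF G assms(2)] .
  show "\<phi> (inv\<^bsub>G\<^esub> g) (\<phi> g x) = x" "\<phi> g (\<phi> (inv\<^bsub>G\<^esub> g) x) = x"
    using group_action.composition_rule[OF assms(1,3), of "inv\<^bsub>G\<^esub> g" g]
      group_action.composition_rule[OF assms(1,3), of g "inv\<^bsub>G\<^esub> g"]
      group_action_one[OF assms(1,3)] ig assms(2) group.l_inv[OF G assms(2)] group.r_inv[OF G assms(2)]
    by simp_all
qed

lemma sum_telescope2:
  fixes h :: "nat \<Rightarrow> real"
  shows "(\<Sum>j=1..N. h (j - 1) - h (Suc j)) = h 0 + h 1 - h N - h (Suc N)"
  by (induction N) auto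

text \<open>With a common minorant \<open>m\<close>, the difference is at most
  \<open>(p - m) + (q - m)\<close>, and both summands have mass \<open>1 - sum m\<close>.\<close>

lemma l1_dist_common_part:
  fixes p q m :: "'a \<Rightarrow> real"
  assumes \<Omega>: "finite \<Omega>'" "\<Omega> \<subseteq> \<Omega>'" and le: "\<And>v. v \<in> \<Omega>' \<Longrightarrow> m v \<le> p v" "\<And>v. v \<in> \<Omega>' \<Longrightarrow> m v \<le> q v"
    and s: "sum p \<Omega>' = 1" "sum q \<Omega>' = 1"
  shows "(\<Sum>v\<in>\<Omega>. \<bar>p v - q v\<bar>) \<le> 2 * (1 - sum m \<Omega>')"
proof -
  have "(\<Sum>v\<in>\<Omega>. \<bar>p v - q v\<bar>) \<le> (\<Sum>v\<in>\<Omega>'. \<bar>p v - q v\<bar>)"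
    using \<Omega> by (intro sum_mono2) auto
  also have "\<dots> \<le> (\<Sum>v\<in>\<Omega>'. (p v - m v) + (q v - m v))"
    using le by (intro sum_mono) (auto simp: abs_le_iff)
  also have "\<dots> = 2 * (1 - sum m \<Omega>')"
    using s by (simp add: sum.distrib sum_subtractf flip: sum_distrib_left)
  finally show ?thesis .
qed

text \<open>Averaging the normalizations of \<open>g 0 \<ge> g 1 \<ge> \<dots> \<ge> g (Suc N)\<close>, where \<open>g (Suc j)\<close> is the minimum of
  the translates of \<open>g j\<close>: a translate of \<open>g j\<close> lies between \<open>g (Suc j)\<close> and \<open>g (j - 1)\<close>, and the
  total masses stay in \<open>[1, C]\<close>, so that the errors form a telescoping sum.\<close>

lemma almost_equivariant_measures:
  fixes f :: "'x \<Rightarrow> 'v \<Rightarrow> real"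
  assumes \<phi>: "group_action G V \<phi>" and \<theta>: "topological_action G X \<theta>"
    and A: "finite A" "A \<subseteq> carrier G" "\<one>\<^bsub>G\<^esub> \<in> A" "\<And>s. s \<in> A \<Longrightarrow> inv\<^bsub>G\<^esub> s \<in> A"
    and K: "finite K" "K \<subseteq> V"
    and cont: "\<And>v. v \<in> V \<Longrightarrow> continuous_map X euclideanreal (\<lambda>x. f x v)"
    and f0: "\<And>x v. x \<in> topspace X \<Longrightarrow> v \<in> V \<Longrightarrow> 0 \<le> f x v"
    and fK: "\<And>x v. x \<in> topspace X \<Longrightarrow> v \<in> V - K \<Longrightarrow> f x v = 0"
    and fC: "\<And>x. x \<in> topspace X \<Longrightarrow> (\<Sum>v\<in>K. f x v) \<le> C"
    and N: "0 < N"
    and core: "\<And>x. x \<in> topspace X \<Longrightarrow> \<exists>p\<in>V. \<forall>w\<in>words G A (Suc N). 1 \<le> f (\<theta> w x) (\<phi> w p)"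
  shows "\<exists>\<zeta>. (\<forall>v\<in>V. continuous_map X euclideanreal (\<lambda>x. \<zeta> x v)) \<and>
    (\<forall>x\<in>topspace X. (\<forall>v\<in>V. 0 \<le> \<zeta> x v) \<and> (\<forall>v\<in>V - K. \<zeta> x v = 0) \<and> (\<Sum>v\<in>K. \<zeta> x v) = 1 \<and>
      (\<forall>s\<in>A. \<forall>\<Omega>. finite \<Omega> \<and> \<Omega> \<subseteq> V \<longrightarrow>
        (\<Sum>v\<in>\<Omega>. \<bar>\<zeta> x (\<phi> (inv\<^bsub>G\<^esub> s) v) - \<zeta> (\<theta> s x) v\<bar>) \<le> 4 * ln C / N))"
proof -
  have \<theta>': "group_action G (topspace X) \<theta>" and \<theta>c: "\<And>s. s \<in> carrier G \<Longrightarrow> continuous_map X X (\<theta> s)"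
    using \<theta> by (auto simp: topological_action_def homeomorphic_imp_continuous_map)
  note G = group_action_group[OF \<phi>]
  have \<theta>X: "\<theta> s x \<in> topspace X" if "s \<in> A" "x \<in> topspace X" for s x
    using group_action_closed[OF \<theta>'] that A(2) by blast
  have \<phi>V: "\<phi> s v \<in> V" if "s \<in> A" "v \<in> V" for s v
    using group_action_closed[OF \<phi>] that A(2) by blast
  have inv\<theta>: "\<theta> (inv\<^bsub>G\<^esub> s) (\<theta> s x) = x" if "s \<in> A" "x \<in> topspace X" for s x
    using group_action_inv[OF \<theta>'] that A(2) by blast
  have inv\<phi>: "\<phi> (inv\<^bsub>G\<^esub> s) (\<phi> s v) = v" "\<phi> s (\<phi> (inv\<^bsub>G\<^esub> s) v) = v" if "s \<in> A" "v \<in> V" for s v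
    using group_action_inv[OF \<phi>] that A(2) by blast+
  have Ane: "A \<noteq> {}" using A(3) by blast
  \<comment> \<open>Unfolded, \<open>g j x v\<close> is the minimum of
    \<open>f (\<theta> w x) (\<phi> w v)\<close> over words \<open>w\<close> of length
    \<open>j\<close>. The newest letter acts first, which is why \<open>words\<close> multiplies on
    the right.\<close>
  define g where "g = rec_nat f (\<lambda>_ h x v. Min ((\<lambda>s. h (\<theta> s x) (\<phi> s v)) ` A))"
  have g0: "g 0 = f" and gS: "\<And>j x v. g (Suc j) x v = Min ((\<lambda>s. g j (\<theta> s x) (\<phi> s v)) ` A)"
    by (simp_all add: g_def)
  have g_le: "g (Suc j) x v \<le> g j (\<theta> s x) (\<phi> s v)" if "s \<in> A" for j x v s
    unfolding gS using A(1) that by simp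
  have g_dec: "g (Suc j) x v \<le> g j x v" if "x \<in> topspace X" "v \<in> V" for j x v
    using g_le[OF A(3), of j x v] group_action_one[OF \<theta>' that(1)] group_action_one[OF \<phi> that(2)] by simp
  have g_nonneg: "0 \<le> g j x v" if "x \<in> topspace X" "v \<in> V" for j x v
    using that
  proof (induction j arbitrary: x v)
    case (Suc j)
    then show ?case unfolding gS using A(1) Ane \<theta>X \<phi>V by (subst Min_ge_iff) auto
  qed (simp add: g0 f0)
  have g_le_f: "g j x v \<le> f x v" if "x \<in> topspace X" "v \<in> V" for j x v
    by (induction j) (use g0 g_dec[OF that] order_trans in \<open>auto\<close>)
  have g_supp: "g j x v = 0" if "x \<in> topspace X" "v \<in> V - K" for j x v
    using g_le_f[of x v j] g_nonneg[of x v j] fK[OF that] that by auto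
  have g_cont: "continuous_map X euclideanreal (\<lambda>x. g j x v)" if "v \<in> V" for j v
    using that
  proof (induction j arbitrary: v)
    case (Suc j)
    show ?case
      unfolding gS
    proof (rule continuous_map_Min[OF A(1) Ane])
      fix s assume s: "s \<in> A"
      have "continuous_map X euclideanreal ((\<lambda>x. g j x (\<phi> s v)) \<circ> \<theta> s)"
        using s A(2) by (intro continuous_map_compose[OF \<theta>c Suc.IH] \<phi>V[OF s Suc.prems]) auto
      then show "continuous_map X euclideanreal (\<lambda>x. g j (\<theta> s x) (\<phi> s v))" by (simp add: o_def)
    qed
  qed (simp add: g0 cont)
  have g_core: "1 \<le> g j x p"
    if "x \<in> topspace X" "p \<in> V" "\<forall>w\<in>words G A j. 1 \<le> f (\<theta> w x) (\<phi> w p)" for j x p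
    using that
  proof (induction j arbitrary: x p)
    case 0
    then show ?case using group_action_one[OF \<theta>'] group_action_one[OF \<phi>] by (simp add: g0)
  next
    case (Suc j)
    have "1 \<le> g j (\<theta> s x) (\<phi> s p)" if s: "s \<in> A" for s
    proof (rule Suc.IH)
      show "\<forall>w\<in>words G A j. 1 \<le> f (\<theta> w (\<theta> s x)) (\<phi> w (\<phi> s p))"
      proof
        fix w assume w: "w \<in> words G A j"
        then have wG: "w \<in> carrier G" using words_closed[OF G A(2)] by blast
        have "w \<otimes>\<^bsub>G\<^esub> s \<in> words G A (Suc j)" using w s by auto
        then have "1 \<le> f (\<theta> (w \<otimes>\<^bsub>G\<^esub> s) x) (\<phi> (w \<otimes>\<^bsub>G\<^esub> s) p)" using Suc.prems(3) by blast
        then show "1 \<le> f (\<theta> w (\<theta> s x)) (\<phi> w (\<phi> s p))"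
          using group_action.composition_rule[OF \<theta>' Suc.prems(1) wG] s A(2)
            group_action.composition_rule[OF \<phi> Suc.prems(2) wG] by auto
      qed
    qed (use Suc.prems \<theta>X \<phi>V s in auto)
    then show ?case unfolding gS using A(1) Ane by simp
  qed
  define a where "a j x = (\<Sum>v\<in>K. g j x v)" for j x
  have a_dec: "a (Suc j) x \<le> a j x" if "x \<in> topspace X" for j x
    unfolding a_def using g_dec that K by (intro sum_mono) auto
  have a_mono: "a j x \<le> a i x" if "x \<in> topspace X" "i \<le> j" for i j x
    using that(2) by (induction rule: dec_induct) (use a_dec[OF that(1)] order_trans in blast)+
  have a_C: "a j x \<le> C" if "x \<in> topspace X" for j x
    using a_mono[OF that, of 0 j] fC[OF that] by (simp add: a_def g0)
  have a_1: "1 \<le> a j x" if x: "x \<in> topspace X" and j: "j \<le> Suc N" for j x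
  proof -
    obtain p where p: "p \<in> V" "\<forall>w\<in>words G A (Suc N). 1 \<le> f (\<theta> w x) (\<phi> w p)"
      using core[OF x] by blast
    have "1 \<le> g (Suc N) x p" by (rule g_core[OF x p])
    moreover have "p \<in> K" using calculation g_supp[OF x, of p] p(1) by fastforce
    moreover have "g (Suc N) x p \<le> a (Suc N) x"
      unfolding a_def using calculation(2) K g_nonneg x by (intro member_le_sum) auto
    ultimately show ?thesis using a_mono[OF x j] by linarith
  qed
  \<comment> \<open>The average starts at 1 because the comparison for \<open>j\<close> involves
    \<open>j - 1\<close>.\<close>
  define \<zeta> where "\<zeta> x v = (\<Sum>j=1..N. g j x v / a j x) / N" for x v
  have step: "(\<Sum>v\<in>\<Omega>. \<bar>g j x (\<phi> (inv\<^bsub>G\<^esub> s) v) / a j x - g j (\<theta> s x) v / a j (\<theta> s x)\<bar>)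
      \<le> 2 * (ln (a (j - 1) (\<theta> s x)) - ln (a (Suc j) (\<theta> s x)))"
    if x: "x \<in> topspace X" and s: "s \<in> A" and \<Omega>: "finite \<Omega>" "\<Omega> \<subseteq> V" and j: "1 \<le> j" "j \<le> N" for x s \<Omega> j
  proof -
    let ?y = "\<theta> s x" and ?\<sigma> = "\<phi> (inv\<^bsub>G\<^esub> s)"
    have y: "?y \<in> topspace X" using \<theta>X s x by blast
    have sG: "s \<in> carrier G" using s A(2) by blast
    define \<Omega>' where "\<Omega>' = \<Omega> \<union> K \<union> \<phi> s ` K"
    have \<Omega>': "finite \<Omega>'" "\<Omega>' \<subseteq> V" "\<Omega> \<subseteq> \<Omega>'"
      using \<Omega> K \<phi>V[OF s] by (auto simp: \<Omega>'_def)
    have pos: "1 \<le> a j x" "1 \<le> a j ?y" "1 \<le> a (Suc j) ?y" "1 \<le> a (j - 1) ?y"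
      using a_1 x y j by auto
    have sum_y: "(\<Sum>v\<in>\<Omega>'. g i ?y v) = a i ?y" for i
      unfolding a_def using \<Omega>' g_supp[OF y] by (intro sum.mono_neutral_right) (auto simp: \<Omega>'_def)
    have inj: "inj_on (\<phi> s) K"
      by (rule inj_on_inverseI[of _ "?\<sigma>"]) (use inv\<phi>(1)[OF s] K in auto)
    have "(\<Sum>v\<in>\<Omega>'. g j x (?\<sigma> v)) = (\<Sum>v\<in>\<phi> s ` K. g j x (?\<sigma> v))"
    proof (intro sum.mono_neutral_right ballI)
      fix v assume v: "v \<in> \<Omega>' - \<phi> s ` K"
      then have "v \<in> V" using \<Omega>' by blast
      then have "?\<sigma> v \<in> V" "?\<sigma> v \<notin> K"
        using v \<phi>V[OF A(4)[OF s]] inv\<phi>(2)[OF s] by (auto simp: image_iff)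
      then show "g j x (?\<sigma> v) = 0" using g_supp[OF x] by blast
    qed (use \<Omega>' in \<open>auto simp: \<Omega>'_def\<close>)
    also have "\<dots> = a j x"
      unfolding a_def using inv\<phi>(1)[OF s] K by (subst sum.reindex[OF inj]) (auto intro!: sum.cong)
    finally have sum_x: "(\<Sum>v\<in>\<Omega>'. g j x (?\<sigma> v)) = a j x" .
    \<comment> \<open>A translate of \<open>g j x\<close> is dominated by \<open>g (j - 1)\<close>
      at \<open>?y\<close>, one step earlier, and so is its mass.\<close>
    have ajx: "a j x \<le> a (j - 1) ?y"
    proof -
      have "a j x \<le> (\<Sum>v\<in>K. g (j - 1) ?y (\<phi> s v))"
        unfolding a_def using g_le[OF s, of "j - 1"] j by (intro sum_mono) auto
      also have "\<dots> = (\<Sum>v\<in>\<phi> s ` K. g (j - 1) ?y v)"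
        by (simp add: sum.reindex[OF inj])
      also have "\<dots> \<le> (\<Sum>v\<in>\<Omega>'. g (j - 1) ?y v)"
        using \<Omega>' g_nonneg[OF y] by (intro sum_mono2) (auto simp: \<Omega>'_def)
      finally show ?thesis using sum_y by simp
    qed
    \<comment> \<open>A common minorant of both measures: the numerators dominate
      \<open>g (Suc j) ?y\<close> because \<open>A\<close> contains the inverse of \<open>s\<close>
      and the unit, and the denominators are at most \<open>a (j - 1) ?y\<close>.\<close>
    let ?m = "\<lambda>v. g (Suc j) ?y v / a (j - 1) ?y"
    have "(\<Sum>v\<in>\<Omega>. \<bar>g j x (?\<sigma> v) / a j x - g j ?y v / a j ?y\<bar>) \<le> 2 * (1 - sum ?m \<Omega>')"
    proof (rule l1_dist_common_part[OF \<Omega>'(1,3)])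
      fix v assume "v \<in> \<Omega>'"
      then have v: "v \<in> V" using \<Omega>' by blast
      have "g (Suc j) ?y v \<le> g j (\<theta> (inv\<^bsub>G\<^esub> s) ?y) (?\<sigma> v)" by (rule g_le[OF A(4)[OF s]])
      then have "g (Suc j) ?y v \<le> g j x (?\<sigma> v)" using inv\<theta>[OF s x] by simp
      then show "?m v \<le> g j x (?\<sigma> v) / a j x"
        using ajx pos g_nonneg[OF y v, of "Suc j"] by (intro frac_le) auto
      have "a j ?y \<le> a (j - 1) ?y" by (rule a_mono[OF y]) simp
      then show "?m v \<le> g j ?y v / a j ?y"
        using pos g_nonneg[OF y v] g_dec[OF y v, of j] by (intro frac_le) auto
    next
      show "(\<Sum>v\<in>\<Omega>'. g j x (?\<sigma> v) / a j x) = 1" "(\<Sum>v\<in>\<Omega>'. g j ?y v / a j ?y) = 1"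
        using sum_x sum_y[of j] pos by (simp_all flip: sum_divide_distrib)
    qed
    also have "sum ?m \<Omega>' = a (Suc j) ?y / a (j - 1) ?y"
      using sum_y by (simp flip: sum_divide_distrib)
    \<comment> \<open>The inequality \<open>1 - q \<le> - ln q\<close> yields differences of
      logarithms with indices two apart. Their sum leaves two terms at each end, which gives the
      factor 4 in the final bound.\<close>
    also have "1 - a (Suc j) ?y / a (j - 1) ?y \<le> ln (a (j - 1) ?y) - ln (a (Suc j) ?y)"
      using ln_le_minus_one[of "a (Suc j) ?y / a (j - 1) ?y"] pos by (simp add: ln_div)
    finally show ?thesis by simp
  qed
  have total: "(\<Sum>v\<in>\<Omega>. \<bar>\<zeta> x (\<phi> (inv\<^bsub>G\<^esub> s) v) - \<zeta> (\<theta> s x) v\<bar>) \<le> 4 * ln C / N"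
    if x: "x \<in> topspace X" and s: "s \<in> A" and \<Omega>: "finite \<Omega>" "\<Omega> \<subseteq> V" for x s \<Omega>
  proof -
    let ?y = "\<theta> s x" and ?\<sigma> = "\<phi> (inv\<^bsub>G\<^esub> s)"
    have y: "?y \<in> topspace X" using \<theta>X s x by blast
    let ?t = "\<lambda>j v. \<bar>g j x (?\<sigma> v) / a j x - g j ?y v / a j ?y\<bar>"
    have "\<bar>\<zeta> x (?\<sigma> v) - \<zeta> ?y v\<bar> \<le> (\<Sum>j=1..N. ?t j v) / N" for v
    proof -
      have "\<zeta> x (?\<sigma> v) - \<zeta> ?y v = (\<Sum>j=1..N. g j x (?\<sigma> v) / a j x - g j ?y v / a j ?y) / N"
        by (simp add: \<zeta>_def sum_subtractf diff_divide_distrib)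
      then show ?thesis using N by (simp add: divide_right_mono)
    qed
    then have "(\<Sum>v\<in>\<Omega>. \<bar>\<zeta> x (?\<sigma> v) - \<zeta> ?y v\<bar>) \<le> (\<Sum>v\<in>\<Omega>. (\<Sum>j=1..N. ?t j v) / N)"
      by (intro sum_mono)
    also have "\<dots> = (\<Sum>j=1..N. \<Sum>v\<in>\<Omega>. ?t j v) / N"
      by (subst sum.swap) (simp flip: sum_divide_distrib)
    also have "\<dots> \<le> (\<Sum>j=1..N. 2 * (ln (a (j - 1) ?y) - ln (a (Suc j) ?y))) / N"
      using step[OF x s \<Omega>] by (intro divide_right_mono sum_mono) auto
    also have "\<dots> = 2 * (ln (a 0 ?y) + ln (a 1 ?y) - ln (a N ?y) - ln (a (Suc N) ?y)) / N"
      unfolding sum_distrib_left[symmetric] sum_telescope2[of "\<lambda>j. ln (a j ?y)" N] ..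
    also have "\<dots> \<le> 2 * (ln C + ln C) / N"
    proof -
      have "ln (a i ?y) \<le> ln C" "0 \<le> ln (a i ?y)" if "i \<le> Suc N" for i
        using a_1[OF y that] a_C[OF y, of i] by auto
      from this[of 0] this[of 1] this[of N] this[of "Suc N"] show ?thesis
        by (intro divide_right_mono mult_left_mono) linarith+
    qed
    finally show ?thesis by simp
  qed
  have "continuous_map X euclideanreal (\<lambda>x. \<zeta> x v)" if v: "v \<in> V" for v
    unfolding \<zeta>_def
  proof (intro continuous_map_real_divide continuous_map_sum)
    fix j assume j: "j \<in> {1..N}"
    show "continuous_map X euclideanreal (\<lambda>x. g j x v)" by (rule g_cont[OF v])
    show "continuous_map X euclideanreal (\<lambda>x. a j x)"
      unfolding a_def using g_cont K by (intro continuous_map_sum) auto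
    show "a j x \<noteq> 0" if "x \<in> topspace X" for x using a_1[OF that, of j] j by auto
  qed (use N in auto)
  moreover have "0 \<le> \<zeta> x v" if "x \<in> topspace X" "v \<in> V" for x v
    unfolding \<zeta>_def a_def using g_nonneg that K by (intro divide_nonneg_nonneg sum_nonneg) auto
  moreover have "\<zeta> x v = 0" if "x \<in> topspace X" "v \<in> V - K" for x v
    unfolding \<zeta>_def using g_supp[OF that] by simp
  moreover have "(\<Sum>v\<in>K. \<zeta> x v) = 1" if x: "x \<in> topspace X" for x
  proof -
    have "(\<Sum>v\<in>K. \<zeta> x v) = (\<Sum>j=1..N. (\<Sum>v\<in>K. g j x v) / a j x) / N"
      unfolding \<zeta>_def sum_divide_distrib[symmetric] by (subst sum.swap) (simp add: sum_divide_distrib)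
    also have "\<dots> = (\<Sum>j=1..N. 1) / N"
    proof -
      have "(\<Sum>v\<in>K. g j x v) / a j x = 1" if "j \<in> {1..N}" for j
        using a_1[OF x, of j] that by (simp flip: a_def)
      then have "(\<Sum>j=1..N. (\<Sum>v\<in>K. g j x v) / a j x) = (\<Sum>j=1..N. 1)" by (rule sum.cong[OF refl])
      then show ?thesis by (rule arg_cong)
    qed
    finally show ?thesis using N by simp
  qed
  ultimately show ?thesis
    using total by (intro exI[of _ \<zeta>]) blast
qed

section \<open>Transport from vertex stabilizers\<close>

lemma continuous_map_Prob_iff:
  "continuous_map X (Prob_topology G) \<mu> \<longleftrightarrow>
    (\<forall>x\<in>topspace X. \<mu> x \<in> Prob G) \<and> (\<forall>t\<in>carrier G. continuous_map X euclideanreal (\<lambda>x. \<mu> x t))"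
  unfolding Prob_topology_def continuous_map_in_subtopology continuous_map_componentwise
  by (auto simp: Prob_def)

lemma Prob_nonneg: "\<mu> \<in> Prob G \<Longrightarrow> t \<in> carrier G \<Longrightarrow> 0 \<le> \<mu> t"
  by (simp add: Prob_def)

lemma Prob_has_sum: "\<mu> \<in> Prob G \<Longrightarrow> (\<mu> has_sum 1) (carrier G)"
  by (simp add: Prob_def)

lemma bij_betw_mult_left:
  assumes G: "group G" and a: "a \<in> carrier G"
  shows "bij_betw (\<lambda>g. a \<otimes>\<^bsub>G\<^esub> g) (carrier G) (carrier G)"
proof -
  interpret group G by fact
  show ?thesis
    using a by (intro bij_betw_byWitness[where f' = "\<lambda>g. inv\<^bsub>G\<^esub> a \<otimes>\<^bsub>G\<^esub> g"])
      (auto simp flip: m_assoc)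
qed

lemma has_sum_left_coset:
  fixes h :: "'g \<Rightarrow> real"
  assumes G: "group G" and a: "a \<in> carrier G" and H: "H \<subseteq> carrier G" and h: "(h has_sum c) H"
  shows "((\<lambda>g. if a \<otimes>\<^bsub>G\<^esub> g \<in> H then h (a \<otimes>\<^bsub>G\<^esub> g) else 0) has_sum c) (carrier G)"
proof -
  let ?k = "\<lambda>g. if g \<in> H then h g else 0"
  have "(?k has_sum c) (carrier G)"
    using h H by (subst has_sum_cong_neutral[where S = H and f = h, symmetric]) auto
  then show ?thesis
    using has_sum_reindex_bij_betw[OF bij_betw_mult_left[OF G a], of ?k c] by simp
qed

lemma translate_Prob:
  assumes G: "group G" and s: "s \<in> carrier G" and \<mu>: "\<mu> \<in> Prob G"
  shows "translate G s \<mu> \<in> Prob G"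
proof -
  interpret group G by fact
  have "((\<lambda>g. \<mu> (inv\<^bsub>G\<^esub> s \<otimes>\<^bsub>G\<^esub> g)) has_sum 1) (carrier G)"
    using has_sum_reindex_bij_betw[OF bij_betw_mult_left[OF G inv_closed[OF s]], of \<mu> 1] Prob_has_sum[OF \<mu>]
    by simp
  then have "(translate G s \<mu> has_sum 1) (carrier G)"
    by (rule has_sum_cong[THEN iffD1, rotated]) (simp add: translate_def)
  then show ?thesis
    using \<mu> s by (auto simp: Prob_def translate_def)
qed

lemma l1_summable:
  assumes "\<mu> \<in> Prob G" "\<nu> \<in> Prob G"
  shows "(\<lambda>t. \<bar>\<mu> t - \<nu> t\<bar>) summable_on carrier G"
proof -
  have "((\<lambda>t. \<mu> t + - 1 * \<nu> t) has_sum 1 + - 1 * 1) (carrier G)"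
    using assms by (intro has_sum_add has_sum_cmult_right Prob_has_sum)
  then have "(\<lambda>t. \<mu> t - \<nu> t) summable_on carrier G"
    unfolding summable_on_def by auto
  from summable_on_iff_abs_summable_on_real[THEN iffD1, OF this] show ?thesis by simp
qed

lemma orbit_translate:
  assumes \<phi>: "group_action G V \<phi>" and s: "s \<in> carrier G" and v: "v \<in> V"
  shows "orbit G \<phi> (\<phi> s v) = orbit G \<phi> v"
proof -
  interpret group G using group_action_group[OF \<phi>] .
  have c: "\<phi> (g \<otimes>\<^bsub>G\<^esub> h) v = \<phi> g (\<phi> h v)" if "g \<in> carrier G" "h \<in> carrier G" for g h
    using group_action.composition_rule[OF \<phi> v that] .
  show ?thesis
  proof (intro equalityI subsetI)
    fix w assume "w \<in> orbit G \<phi> (\<phi> s v)"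
    then obtain g where g: "g \<in> carrier G" "w = \<phi> g (\<phi> s v)" by (auto simp: orbit_def)
    then have "w = \<phi> (g \<otimes>\<^bsub>G\<^esub> s) v" using c[OF g(1) s] by simp
    then show "w \<in> orbit G \<phi> v" using g(1) s unfolding orbit_def by blast
  next
    fix w assume "w \<in> orbit G \<phi> v"
    then obtain g where g: "g \<in> carrier G" "w = \<phi> g v" by (auto simp: orbit_def)
    have "w = \<phi> (g \<otimes>\<^bsub>G\<^esub> inv\<^bsub>G\<^esub> s \<otimes>\<^bsub>G\<^esub> s) v" using g s by (simp add: m_assoc)
    then have "w = \<phi> (g \<otimes>\<^bsub>G\<^esub> inv\<^bsub>G\<^esub> s) (\<phi> s v)" using c[of "g \<otimes>\<^bsub>G\<^esub> inv\<^bsub>G\<^esub> s" s] g s by simp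
    then show "w \<in> orbit G \<phi> (\<phi> s v)" using g s unfolding orbit_def by blast
  qed
qed

text \<open>Transport measures from the stabilizer of a representative of each orbit: with
  \<open>\<sigma> v\<close> moving the representative to \<open>v\<close>, the element \<open>\<sigma> (\<phi> s v)\<inverse> s \<sigma> v\<close> stabilizes it.\<close>

lemma stabilizer_measures:
  assumes \<phi>: "group_action G V \<phi>" and \<psi>: "topological_action G Y \<psi>"
    and am: "\<And>x. x \<in> V \<Longrightarrow> amenable_action (G\<lparr>carrier := stabilizer G \<phi> x\<rparr>) Y \<psi>"
    and W: "finite W" "W \<subseteq> V" and F: "finite F" "F \<subseteq> carrier G" and \<epsilon>: "0 < \<epsilon>"
  shows "\<exists>m. (\<forall>v\<in>V. continuous_map Y (Prob_topology G) (m v)) \<and>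
    (\<forall>v\<in>W. \<forall>s\<in>F. \<forall>y\<in>topspace Y. l1_dist G (translate G s (m v y)) (m (\<phi> s v) (\<psi> s y)) \<le> \<epsilon>)"
proof -
  note G = group_action_group[OF \<phi>]
  interpret group G by (rule G)
  have \<psi>': "group_action G (topspace Y) \<psi>" and \<psi>c: "\<And>s. s \<in> carrier G \<Longrightarrow> continuous_map Y Y (\<psi> s)"
    using \<psi> by (auto simp: topological_action_def homeomorphic_imp_continuous_map)
  let ?St = "stabilizer G \<phi>"
  let ?H = "\<lambda>u. G\<lparr>carrier := ?St u\<rparr>"
  \<comment> \<open>The choice is made from the orbit as a set, so \<open>r\<close> is constant on
    orbits.\<close>
  define r where "r v = (SOME u. u \<in> orbit G \<phi> v)" for v
  have r_orb: "r v \<in> orbit G \<phi> v" if "v \<in> V" for v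
    unfolding r_def using group_action.orbit_refl[OF \<phi> that] by (rule someI)
  have rV: "r v \<in> V" if "v \<in> V" for v
    using r_orb[OF that] group_action_closed[OF \<phi> _ that] by (auto simp: orbit_def)
  have r_trans: "r (\<phi> s v) = r v" if "s \<in> carrier G" "v \<in> V" for s v
    unfolding r_def orbit_translate[OF \<phi> that] ..
  have "\<exists>g\<in>carrier G. \<phi> g (r v) = v" if v: "v \<in> V" for v
  proof -
    have "v \<in> orbit G \<phi> (r v)" using group_action.orbit_sym[OF \<phi> v rV[OF v] r_orb[OF v]] .
    then obtain g where "g \<in> carrier G" "\<phi> g (r v) = v" by (smt (verit) orbit_def mem_Collect_eq)
    then show ?thesis by blast
  qed
  then obtain \<sigma> where \<sigma>: "\<And>v. v \<in> V \<Longrightarrow> \<sigma> v \<in> carrier G" "\<And>v. v \<in> V \<Longrightarrow> \<phi> (\<sigma> v) (r v) = v"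
    by metis
  define t where "t s v = inv\<^bsub>G\<^esub> (\<sigma> (\<phi> s v)) \<otimes>\<^bsub>G\<^esub> (s \<otimes>\<^bsub>G\<^esub> \<sigma> v)" for s v
  have t_stab: "t s v \<in> ?St (r v)" and sv: "\<phi> s v \<in> V" if s: "s \<in> carrier G" and v: "v \<in> V" for s v
  proof -
    show sv: "\<phi> s v \<in> V" using group_action_closed[OF \<phi> s v] .
    note sg = \<sigma>[OF v] \<sigma>[OF sv]
    have "\<phi> (t s v) (r v) = \<phi> (inv\<^bsub>G\<^esub> (\<sigma> (\<phi> s v))) (\<phi> s v)"
      unfolding t_def using s v sg rV[OF v] by (simp add: group_action.composition_rule[OF \<phi> rV[OF v]])
    also have "\<phi> s v = \<phi> (\<sigma> (\<phi> s v)) (r v)" using sg(4) r_trans[OF s v] by simp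
    also have "\<phi> (inv\<^bsub>G\<^esub> (\<sigma> (\<phi> (\<sigma> (\<phi> s v)) (r v)))) (\<phi> (\<sigma> (\<phi> s v)) (r v)) = r v"
      using group_action_inv(1)[OF \<phi> sg(3) rV[OF v]] sg(4) r_trans[OF s v] by simp
    finally show "t s v \<in> ?St (r v)"
      using s sg by (simp add: stabilizer_def t_def)
  qed
  \<comment> \<open>The finitely many stabilizer elements \<open>t s v\<close> for which the
    measures at the representative \<open>u\<close> must be almost invariant.\<close>
  define T where "T u = (\<lambda>(s, v). t s v) ` {(s, v). s \<in> F \<and> v \<in> W \<and> r v = u}" for u
  have Tfin: "finite (T u)" for u
  proof -
    have "finite {(s, v). s \<in> F \<and> v \<in> W \<and> r v = u}"
      by (rule finite_subset[of _ "F \<times> W"]) (use F W in auto)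
    then show ?thesis by (simp add: T_def)
  qed
  have Tsub: "T u \<subseteq> ?St u" for u
    using t_stab F W by (auto simp: T_def)
  have "\<exists>\<nu>. continuous_map Y (Prob_topology (?H u)) \<nu> \<and>
      (\<forall>t\<in>T u. \<forall>y\<in>topspace Y. l1_dist (?H u) (translate (?H u) t (\<nu> y)) (\<nu> (\<psi> t y)) \<le> \<epsilon>)"
    if "u \<in> V" for u
    using am[OF that] Tfin[of u] Tsub[of u] \<epsilon> unfolding amenable_action_def by simp
  then obtain \<nu> where \<nu>: "\<And>u. u \<in> V \<Longrightarrow> continuous_map Y (Prob_topology (?H u)) (\<nu> u)"
      "\<And>u t y. u \<in> V \<Longrightarrow> t \<in> T u \<Longrightarrow> y \<in> topspace Y \<Longrightarrow>
        l1_dist (?H u) (translate (?H u) t (\<nu> u y)) (\<nu> u (\<psi> t y)) \<le> \<epsilon>"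
    by metis
  have \<nu>P: "\<nu> u y \<in> Prob (?H u)" if "u \<in> V" "y \<in> topspace Y" for u y
    using \<nu>(1)[OF that(1)] that(2) unfolding continuous_map_Prob_iff by blast
  have \<nu>c: "continuous_map Y euclideanreal (\<lambda>y. \<nu> u y k)" if "u \<in> V" "k \<in> ?St u" for u k
    using \<nu>(1)[OF that(1)] that(2) unfolding continuous_map_Prob_iff by simp
  have StG: "?St u \<subseteq> carrier G" for u by (auto simp: stabilizer_def)
  \<comment> \<open>The image of the measure at \<open>inv (\<sigma> v)\<close> applied to
    \<open>y\<close> under left multiplication by \<open>\<sigma> v\<close>; it lives on the coset
    of the stabilizer of \<open>r v\<close> that moves \<open>r v\<close> to
    \<open>v\<close>.\<close>
  define m where "m v y = (\<lambda>g\<in>carrier G. if inv\<^bsub>G\<^esub> (\<sigma> v) \<otimes>\<^bsub>G\<^esub> g \<in> ?St (r v)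
      then \<nu> (r v) (\<psi> (inv\<^bsub>G\<^esub> (\<sigma> v)) y) (inv\<^bsub>G\<^esub> (\<sigma> v) \<otimes>\<^bsub>G\<^esub> g) else 0)" for v y
  have "continuous_map Y (Prob_topology G) (m v)" if v: "v \<in> V" for v
    unfolding continuous_map_Prob_iff
  proof (intro conjI ballI)
    note i\<sigma> = inv_closed[OF \<sigma>(1)[OF v]]
    fix y assume y: "y \<in> topspace Y"
    let ?w = "\<psi> (inv\<^bsub>G\<^esub> (\<sigma> v)) y"
    have w: "?w \<in> topspace Y" using group_action_closed[OF \<psi>' i\<sigma> y] .
    note P = \<nu>P[OF rV[OF v] w]
    have "(\<nu> (r v) ?w has_sum 1) (?St (r v))" using Prob_has_sum[OF P] by simp
    from has_sum_left_coset[OF G i\<sigma> StG this]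
    have "(m v y has_sum 1) (carrier G)"
      by (rule has_sum_cong[THEN iffD1, rotated]) (simp add: m_def)
    moreover have "0 \<le> m v y g" if "g \<in> carrier G" for g
      using Prob_nonneg[OF P] that by (simp add: m_def)
    ultimately show "m v y \<in> Prob G" by (simp add: Prob_def m_def)
  next
    note i\<sigma> = inv_closed[OF \<sigma>(1)[OF v]]
    fix g assume g: "g \<in> carrier G"
    show "continuous_map Y euclideanreal (\<lambda>y. m v y g)"
    proof (cases "inv\<^bsub>G\<^esub> (\<sigma> v) \<otimes>\<^bsub>G\<^esub> g \<in> ?St (r v)")
      case True
      then show ?thesis
        using continuous_map_compose[OF \<psi>c[OF i\<sigma>] \<nu>c[OF rV[OF v] True]] g by (simp add: m_def o_def)
    qed (use g in \<open>simp add: m_def\<close>)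
  qed
  moreover have "l1_dist G (translate G s (m v y)) (m (\<phi> s v) (\<psi> s y)) \<le> \<epsilon>"
    if v: "v \<in> W" and s: "s \<in> F" and y: "y \<in> topspace Y" for v s y
  proof -
    have vV: "v \<in> V" and sG: "s \<in> carrier G" using v s W F by auto
    define u where "u = r v"
    define \<tau> where "\<tau> = t s v"
    define w where "w = \<psi> (inv\<^bsub>G\<^esub> (\<sigma> v)) y"
    define \<rho> where "\<rho> = \<sigma> (\<phi> s v)"
    note sv' = sv[OF sG vV]
    have cl: "\<sigma> v \<in> carrier G" "\<rho> \<in> carrier G" "\<tau> \<in> carrier G" "u \<in> V"
      using \<sigma> vV sv' t_stab[OF sG vV] StG rV by (auto simp: u_def \<tau>_def \<rho>_def)
    have \<tau>: "\<tau> = inv\<^bsub>G\<^esub> \<rho> \<otimes>\<^bsub>G\<^esub> (s \<otimes>\<^bsub>G\<^esub> \<sigma> v)" by (simp add: \<tau>_def t_def \<rho>_def)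
    have \<tau>T: "\<tau> \<in> T u" using v s by (auto simp: T_def u_def \<tau>_def)
    have \<tau>S: "\<tau> \<in> ?St u" using Tsub \<tau>T by blast
    have w: "w \<in> topspace Y" unfolding w_def using group_action_closed[OF \<psi>' _ y] cl by simp
    have sub: "subgroup (?St u) G" using group_action.stabilizer_subgroup[OF \<phi> cl(4)] .
    have inv\<tau>: "inv\<^bsub>?H u\<^esub> \<tau> = inv\<^bsub>G\<^esub> \<tau>" using m_inv_consistent[OF sub \<tau>S] .
    have yw: "\<psi> (\<sigma> v) w = y" unfolding w_def using group_action_inv(2)[OF \<psi>' cl(1) y] .
    have target: "\<psi> (inv\<^bsub>G\<^esub> \<rho>) (\<psi> s y) = \<psi> \<tau> w"
    proof -
      have "\<psi> \<tau> w = \<psi> (inv\<^bsub>G\<^esub> \<rho>) (\<psi> s (\<psi> (\<sigma> v) w))"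
        unfolding \<tau> using cl sG w by (simp add: group_action.composition_rule[OF \<psi>' w])
      then show ?thesis using yw by simp
    qed
    let ?h = "\<lambda>k. \<bar>\<nu> u w (inv\<^bsub>G\<^esub> \<tau> \<otimes>\<^bsub>G\<^esub> k) - \<nu> u (\<psi> \<tau> w) k\<bar>"
    have pt: "\<bar>translate G s (m v y) g - m (\<phi> s v) (\<psi> s y) g\<bar> =
        (if inv\<^bsub>G\<^esub> \<rho> \<otimes>\<^bsub>G\<^esub> g \<in> ?St u then ?h (inv\<^bsub>G\<^esub> \<rho> \<otimes>\<^bsub>G\<^esub> g) else 0)" if g: "g \<in> carrier G" for g
    proof -
      let ?k = "inv\<^bsub>G\<^esub> \<rho> \<otimes>\<^bsub>G\<^esub> g"
      have e: "inv\<^bsub>G\<^esub> \<tau> \<otimes>\<^bsub>G\<^esub> ?k = inv\<^bsub>G\<^esub> (\<sigma> v) \<otimes>\<^bsub>G\<^esub> (inv\<^bsub>G\<^esub> s \<otimes>\<^bsub>G\<^esub> g)"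
      proof -
        have "inv\<^bsub>G\<^esub> \<tau> = inv\<^bsub>G\<^esub> (\<sigma> v) \<otimes>\<^bsub>G\<^esub> inv\<^bsub>G\<^esub> s \<otimes>\<^bsub>G\<^esub> \<rho>"
          unfolding \<tau> using cl sG by (simp add: inv_mult_group m_assoc)
        then show ?thesis using cl sG g by (simp add: m_assoc flip: m_assoc[of \<rho>])
      qed
      \<comment> \<open>Both measures live on the same coset, so the distance in the group is a
        distance in the stabilizer, reindexed by left multiplication.\<close>
      have iff: "inv\<^bsub>G\<^esub> \<tau> \<otimes>\<^bsub>G\<^esub> ?k \<in> ?St u \<longleftrightarrow> ?k \<in> ?St u"
      proof
        assume "inv\<^bsub>G\<^esub> \<tau> \<otimes>\<^bsub>G\<^esub> ?k \<in> ?St u"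
        then have "\<tau> \<otimes>\<^bsub>G\<^esub> (inv\<^bsub>G\<^esub> \<tau> \<otimes>\<^bsub>G\<^esub> ?k) \<in> ?St u"
          using subgroup.m_closed[OF sub \<tau>S] by blast
        then show "?k \<in> ?St u" using cl g by (simp flip: m_assoc)
      next
        assume "?k \<in> ?St u"
        then show "inv\<^bsub>G\<^esub> \<tau> \<otimes>\<^bsub>G\<^esub> ?k \<in> ?St u"
          using subgroup.m_closed[OF sub subgroup.m_inv_closed[OF sub \<tau>S]] by blast
      qed
      have "translate G s (m v y) g = (if inv\<^bsub>G\<^esub> \<tau> \<otimes>\<^bsub>G\<^esub> ?k \<in> ?St u then \<nu> u w (inv\<^bsub>G\<^esub> \<tau> \<otimes>\<^bsub>G\<^esub> ?k) else 0)"
        unfolding translate_def e using g sG by (simp add: m_def u_def w_def)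
      moreover have "m (\<phi> s v) (\<psi> s y) g = (if ?k \<in> ?St u then \<nu> u (\<psi> \<tau> w) ?k else 0)"
        using g r_trans[OF sG vV] by (simp add: m_def u_def \<rho>_def target[unfolded \<rho>_def])
      ultimately show ?thesis unfolding iff by simp
    qed
    let ?l = "\<lambda>k. \<bar>translate (?H u) \<tau> (\<nu> u w) k - \<nu> u (\<psi> \<tau> w) k\<bar>"
    have gH: "group (?H u)" using subgroup.subgroup_is_group[OF sub G] .
    have \<tau>w: "\<psi> \<tau> w \<in> topspace Y" using group_action_closed[OF \<psi>' cl(3) w] .
    have "translate (?H u) \<tau> (\<nu> u w) \<in> Prob (?H u)"
      using translate_Prob[OF gH _ \<nu>P[OF cl(4) w]] \<tau>S by simp
    then have "?l summable_on ?St u"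
      using l1_summable[OF _ \<nu>P[OF cl(4) \<tau>w]] by simp
    then have "(?l has_sum l1_dist (?H u) (translate (?H u) \<tau> (\<nu> u w)) (\<nu> u (\<psi> \<tau> w))) (?St u)"
      by (simp add: l1_dist_def)
    then have "(?h has_sum l1_dist (?H u) (translate (?H u) \<tau> (\<nu> u w)) (\<nu> u (\<psi> \<tau> w))) (?St u)"
      by (rule has_sum_cong[THEN iffD1, rotated]) (simp add: translate_def inv\<tau>)
    from has_sum_left_coset[OF G inv_closed[OF cl(2)] StG this]
    have "((\<lambda>g. \<bar>translate G s (m v y) g - m (\<phi> s v) (\<psi> s y) g\<bar>) has_sum
        l1_dist (?H u) (translate (?H u) \<tau> (\<nu> u w)) (\<nu> u (\<psi> \<tau> w))) (carrier G)"
      by (rule has_sum_cong[THEN iffD1, rotated]) (simp add: pt)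
    then have "l1_dist G (translate G s (m v y)) (m (\<phi> s v) (\<psi> s y)) =
        l1_dist (?H u) (translate (?H u) \<tau> (\<nu> u w)) (\<nu> u (\<psi> \<tau> w))"
      unfolding l1_dist_def[of G] by (rule infsumI)
    then show ?thesis using \<nu>(2)[OF cl(4) \<tau>T w] by simp
  qed
  ultimately show ?thesis by blast
qed

section \<open>Mixing the transported measures\<close>

lemma has_sum_finite_sum:
  fixes h :: "'a \<Rightarrow> 'b \<Rightarrow> real"
  assumes "finite I" "\<And>i. i \<in> I \<Longrightarrow> (h i has_sum c i) B"
  shows "((\<lambda>x. \<Sum>i\<in>I. h i x) has_sum (\<Sum>i\<in>I. c i)) B"
  using assms by (induction I rule: finite_induct) (auto intro: has_sum_add)

text \<open>The measure at (x, y) is the mixture of the \<open>m v y\<close> with weights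
  \<open>\<zeta> x v\<close>. The error splits into that of the \<open>m v y\<close>, averaged with
  probability weights, and that of the weights, multiplied by probability measures; each gets half
  of \<epsilon>.\<close>

lemma amenable_diagonal_action:
  fixes V :: "'v set"
  assumes \<phi>: "group_action G V \<phi>" and \<theta>: "topological_action G X \<theta>" and \<psi>: "topological_action G Y \<psi>"
    and am: "\<And>x. x \<in> V \<Longrightarrow> amenable_action (G\<lparr>carrier := stabilizer G \<phi> x\<rparr>) Y \<psi>"
    and meas: "\<And>F \<epsilon>. finite F \<Longrightarrow> F \<subseteq> carrier G \<Longrightarrow> 0 < \<epsilon> \<Longrightarrow> \<exists>K \<zeta>. finite K \<and> K \<subseteq> V \<and>
      (\<forall>v\<in>V. continuous_map X euclideanreal (\<lambda>x. \<zeta> x v)) \<and>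
      (\<forall>x\<in>topspace X. (\<forall>v\<in>V. 0 \<le> \<zeta> x v) \<and> (\<forall>v\<in>V - K. \<zeta> x v = 0) \<and> (\<Sum>v\<in>K. \<zeta> x v) = 1 \<and>
        (\<forall>s\<in>F. \<forall>\<Omega>. finite \<Omega> \<and> \<Omega> \<subseteq> V \<longrightarrow>
          (\<Sum>v\<in>\<Omega>. \<bar>\<zeta> x (\<phi> (inv\<^bsub>G\<^esub> s) v) - \<zeta> (\<theta> s x) v\<bar>) \<le> \<epsilon>))"
  shows "amenable_action G (prod_topology X Y) (diagonal_action X \<theta> Y \<psi>)"
  unfolding amenable_action_def
proof (intro allI impI, elim conjE)
  fix F and \<epsilon> :: real
  assume F: "finite F" "F \<subseteq> carrier G" and \<epsilon>: "0 < \<epsilon>"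
  note G = group_action_group[OF \<phi>]
  interpret group G by (rule G)
  have \<theta>': "group_action G (topspace X) \<theta>" and \<psi>': "group_action G (topspace Y) \<psi>"
    using \<theta> \<psi> by (auto simp: topological_action_def)
  have e2: "0 < \<epsilon> / 2" using \<epsilon> by simp
  from meas[OF F e2] obtain K \<zeta> where "finite K \<and> K \<subseteq> V \<and>
      (\<forall>v\<in>V. continuous_map X euclideanreal (\<lambda>x. \<zeta> x v)) \<and>
      (\<forall>x\<in>topspace X. (\<forall>v\<in>V. 0 \<le> \<zeta> x v) \<and> (\<forall>v\<in>V - K. \<zeta> x v = 0) \<and> (\<Sum>v\<in>K. \<zeta> x v) = 1 \<and>
        (\<forall>s\<in>F. \<forall>\<Omega>. finite \<Omega> \<and> \<Omega> \<subseteq> V \<longrightarrow>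
          (\<Sum>v\<in>\<Omega>. \<bar>\<zeta> x (\<phi> (inv\<^bsub>G\<^esub> s) v) - \<zeta> (\<theta> s x) v\<bar>) \<le> \<epsilon> / 2))"
    by (elim exE)
  then have K: "finite K" "K \<subseteq> V"
    and \<zeta>c: "\<And>v. v \<in> V \<Longrightarrow> continuous_map X euclideanreal (\<lambda>x. \<zeta> x v)"
    and \<zeta>: "\<And>x v. x \<in> topspace X \<Longrightarrow> v \<in> V \<Longrightarrow> 0 \<le> \<zeta> x v"
      "\<And>x v. x \<in> topspace X \<Longrightarrow> v \<in> V - K \<Longrightarrow> \<zeta> x v = 0"
      "\<And>x. x \<in> topspace X \<Longrightarrow> (\<Sum>v\<in>K. \<zeta> x v) = 1"
    and \<zeta>e: "\<And>x s \<Omega>. x \<in> topspace X \<Longrightarrow> s \<in> F \<Longrightarrow> finite \<Omega> \<Longrightarrow> \<Omega> \<subseteq> V \<Longrightarrow>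
      (\<Sum>v\<in>\<Omega>. \<bar>\<zeta> x (\<phi> (inv\<^bsub>G\<^esub> s) v) - \<zeta> (\<theta> s x) v\<bar>) \<le> \<epsilon> / 2"
    by simp_all
  obtain m where mc: "\<And>v. v \<in> V \<Longrightarrow> continuous_map Y (Prob_topology G) (m v)"
    and me: "\<And>v s y. v \<in> K \<Longrightarrow> s \<in> F \<Longrightarrow> y \<in> topspace Y \<Longrightarrow>
      l1_dist G (translate G s (m v y)) (m (\<phi> s v) (\<psi> s y)) \<le> \<epsilon> / 2"
    using stabilizer_measures[OF \<phi> \<psi> am K F e2] by blast
  have mP: "m v y \<in> Prob G" if "v \<in> V" "y \<in> topspace Y" for v y
    using mc[OF that(1)] that(2) unfolding continuous_map_Prob_iff by blast
  define \<mu> where "\<mu> p = (\<lambda>g\<in>carrier G. \<Sum>v\<in>K. \<zeta> (fst p) v * m v (snd p) g)" for p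
  have "continuous_map (prod_topology X Y) (Prob_topology G) \<mu>"
    unfolding continuous_map_Prob_iff
  proof (intro conjI ballI)
    fix p assume "p \<in> topspace (prod_topology X Y)"
    then have p: "fst p \<in> topspace X" "snd p \<in> topspace Y" by auto
    have "((\<lambda>g. \<Sum>v\<in>K. \<zeta> (fst p) v * m v (snd p) g) has_sum (\<Sum>v\<in>K. \<zeta> (fst p) v * 1)) (carrier G)"
      using K p mP by (intro has_sum_finite_sum has_sum_cmult_right Prob_has_sum) auto
    then have "(\<mu> p has_sum 1) (carrier G)"
      unfolding \<mu>_def mult_1_right \<zeta>(3)[OF p(1)] by (rule has_sum_cong[THEN iffD1, rotated]) simp
    moreover have "0 \<le> \<mu> p g" if "g \<in> carrier G" for g
      using that p K \<zeta>(1) Prob_nonneg[OF mP] by (auto simp: \<mu>_def intro!: sum_nonneg mult_nonneg_nonneg)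
    ultimately show "\<mu> p \<in> Prob G" by (simp add: Prob_def \<mu>_def)
  next
    fix g assume g: "g \<in> carrier G"
    have "continuous_map (prod_topology X Y) euclideanreal (\<lambda>p. \<Sum>v\<in>K. \<zeta> (fst p) v * m v (snd p) g)"
    proof (intro continuous_map_sum continuous_map_real_mult K)
      fix v assume "v \<in> K"
      then have v: "v \<in> V" using K by blast
      show "continuous_map (prod_topology X Y) euclideanreal (\<lambda>p. \<zeta> (fst p) v)"
        using continuous_map_compose[OF continuous_map_fst \<zeta>c[OF v]] by (simp add: o_def)
      have "continuous_map Y euclideanreal (\<lambda>y. m v y g)"
        using mc[OF v] g unfolding continuous_map_Prob_iff by blast
      then show "continuous_map (prod_topology X Y) euclideanreal (\<lambda>p. m v (snd p) g)"
        using continuous_map_compose[OF continuous_map_snd] by (fastforce simp: o_def)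
    qed
    then show "continuous_map (prod_topology X Y) euclideanreal (\<lambda>p. \<mu> p g)"
      using g by (simp add: \<mu>_def)
  qed
  moreover have "l1_dist G (translate G s (\<mu> p)) (\<mu> (diagonal_action X \<theta> Y \<psi> s p)) \<le> \<epsilon>"
    if s: "s \<in> F" and p: "p \<in> topspace (prod_topology X Y)" for s p
  proof -
    obtain x y where xy: "p = (x, y)" "x \<in> topspace X" "y \<in> topspace Y" using p by auto
    have sG: "s \<in> carrier G" using s F by blast
    let ?x = "\<theta> s x" and ?y = "\<psi> s y" and ?\<sigma> = "\<phi> (inv\<^bsub>G\<^esub> s)"
    have x': "?x \<in> topspace X" and y': "?y \<in> topspace Y"
      using group_action_closed[OF \<theta>' sG xy(2)] group_action_closed[OF \<psi>' sG xy(3)] by auto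
    have diag: "diagonal_action X \<theta> Y \<psi> s p = (?x, ?y)"
      using xy by (simp add: diagonal_action_def)
    define \<Omega> where "\<Omega> = K \<union> \<phi> s ` K"
    have \<Omega>: "finite \<Omega>" "\<Omega> \<subseteq> V"
      using K group_action_closed[OF \<phi> sG] by (auto simp: \<Omega>_def)
    have \<sigma>V: "?\<sigma> v \<in> V" if "v \<in> V" for v using group_action_closed[OF \<phi> inv_closed[OF sG] that] .
    have inj: "inj_on (\<phi> s) K"
      by (rule inj_on_inverseI[of _ ?\<sigma>]) (use group_action_inv(1)[OF \<phi> sG] K in auto)
    have outside: "\<zeta> x (?\<sigma> v) = 0" if v: "v \<in> \<Omega> - \<phi> s ` K" for v
    proof -
      have vV: "v \<in> V" using v \<Omega> by blast
      then have "?\<sigma> v \<notin> K" using v group_action_inv(2)[OF \<phi> sG vV] by (metis DiffD2 imageI)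
      then show ?thesis using \<zeta>(2)[OF xy(2)] \<sigma>V[OF vV] by blast
    qed
    have reindex: "(\<Sum>v\<in>\<Omega>. \<zeta> x (?\<sigma> v) * h (?\<sigma> v)) = (\<Sum>v\<in>K. \<zeta> x v * h v)" for h :: "'v \<Rightarrow> real"
    proof -
      have "(\<Sum>v\<in>\<Omega>. \<zeta> x (?\<sigma> v) * h (?\<sigma> v)) = (\<Sum>v\<in>\<phi> s ` K. \<zeta> x (?\<sigma> v) * h (?\<sigma> v))"
        using \<Omega> outside by (intro sum.mono_neutral_right) (auto simp: \<Omega>_def)
      also have "\<dots> = (\<Sum>v\<in>K. \<zeta> x v * h v)"
        using K group_action_inv(1)[OF \<phi> sG] by (subst sum.reindex[OF inj]) (auto intro!: sum.cong)
      finally show ?thesis .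
    qed
    let ?T = "\<lambda>v. translate G s (m (?\<sigma> v) y)"
    have TP: "?T v \<in> Prob G" if "v \<in> V" for v
      using translate_Prob[OF G sG mP[OF \<sigma>V[OF that] xy(3)]] .
    have lhs: "translate G s (\<mu> p) g = (\<Sum>v\<in>\<Omega>. \<zeta> x (?\<sigma> v) * ?T v g)" if g: "g \<in> carrier G" for g
      using reindex[of "\<lambda>v. translate G s (m v y) g"] g sG by (simp add: translate_def \<mu>_def xy)
    have rhs: "\<mu> (?x, ?y) g = (\<Sum>v\<in>\<Omega>. \<zeta> ?x v * m v ?y g)" if g: "g \<in> carrier G" for g
    proof -
      have "(\<Sum>v\<in>\<Omega>. \<zeta> ?x v * m v ?y g) = (\<Sum>v\<in>K. \<zeta> ?x v * m v ?y g)"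
        using \<Omega> \<zeta>(2)[OF x'] by (intro sum.mono_neutral_right) (auto simp: \<Omega>_def)
      then show ?thesis using g by (simp add: \<mu>_def)
    qed
    let ?B = "\<lambda>g. (\<Sum>v\<in>\<Omega>. \<zeta> x (?\<sigma> v) * \<bar>?T v g - m v ?y g\<bar>) +
        (\<Sum>v\<in>\<Omega>. \<bar>\<zeta> x (?\<sigma> v) - \<zeta> ?x v\<bar> * m v ?y g)"
    have pt: "\<bar>translate G s (\<mu> p) g - \<mu> (?x, ?y) g\<bar> \<le> ?B g" if g: "g \<in> carrier G" for g
    proof -
      have eq: "translate G s (\<mu> p) g - \<mu> (?x, ?y) g =
          (\<Sum>v\<in>\<Omega>. \<zeta> x (?\<sigma> v) * (?T v g - m v ?y g) + (\<zeta> x (?\<sigma> v) - \<zeta> ?x v) * m v ?y g)"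
        unfolding lhs[OF g] rhs[OF g] sum_subtractf[symmetric] by (intro sum.cong) (auto simp: algebra_simps)
      show ?thesis
        unfolding eq sum.distrib[symmetric]
      proof (rule order_trans[OF sum_abs sum_mono])
        fix v assume "v \<in> \<Omega>"
        then have v: "v \<in> V" using \<Omega> by blast
        then have "0 \<le> \<zeta> x (?\<sigma> v)" "0 \<le> m v ?y g"
          using \<zeta>(1)[OF xy(2) \<sigma>V[OF v]] Prob_nonneg[OF mP[OF v y'] g] by auto
        then show "\<bar>\<zeta> x (?\<sigma> v) * (?T v g - m v ?y g) + (\<zeta> x (?\<sigma> v) - \<zeta> ?x v) * m v ?y g\<bar>
            \<le> \<zeta> x (?\<sigma> v) * \<bar>?T v g - m v ?y g\<bar> + \<bar>\<zeta> x (?\<sigma> v) - \<zeta> ?x v\<bar> * m v ?y g"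
          by (intro order_trans[OF abs_triangle_ineq]) (simp add: abs_mult)
      qed
    qed
    have "((\<lambda>g. \<bar>?T v g - m v ?y g\<bar>) has_sum l1_dist G (?T v) (m v ?y)) (carrier G)" if "v \<in> \<Omega>" for v
      using l1_summable[OF TP mP[OF _ y']] that \<Omega> unfolding l1_dist_def by (intro has_sum_infsum) blast
    then have hB: "(?B has_sum (\<Sum>v\<in>\<Omega>. \<zeta> x (?\<sigma> v) * l1_dist G (?T v) (m v ?y)) +
        (\<Sum>v\<in>\<Omega>. \<bar>\<zeta> x (?\<sigma> v) - \<zeta> ?x v\<bar> * 1)) (carrier G)"
      using \<Omega> mP[OF _ y'] by (intro has_sum_add has_sum_finite_sum has_sum_cmult_right Prob_has_sum) auto
    have "translate G s (\<mu> p) \<in> Prob G" "\<mu> (?x, ?y) \<in> Prob G"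
      using translate_Prob[OF G sG] \<open>continuous_map (prod_topology X Y) (Prob_topology G) \<mu>\<close> p x' y'
      unfolding continuous_map_Prob_iff by auto
    then have hL: "((\<lambda>g. \<bar>translate G s (\<mu> p) g - \<mu> (?x, ?y) g\<bar>) has_sum
        l1_dist G (translate G s (\<mu> p)) (\<mu> (?x, ?y))) (carrier G)"
      using l1_summable unfolding l1_dist_def by (intro has_sum_infsum) blast
    have "l1_dist G (translate G s (\<mu> p)) (\<mu> (?x, ?y)) \<le>
        (\<Sum>v\<in>\<Omega>. \<zeta> x (?\<sigma> v) * l1_dist G (?T v) (m v ?y)) + (\<Sum>v\<in>\<Omega>. \<bar>\<zeta> x (?\<sigma> v) - \<zeta> ?x v\<bar> * 1)"
      by (rule has_sum_mono[OF hL hB pt])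
    also have "(\<Sum>v\<in>\<Omega>. \<bar>\<zeta> x (?\<sigma> v) - \<zeta> ?x v\<bar> * 1) \<le> \<epsilon> / 2"
      using \<zeta>e[OF xy(2) s \<Omega>] by simp
    also have "(\<Sum>v\<in>\<Omega>. \<zeta> x (?\<sigma> v) * l1_dist G (?T v) (m v ?y)) \<le> (\<Sum>v\<in>\<Omega>. \<zeta> x (?\<sigma> v) * (\<epsilon> / 2))"
    proof (rule sum_mono)
      fix v assume v: "v \<in> \<Omega>"
      then have vV: "v \<in> V" using \<Omega> by blast
      show "\<zeta> x (?\<sigma> v) * l1_dist G (?T v) (m v ?y) \<le> \<zeta> x (?\<sigma> v) * (\<epsilon> / 2)"
      \<comment> \<open>Off \<open>K\<close> the weight is zero, so almost invariance of the
        transported measures at the finitely many vertices of \<open>K\<close> suffices.\<close>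
      proof (cases "?\<sigma> v \<in> K")
        case True
        then have "l1_dist G (?T v) (m v ?y) \<le> \<epsilon> / 2"
          using me[OF True s xy(3)] group_action_inv(2)[OF \<phi> sG vV] by simp
        then show ?thesis using \<zeta>(1)[OF xy(2) \<sigma>V[OF vV]] by (rule mult_left_mono)
      qed (use \<zeta>(2)[OF xy(2)] \<sigma>V[OF vV] in simp)
    qed
    also have "(\<Sum>v\<in>\<Omega>. \<zeta> x (?\<sigma> v) * (\<epsilon> / 2)) = \<epsilon> / 2"
      using reindex[of "\<lambda>_. 1"] \<zeta>(3)[OF xy(2)] unfolding sum_distrib_right[symmetric] by simp
    finally show ?thesis by (simp add: diag)
  qed
  ultimately show "\<exists>\<mu>. continuous_map (prod_topology X Y) (Prob_topology G) \<mu> \<and>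
      (\<forall>s\<in>F. \<forall>p\<in>topspace (prod_topology X Y). l1_dist G (translate G s (\<mu> p)) (\<mu> (diagonal_action X \<theta> Y \<psi> s p)) \<le> \<epsilon>)"
    by blast
qed

section \<open>Equivariance\<close>

context graph_group_action
begin

lemma Circ_map:
  assumes g: "g \<in> carrier \<Gamma>" and e': "e' \<in> Circ n e"
  shows "\<phi> g ` e' \<in> Circ n (\<phi> g ` e)"
proof -
  obtain p where p: "circuit p" "length p - 1 \<le> n" "path_contains_edge p e" "path_contains_edge p e'" "e' \<in> E"
    using e' by (auto simp: Circ_def)
  have ne: "p \<noteq> []" and pV: "set p \<subseteq> V" and fp: "finite_path p"
    using p(1) by (auto simp: circuit_def finite_path_def)
  have "set (butlast p) \<subseteq> V" using pV in_set_butlastD by fastforce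
  then have "inj_on (\<phi> g) (set (butlast p))"
    using inj_prop[OF g] inj_on_subset by blast
  then have "circuit (map (\<phi> g) p)"
    using p(1) ne finite_path_map[OF g fp]
    by (auto simp: circuit_def hd_map last_map distinct_map map_butlast[symmetric])
  moreover have con: "path_contains_edge (map (\<phi> g) p) (\<phi> g ` e0)" if e0: "path_contains_edge p e0" for e0
  proof -
    from e0 obtain i where "Suc i < length p" "{p ! i, p ! Suc i} = e0"
      unfolding path_contains_edge_def by blast
    then show ?thesis unfolding path_contains_edge_def by (intro exI[of _ i]) auto
  qed
  moreover have "\<phi> g ` e' \<in> E"
  proof -
    obtain x y where "x \<in> V" "y \<in> V" "e' = {x, y}" using edges[OF p(5)] by blast
    then show ?thesis using automorphism[OF g, of x y] p(5) by simp
  qed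
  ultimately show ?thesis
    unfolding Circ_def using p by (intro CollectI exI[of _ "map (\<phi> g) p"]) auto
qed

lemma cvert_map: "g \<in> carrier \<Gamma> \<Longrightarrow> p \<in> cvert n e \<Longrightarrow> \<phi> g p \<in> cvert n (\<phi> g ` e)"
  using Circ_map unfolding cvert_def by blast

lemma delta_action_in: "g \<in> carrier \<Gamma> \<Longrightarrow> z \<in> delta_set \<Longrightarrow> delta_action g z \<in> delta_set"
  using raw_in by (simp add: delta_action_def)

lemma Geo_map:
  assumes g: "g \<in> carrier \<Gamma>" and h: "Geo y z h"
  shows "Geo (\<phi> g y) (delta_action g z) (\<phi> g \<circ> h)"
proof -
  have V: "y \<in> V" "\<And>i. h i \<in> V" using Geo_source[OF h] Geo_V[OF h] by auto
  have zd: "z \<in> delta_set" using Geo_target[OF h] .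
  have lev: "lev (\<phi> g y) (delta_action g z) i = lev y z i" for i
    using zd V g by (cases z) (auto simp: delta_action_def lev_def graph_dist_phi)
  have "case delta_action g z of Inl x \<Rightarrow> (\<phi> g \<circ> h) (d (\<phi> g y) x) = x | Inr c \<Rightarrow> \<phi> g \<circ> h \<in> c"
    using zd V g h by (cases z) (auto simp: delta_action_def Geo_def graph_dist_phi)
  then show ?thesis
    using h g V delta_action_in[OF g zd] unfolding Geo_def lev
    by (auto simp: in_V graph_dist_phi)
qed

lemma shadow_map:
  assumes g: "g \<in> carrier \<Gamma>" and z: "z \<in> shadow y b"
  shows "delta_action g z \<in> shadow (\<phi> g y) (\<phi> g b)"
proof -
  obtain h where h: "Geo y z h" "b \<in> range h" using z by (auto simp: shadow_def)
  then have "\<phi> g b \<in> range (\<phi> g \<circ> h)" by auto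
  then show ?thesis using Geo_map[OF g h(1)] by (auto simp: shadow_def)
qed

end

locale fine_hyperbolic_action =
  graph_group_action V E \<Gamma> \<phi> + fine_hyperbolic_graph V E \<delta>
  for V :: "'v set" and E :: "'v set set" and \<Gamma> :: "'g monoid" (structure) and \<phi> and \<delta> +
  assumes edge_orbits: "finite (orbits \<Gamma> E (\<lambda>g e. \<phi> g ` e))"
begin

lemma candidates_map:
  assumes g: "g \<in> carrier \<Gamma>" and V: "y \<in> V" "Z \<subseteq> V" "W \<subseteq> E" and p: "p \<in> candidates y Z W L z"
  shows "\<phi> g p \<in> candidates (\<phi> g y) (\<phi> g ` Z) ((\<lambda>e. \<phi> g ` e) ` W) L (delta_action g z)"
proof -
  from p consider (v) "p \<in> Z" "d y p \<le> L" "z \<in> shadow y p"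
    | (e) a b where "{a, b} \<in> W" "d y b = Suc (d y a)" "d y b \<le> L" "z \<in> shadow y b" "p \<in> cvert mu {a, b}"
    unfolding candidates_def by blast
  then show ?thesis
  proof cases
    case v
    then show ?thesis
      using shadow_map[OF g v(3)] V graph_dist_phi[OF g V(1), of p] by (auto simp: candidates_def)
  next
    case e
    then have ab: "a \<in> V" "b \<in> V" using V edge_in_V by blast+
    have "{\<phi> g a, \<phi> g b} \<in> (\<lambda>e. \<phi> g ` e) ` W" using e(1) by (intro image_eqI[of _ _ "{a, b}"]) auto
    moreover have "\<phi> g p \<in> cvert mu {\<phi> g a, \<phi> g b}" using cvert_map[OF g e(5)] by simp
    ultimately show ?thesis
      unfolding candidates_def using e shadow_map[OF g e(4)] graph_dist_phi[OF g V(1)] ab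
      by (intro UnI2 CollectI exI[of _ "\<phi> g a"] exI[of _ "\<phi> g b"]) simp
  qed
qed

text \<open>Finitely many edge orbits turn fineness into one bound for all edges; the sum over
  representatives majorizes their maximum.\<close>

lemma uniformly_fine: "\<exists>c. \<forall>e\<in>E. card (cvert n e) \<le> c"
proof -
  let ?orb = "orbit \<Gamma> (\<lambda>g e. \<phi> g ` e)"
  have "\<forall>Q\<in>orbits \<Gamma> E (\<lambda>g e. \<phi> g ` e). \<exists>e\<in>E. Q = ?orb e" by (auto simp: orbits_def)
  then obtain r where r: "\<And>Q. Q \<in> orbits \<Gamma> E (\<lambda>g e. \<phi> g ` e) \<Longrightarrow> r Q \<in> E \<and> Q = ?orb (r Q)" by metis
  have "card (cvert n e) \<le> (\<Sum>Q\<in>orbits \<Gamma> E (\<lambda>g e. \<phi> g ` e). card (cvert n (r Q)))" if e: "e \<in> E" for e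
  proof -
    have Q: "?orb e \<in> orbits \<Gamma> E (\<lambda>g e. \<phi> g ` e)" using e by (auto simp: orbits_def)
    have "\<phi> \<one> ` e = e"
    proof -
      have "\<phi> \<one> x = x" if "x \<in> e" for x
        using group_action_one[OF group_action_axioms] edge_subset_V[OF e] that by blast
      then show ?thesis by force
    qed
    then have "e \<in> ?orb e"
      unfolding orbit_def using group.is_monoid[OF is_group] monoid.one_closed by fastforce
    then have "e \<in> ?orb (r (?orb e))" using r[OF Q] by simp
    then obtain g where g: "g \<in> carrier \<Gamma>" "e = \<phi> g ` r (?orb e)" by (auto simp: orbit_def)
    let ?e = "r (?orb e)"
    have rE: "?e \<in> E" using r[OF Q] by simp
    have ig: "inv g \<in> carrier \<Gamma>" using group.inv_closed[OF is_group g(1)] .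
    have "cvert n e \<subseteq> \<phi> g ` cvert n ?e"
    proof
      fix v assume v: "v \<in> cvert n e"
      have "\<phi> (inv g) ` e = ?e"
      proof -
        have "\<phi> (inv g) (\<phi> g x) = x" if "x \<in> ?e" for x
          using inv_cancel[OF g(1)] edge_subset_V[OF rE] that by blast
        then show ?thesis by (subst g(2)) (force simp: image_image)
      qed
      then have "\<phi> (inv g) v \<in> cvert n ?e" using cvert_map[OF ig v] by simp
      moreover have "\<phi> g (\<phi> (inv g) v) = v"
        using group_action_inv(2)[OF group_action_axioms g(1)] v cvert_subset_V by blast
      ultimately show "v \<in> \<phi> g ` cvert n ?e" by force
    qed
    then have "card (cvert n e) \<le> card (cvert n ?e)"
      using finite_cvert[OF rE] by (meson card_image_le card_mono finite_imageI le_trans)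
    also have "\<dots> \<le> (\<Sum>Q\<in>orbits \<Gamma> E (\<lambda>g e. \<phi> g ` e). card (cvert n (r Q)))"
      using edge_orbits Q by (intro member_le_sum) auto
    finally show ?thesis .
  qed
  then show ?thesis by blast
qed

lemma dist_words:
  assumes A: "A \<subseteq> carrier \<Gamma>" and y: "y \<in> V" and \<rho>: "\<And>s. s \<in> A \<Longrightarrow> d y (\<phi> s y) \<le> \<rho>"
  shows "w \<in> words \<Gamma> A n \<Longrightarrow> d y (\<phi> w y) \<le> n * \<rho>"
proof (induction n arbitrary: w)
  case 0
  then show ?case using group_action_one[OF group_action_axioms y] y by simp
next
  case (Suc n)
  then obtain v s where w: "w = v \<otimes> s" "v \<in> words \<Gamma> A n" "s \<in> A" by auto
  have G: "v \<in> carrier \<Gamma>" "s \<in> carrier \<Gamma>" using words_closed[OF is_group A] w A by blast+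
  have V: "\<phi> v y \<in> V" "\<phi> s y \<in> V" "\<phi> v (\<phi> s y) \<in> V" using in_V G y by auto
  have "d y (\<phi> w y) \<le> d y (\<phi> v y) + d (\<phi> v y) (\<phi> v (\<phi> s y))"
    using dist_triangle[OF y V(1,3)] composition_rule[OF y G] w(1) by simp
  also have "d (\<phi> v y) (\<phi> v (\<phi> s y)) = d y (\<phi> s y)" by (rule graph_dist_phi[OF G(1) y V(2)])
  finally show ?case using Suc.IH[OF w(2)] \<rho>[OF w(3)] by simp
qed

end

text \<open>By \<open>ln (a + b * N) \<le> ln (a + b) + ln N\<close>, a mass that grows linearly
  with the number of averaging steps is harmless.\<close>

lemma log_over_linear:
  fixes a b :: nat and \<epsilon> :: real
  assumes a: "1 \<le> a" and \<epsilon>: "0 < \<epsilon>"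
  shows "\<exists>N>0. 4 * ln (real (a + b * N)) / N \<le> \<epsilon>"
proof -
  have "(\<lambda>N. 4 * (ln (real (a + b)) / real N + ln (real N) / real N)) \<longlonglongrightarrow> 4 * (0 + 0)"
    by (intro tendsto_intros lim_const_over_n lim_ln_over_n)
  then have "eventually (\<lambda>N. 4 * (ln (real (a + b)) / real N + ln (real N) / real N) < \<epsilon>) sequentially"
    using \<epsilon> by (intro order_tendstoD(2)) auto
  then obtain M where M: "\<And>N. N \<ge> M \<Longrightarrow> 4 * (ln (real (a + b)) / real N + ln (real N) / real N) < \<epsilon>"
    unfolding eventually_sequentially by blast
  define N where "N = max 1 M"
  have le: "real (a + b * N) \<le> real (a + b) * real N"
  proof -
    have "a * 1 \<le> a * N" by (rule mult_le_mono2) (simp add: N_def)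
    then have "a + b * N \<le> (a + b) * N" by (simp add: distrib_right)
    then show ?thesis by (metis of_nat_le_iff of_nat_mult)
  qed
  have p1: "0 < real (a + b * N)" using a by (subst of_nat_0_less_iff) (rule add_pos_nonneg, simp_all)
  have p2: "0 < real (a + b) * real N" using p1 le by linarith
  have "ln (real (a + b * N)) \<le> ln (real (a + b) * real N)"
    using le by (simp only: ln_le_cancel_iff[OF p1 p2])
  also have "\<dots> = ln (real (a + b)) + ln (real N)"
    using a by (intro ln_mult_pos) (auto simp: N_def)
  finally have "4 * ln (real (a + b * N)) / N \<le> 4 * (ln (real (a + b)) / real N + ln (real N) / real N)"
    by (simp add: N_def divide_right_mono flip: add_divide_distrib)
  then show ?thesis
    using M[of N] by (intro exI[of _ N]) (auto simp: N_def)
qed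

section \<open>Almost equivariant measures on the vertices\<close>

context fine_hyperbolic_action
begin

lemma delta_almost_equivariant_measures:
  assumes F: "finite F" "F \<subseteq> carrier \<Gamma>" and \<epsilon>: "0 < \<epsilon>"
  shows "\<exists>K \<zeta>. finite K \<and> K \<subseteq> V \<and>
    (\<forall>v\<in>V. continuous_map delta_topology euclideanreal (\<lambda>x. \<zeta> x v)) \<and>
    (\<forall>x\<in>topspace delta_topology. (\<forall>v\<in>V. 0 \<le> \<zeta> x v) \<and> (\<forall>v\<in>V - K. \<zeta> x v = 0) \<and> (\<Sum>v\<in>K. \<zeta> x v) = 1 \<and>
      (\<forall>s\<in>F. \<forall>\<Omega>. finite \<Omega> \<and> \<Omega> \<subseteq> V \<longrightarrow>
        (\<Sum>v\<in>\<Omega>. \<bar>\<zeta> x (\<phi> (inv s) v) - \<zeta> (delta_action s x) v\<bar>) \<le> \<epsilon>))"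
proof (cases "delta_set = {}")
  case True
  then show ?thesis by (intro exI[of _ "{}"] exI[of _ "\<lambda>_ _. 0"]) simp
next
  case False
  then obtain z where "z \<in> delta_set" by blast
  then obtain y where y: "y \<in> V"
    using boundary_ex boundary_infinite_geodesic unfolding infinite_geodesic_iff
    by (cases z) fastforce+
  interpret \<Gamma>: group \<Gamma> by (rule is_group)
  define A where "A = insert \<one> (F \<union> m_inv \<Gamma> ` F)"
  have A: "finite A" "A \<subseteq> carrier \<Gamma>" "\<one> \<in> A" "\<And>s. s \<in> A \<Longrightarrow> inv s \<in> A" "F \<subseteq> A"
    using F by (auto simp: A_def)
  define \<rho> where "\<rho> = (\<Sum>s\<in>A. d y (\<phi> s y))"
  have \<rho>: "d y (\<phi> s y) \<le> \<rho>" if "s \<in> A" for s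
    unfolding \<rho>_def using A(1) that by (intro member_le_sum) auto
  obtain c where c: "\<And>e. e \<in> E \<Longrightarrow> card (cvert mu e) \<le> c"
    using uniformly_fine[of mu] by blast
  \<comment> \<open>The argument of the logarithm is the mass bound \<open>C\<close> below, expanded
    in \<open>N\<close>. The constants \<open>c\<close> and \<rho> do not depend on
    \<open>N\<close>, so \<open>N\<close> can be chosen before \<open>R\<close> and
    \<open>L\<close>.\<close>
  obtain N where N: "0 < N"
      "4 * ln (real ((1 + (2 * \<rho> + 2 * \<delta> + 2) * (2 ^ c * c)) + 2 * \<rho> * (2 ^ c * c) * N)) / N \<le> \<epsilon>"
    using log_over_linear[of "1 + (2 * \<rho> + 2 * \<delta> + 2) * (2 ^ c * c)" \<epsilon> "2 * \<rho> * (2 ^ c * c)"] \<epsilon> by auto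
  define R where "R = Suc N * \<rho>"
  define L where "L = 2 * R + 2 * \<delta> + 2"
  define C where "C = 1 + L * (2 ^ c * c)"
  have C: "C = (1 + (2 * \<rho> + 2 * \<delta> + 2) * (2 ^ c * c)) + 2 * \<rho> * (2 ^ c * c) * N"
    by (simp add: C_def L_def R_def algebra_simps)
  let ?w = "words \<Gamma> A (Suc N)"
  have w: "finite ?w" "?w \<subseteq> carrier \<Gamma>"
    by (rule finite_words[OF A(1)], rule words_closed[OF is_group A(2)])
  \<comment> \<open>The base points to be synchronized: \<open>v\<close> moves candidates seen from
    \<open>inv v\<close> applied to \<open>y\<close> to candidates seen from \<open>y\<close>, and
    words of length \<open>N + 1\<close> move \<open>y\<close> by at most \<open>R\<close>.\<close>
  define D where "D = insert y ((\<lambda>w. \<phi> (inv w) y) ` ?w)"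
  have D: "finite D" "D \<subseteq> V" "y \<in> D"
    using w y in_V by (auto simp: D_def subset_iff simp del: words.simps)
  have DR: "d y x \<le> R" if "x \<in> D" for x
  proof -
    from that consider "x = y" | v where "v \<in> ?w" "x = \<phi> (inv v) y" unfolding D_def by blast
    then show ?thesis
    proof cases
      case 1
      then show ?thesis using y by simp
    next
      case (2 v)
      then have vG: "v \<in> carrier \<Gamma>" using w by blast
      have "d y x = d (\<phi> v y) (\<phi> v x)"
        using graph_dist_phi[OF vG y in_V[OF \<Gamma>.inv_closed[OF vG] y]] 2 by simp
      also have "\<phi> v x = y" using group_action_inv(2)[OF group_action_axioms vG y] 2 by simp
      also have "d (\<phi> v y) y = d y (\<phi> v y)" by (rule dist_sym[OF in_V[OF vG y] y])
      also have "\<dots> \<le> R" unfolding R_def by (rule dist_words[OF A(2) y \<rho> 2(1)])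
      finally show ?thesis .
    qed
  qed
  obtain Z0 W0 where ZW: "finite Z0" "Z0 \<subseteq> V" "finite W0" "W0 \<subseteq> E"
    and common: "\<And>z. z \<in> delta_set \<Longrightarrow> \<exists>p. \<forall>x\<in>D. p \<in> candidates x Z0 W0 L z"
    using common_point[OF D DR] unfolding L_def by blast
  \<comment> \<open>One pair of sets must serve all translates, so those under all words are
    collected. This leaves the mass bound untouched, since \<open>card_candidates_le\<close> does
    not involve the sizes of these sets.\<close>
  define Z where "Z = (\<Union>v\<in>?w. \<phi> v ` Z0)"
  define W where "W = (\<Union>v\<in>?w. (\<lambda>e. \<phi> v ` e) ` W0)"
  have Z: "finite Z" "Z \<subseteq> V" using ZW w in_V by (auto simp: Z_def subset_iff simp del: words.simps)
  have W: "finite W" "W \<subseteq> E"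
  proof -
    show "finite W" unfolding W_def using ZW(3) w(1) by (intro finite_UN_I finite_imageI)
    have "\<phi> v ` e \<in> E" if v: "v \<in> ?w" and e: "e \<in> W0" for v e
    proof -
      have eE: "e \<in> E" and vG: "v \<in> carrier \<Gamma>" using ZW(4) w(2) v e by blast+
      obtain a b where "e = {a, b}" "a \<in> V" "b \<in> V" using edges[OF eE] by blast
      then show ?thesis using automorphism[OF vG, of a b] eE by simp
    qed
    then show "W \<subseteq> E" unfolding W_def by blast
  qed
  define K where "K = Z \<union> (\<Union>e\<in>W. cvert mu e)"
  have K: "finite K" "K \<subseteq> V"
    using Z W finite_cvert cvert_subset_V unfolding K_def by blast+
  have card: "card {p \<in> K. z \<in> {z. p \<in> candidates y Z W L z}} \<le> C" if "z \<in> topspace delta_topology" for z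
  proof -
    have zd: "z \<in> delta_set" using that by simp
    have "{p \<in> K. z \<in> {z. p \<in> candidates y Z W L z}} \<subseteq> candidates y Z W L z" by auto
    then have "card {p \<in> K. z \<in> {z. p \<in> candidates y Z W L z}} \<le> card (candidates y Z W L z)"
      using card_candidates_le(1)[OF y zd Z(2) W(2) c] by (intro card_mono)
    then show ?thesis using card_candidates_le(2)[OF y zd Z(2) W(2) c, of L] by (simp add: C_def)
  qed
  note words.simps [simp del]
  have "\<exists>u. (\<forall>p\<in>K. continuous_map delta_topology euclideanreal (u p)) \<and>
    (\<forall>z\<in>topspace delta_topology. (\<forall>p\<in>K. 0 \<le> u p z \<and> (z \<in> {z. p \<in> candidates y Z W L z} \<longrightarrow> u p z = 1)) \<and>
      (\<Sum>p\<in>K. u p z) \<le> real C)"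
    by (rule Urysohn_family[OF normal_delta K(1) closedin_candidates[OF y Z(2) W] card])
  then obtain u where u: "\<And>p. p \<in> K \<Longrightarrow> continuous_map delta_topology euclideanreal (u p)"
      "\<And>p z. p \<in> K \<Longrightarrow> z \<in> delta_set \<Longrightarrow> 0 \<le> u p z"
      "\<And>p z. p \<in> K \<Longrightarrow> z \<in> delta_set \<Longrightarrow> p \<in> candidates y Z W L z \<Longrightarrow> u p z = 1"
      "\<And>z. z \<in> delta_set \<Longrightarrow> (\<Sum>p\<in>K. u p z) \<le> real C"
    by auto
  define f where "f z p = (if p \<in> K then u p z else 0)" for z p
  have core: "\<exists>p\<in>V. \<forall>v\<in>?w. 1 \<le> f (delta_action v z) (\<phi> v p)" if z: "z \<in> delta_set" for z
  proof -
    obtain p where p: "\<And>x. x \<in> D \<Longrightarrow> p \<in> candidates x Z0 W0 L z" using common[OF z] by blast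
    have "p \<in> V" using p[OF D(3)] candidates_subset[of y Z0 W0 L z] ZW(2) cvert_subset_V by blast
    moreover have "1 \<le> f (delta_action v z) (\<phi> v p)" if v: "v \<in> ?w" for v
    proof -
      have vG: "v \<in> carrier \<Gamma>" using v w by blast
      let ?x = "\<phi> (inv v) y"
      have xD: "?x \<in> D" using v by (simp add: D_def)
      then have xV: "?x \<in> V" using D by blast
      have sx: "\<phi> v p \<in> candidates (\<phi> v ?x) (\<phi> v ` Z0) ((\<lambda>e. \<phi> v ` e) ` W0) L (delta_action v z)"
        by (rule candidates_map[OF vG xV ZW(2,4) p[OF xD]])
      have vx: "\<phi> v ?x = y" using group_action_inv(2)[OF group_action_axioms vG y] .
      have "\<phi> v ` Z0 \<subseteq> Z" "(\<lambda>e. \<phi> v ` e) ` W0 \<subseteq> W" using v by (auto simp: Z_def W_def)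
      from candidates_mono[OF this] have vp: "\<phi> v p \<in> candidates y Z W L (delta_action v z)"
        using sx unfolding vx by blast
      then have "\<phi> v p \<in> K" using candidates_subset unfolding K_def by blast
      then show ?thesis
        using u(3)[OF _ delta_action_in[OF vG z] vp] by (simp add: f_def)
    qed
    ultimately show ?thesis by blast
  qed
  have bound: "4 * ln (real C) / N \<le> \<epsilon>" using N(2) by (simp add: C)
  have "\<exists>\<zeta>. (\<forall>v\<in>V. continuous_map delta_topology euclideanreal (\<lambda>x. \<zeta> x v)) \<and>
    (\<forall>x\<in>topspace delta_topology. (\<forall>v\<in>V. 0 \<le> \<zeta> x v) \<and> (\<forall>v\<in>V - K. \<zeta> x v = 0) \<and> (\<Sum>v\<in>K. \<zeta> x v) = 1 \<and>
      (\<forall>s\<in>A. \<forall>\<Omega>. finite \<Omega> \<and> \<Omega> \<subseteq> V \<longrightarrow>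
        (\<Sum>v\<in>\<Omega>. \<bar>\<zeta> x (\<phi> (inv s) v) - \<zeta> (delta_action s x) v\<bar>) \<le> 4 * ln (real C) / N))"
  proof (rule almost_equivariant_measures[where f = f, OF group_action_axioms topological_action_delta A(1-4) K])
    show "continuous_map delta_topology euclideanreal (\<lambda>x. f x v)" if "v \<in> V" for v
      using u(1)[of v] by (cases "v \<in> K") (simp_all add: f_def)
    show "(\<Sum>v\<in>K. f x v) \<le> real C" if "x \<in> topspace delta_topology" for x
      using u(4)[of x] that by (simp add: f_def)
  qed (use u(2) N(1) core in \<open>auto simp: f_def\<close>)
  then obtain \<zeta> where \<zeta>: "(\<forall>v\<in>V. continuous_map delta_topology euclideanreal (\<lambda>x. \<zeta> x v)) \<and>
    (\<forall>x\<in>topspace delta_topology. (\<forall>v\<in>V. 0 \<le> \<zeta> x v) \<and> (\<forall>v\<in>V - K. \<zeta> x v = 0) \<and> (\<Sum>v\<in>K. \<zeta> x v) = 1 \<and>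
      (\<forall>s\<in>A. \<forall>\<Omega>. finite \<Omega> \<and> \<Omega> \<subseteq> V \<longrightarrow>
        (\<Sum>v\<in>\<Omega>. \<bar>\<zeta> x (\<phi> (inv s) v) - \<zeta> (delta_action s x) v\<bar>) \<le> 4 * ln (real C) / N))"
    by (elim exE)
  then have "(\<Sum>v\<in>\<Omega>. \<bar>\<zeta> x (\<phi> (inv s) v) - \<zeta> (delta_action s x) v\<bar>) \<le> \<epsilon>"
    if "x \<in> topspace delta_topology" "s \<in> F" "finite \<Omega>" "\<Omega> \<subseteq> V" for x s \<Omega>
    using that A(5) bound by (meson order_trans subsetD)
  then show ?thesis
    using K \<zeta> by (intro exI[of _ K] exI[of _ \<zeta>]) simp
qed

end

lemma (in connected_graph) fine_hyperbolic_graphI: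
  assumes fine_graph hyperbolic_graph
  shows "\<exists>\<delta>. fine_hyperbolic_graph V E \<delta>"
proof -
  obtain \<delta> :: real where \<delta>: "\<delta> > 0" "\<And>z \<alpha> \<beta> k. finite_geodesic \<alpha> \<Longrightarrow> finite_geodesic \<beta> \<Longrightarrow>
      hd \<alpha> = z \<Longrightarrow> hd \<beta> = z \<Longrightarrow> real k \<le> gromov_product (last \<alpha>) (last \<beta>) z \<Longrightarrow>
      real (graph_dist (\<alpha> ! k) (\<beta> ! k)) < \<delta>"
    using assms(2) unfolding hyperbolic_graph_def by blast
  have "d (\<alpha> ! k) (\<beta> ! k) \<le> nat \<lceil>\<delta>\<rceil>"
    if "finite_geodesic \<alpha>" "finite_geodesic \<beta>" "hd \<alpha> = hd \<beta>"
      "real k \<le> gromov_product (last \<alpha>) (last \<beta>) (hd \<alpha>)" for \<alpha> \<beta> k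
    using \<delta>(2)[OF that(1,2) refl that(3)[symmetric] that(4)] by linarith
  then show ?thesis
    using assms(1) by (intro exI[of _ "nat \<lceil>\<delta>\<rceil>"]) unfold_locales
qed

theorem theorem1:
  fixes V :: "'v set" and E :: "'v set set"
    and \<Gamma> :: "'g monoid" and \<phi> :: "'g \<Rightarrow> 'v \<Rightarrow> 'v"
    and Y :: "'y topology" and \<psi> :: "'g \<Rightarrow> 'y \<Rightarrow> 'y"
  assumes "graph_group_action V E \<Gamma> \<phi>"
    and "countable V"
    and "connected_graph.fine_graph V E"
    and "connected_graph.hyperbolic_graph V E"
    and "finite (orbits \<Gamma> V \<phi>)"
    and "finite (orbits \<Gamma> E (\<lambda>g e. \<phi> g ` e))"
    and "compact_space Y" and "Hausdorff_space Y"
    and "topological_action \<Gamma> Y \<psi>"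
    and "\<And>x. x \<in> V \<Longrightarrow> amenable_action (\<Gamma>\<lparr>carrier := stabilizer \<Gamma> \<phi> x\<rparr>) Y \<psi>"
  shows "amenable_action \<Gamma>
    (prod_topology (connected_graph.delta_topology V E) Y)
    (diagonal_action (connected_graph.delta_topology V E)
      (graph_group_action.delta_action V E \<phi>) Y \<psi>)"
proof -
  interpret graph_group_action V E \<Gamma> \<phi> by fact
  obtain \<delta> where "fine_hyperbolic_graph V E \<delta>"
    using fine_hyperbolic_graphI assms(3,4) by blast
  then interpret fine_hyperbolic_graph V E \<delta> .
  interpret fine_hyperbolic_action V E \<Gamma> \<phi> \<delta>
    by unfold_locales (rule assms(6))
  show ?thesis
    by (rule amenable_diagonal_action[OF group_action_axioms topological_action_delta assms(9,10)
          delta_almost_equivariant_measures])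
qed

end
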